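(* Assume consistency and sequential unconfoundedness, and let $\{\pi_\varepsilon\}_{0\le\varepsilon<\bar\varepsilon}$ be a convolutional perturbation path around the baseline policy $\pi$ with kernels $M_{t,\varepsilon}$, forward operators $L_t^*$, backward operators $L_t$ and function classes $\mathcal Q_t\ni q_t$ (all as defined in the context). Assume further that for each stage $t=1,\ldots,T$ the following hold. (i) Moment conditions: $\mathbb E[|\Gamma_t|]<\infty$; $\mathbb E[|H_t(S_t,A_t)\Gamma_t|]<\infty$; and $$\mathbb E\Big[\int_{\mathcal A_t}|q_t(S_t,a)(L_t^*\pi_t)(a\mid S_t)|\,d\lambda(a)\Big]<\infty,\qquad \mathbb E\Big[\int_{\mathcal A_t}|(L_tq_t)(S_t,a)|\,\pi_t(a\mid S_t)\,d\lambda(a)\Big]<\infty.$$ (ii) Dominated convergence for the local path: there exist an integrable random variable $D_t$ and a measurable envelope $\widetilde D_t(s,a_0)$ such that, for all sufficiently small $\varepsilon>0$, $$\int_{\mathcal A_t}\Big|q_t(S_t,a)\frac{\pi_{t,\varepsilon}(a\mid S_t)-\pi_t(a\mid S_t)}{\varepsilon}\Big|\,d\lambda(a)\le D_t,$$ $$\Big|\frac{\int_{\mathcal A_t}q_t(s,a)M_{t,\varepsilon}(a\mid a_0,s)\,d\lambda(a)-q_t(s,a_0)}{\varepsilon}\Big|\le\widetilde D_t(s,a_0),$$ and $$\mathbb E\Big[\int_{\mathcal A_t}\widetilde D_t(S_t,a_0)\,\pi_t(a_0\mid S_t)\,d\lambda(a_0)\Big]<\infty.$$ Then the marginal policy effect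 $$\Theta=\frac{d}{d\varepsilon}\,\mathbb E_\varepsilon\Big[\sum_{k=1}^T\gamma^{k-1}Y_k\Big]\Big|_{\varepsilon=0}$$ exists and satisfies both the forward representation $$\Theta=\sum_{t=1}^T\gamma^{t-1}\mathbb E\big[\langle L_t^*\pi_t,q_t\rangle(S_t)\big]=\sum_{t=1}^T\gamma^{t-1}\mathbb E\big[H_t(S_t,A_t)\Gamma_t\big]$$ and the backward representation $$\Theta=\sum_{t=1}^T\gamma^{t-1}\mathbb E\big[\langle L_tq_t,\pi_t\rangle(S_t)\big]=\sum_{t=1}^T\gamma^{t-1}\mathbb E\big[(L_tq_t)(S_t,A_t)\big].$$
   Context: Setting. Fix a horizon $T\in\mathbb N$ and a discount factor $\gamma\in(0,1]$. A trajectory is $Z=(X_1,A_1,Y_1,\ldots,X_T,A_T,Y_T,X_{T+1})$ with covariates $X_t\in\mathcal X_t$, actions $A_t\in\mathcal A_t$ and outcomes $Y_t\in\mathbb R$. The history before action $t$ is $S_t=(X_1,A_1,Y_1,\ldots,X_{t-1},A_{t-1},Y_{t-1},X_t)\in\mathcal S_t$. No Markov property is assumed. There is a $\sigma$-finite reference measure $\lambda$ on an action space $\mathcal A$, with each $\mathcal A_t$ a measurable subset of $\mathcal A$. A policy $\pi=\{\pi_t\}_{t=1}^T$ is a collection of conditional action distributions $A_t\sim\pi_t(\cdot\mid S_t)$, where $\pi_t(\cdot\mid s)$ is a density (or mass function) with respect to $\lambda$ restricted to $\mathcal A_t$, for almost every $s$. The observed (status-quo) law of $Z$ is $P$, with expectation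 $\mathbb E$; the baseline policy $\pi$ is the status-quo policy, i.e. under $P$, $A_t\mid S_t\sim\pi_t(\cdot\mid S_t)$. Consistency. For each action history $a_{1:t}=(a_1,\ldots,a_t)$ there exist potential outcomes $(X_{t+1}(a_{1:t}),Y_t(a_{1:t}))$ such that, almost surely, $(X_{t+1},Y_t)=(X_{t+1}(A_{1:t}),Y_t(A_{1:t}))$ for $t=1,\ldots,T$. Sequential unconfoundedness. For each $t=1,\ldots,T$ and any $(a_t,\ldots,a_T)$, $A_t$ is conditionally independent of $\{X_{k+1}(A_{1:t-1},a_t,\ldots,a_k),\,Y_k(A_{1:t-1},a_t,\ldots,a_k):k=t,\ldots,T\}$ given $S_t$. Counterfactual laws. For a policy $\pi'$ whose conditional action distributions are absolutely continuous with respect to the status-quo policy, the induced law of the trajectory is given by the $g$-formula $P^{\pi'}(x_{1:T+1},a_{1:T},y_{1:T})=P(x_1)\prod_{t=1}^T\pi'_t(a_t\mid s_t)\,P(x_{t+1},y_t\mid s_t,a_t)$, where $P(x_1)$ and $P(x_{t+1},y_t\mid s_t,a_t)$ are the law of $X_1$ and the conditional law of $(X_{t+1},Y_t)$ given $(S_t,A_t)$ under $P$. Write $\mathbb E_{\varepsilon}$ for expectation under $P^{\pi_\varepsilon}$; $\mathbb E=\mathbb E_0$. Values. $\Gamma_t=\sum_{k=t}^T\gamma^{k-t}Y_k$, and $q_t(s,a)=\mathbb E[\Gamma_t\mid S_t=s,A_t=a]$ is the action-value function under the baseline policy. Convolutional perturbation path. A family of policies $\{\pi_\varepsilon\}_{0\le\varepsilon<\bar\varepsilon}$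 is a convolutional perturbation path around $\pi$ if for each $t$ there is a known family of Markov kernels $M_{t,\varepsilon}(a\mid a_0,s)$, $0\le\varepsilon<\bar\varepsilon$, from baseline actions $a_0\in\mathcal A_t$ to perturbed actions $a\in\mathcal A_t$ (written in density/mass form against $d\lambda(a)$, with Dirac masses allowed by abuse of notation, so that $\int q(s,a)M_{t,\varepsilon}(a\mid a_0,s)\,d\lambda(a)$ means integration against the kernel), such that: (a) $\pi_{t,\varepsilon}(a\mid s)=\int_{\mathcal A_t}M_{t,\varepsilon}(a\mid a_0,s)\,\pi_t(a_0\mid s)\,d\lambda(a_0)$; (b) $M_{t,0}(a\mid a_0,s)=\delta_{a_0}(a)$, so $\pi_{t,0}=\pi_t$; (c) for almost every $s$ and all sufficiently small $\varepsilon>0$, $\pi_t(a\mid s)=0$ implies $\pi_{t,\varepsilon}(a\mid s)=0$ for $\lambda$-almost every $a\in\mathcal A_t$; (d) the path admits a forward operator $(L_t^*\pi_t)(a\mid s)=\lim_{\varepsilon\downarrow0}\{\pi_{t,\varepsilon}(a\mid s)-\pi_t(a\mid s)\}/\varepsilon$, and a backward operator $L_t$ acting on a function class $\mathcal Q_t$ containing $q_t$ by $(L_tq)(s,a_0)=\lim_{\varepsilon\downarrow0}\{\int_{\mathcal A_t}q(s,a)M_{t,\varepsilon}(a\mid a_0,s)\,d\lambda(a)-q(s,a_0)\}/\varepsilon$, $q\in\mathcal Q_t$. Since $\varepsilon\ge0$, the derivative at $\varepsilon=0$ defining $\Theta$ is a right derivative. Further notation. $H_t(s,a)=(L_t^*\pi_t)(a\mid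 s)/\pi_t(a\mid s)$ on $\{\pi_t(a\mid s)>0\}$; $\langle L_t^*\pi_t,q\rangle(s)=\int_{\mathcal A_t}q(s,a)(L_t^*\pi_t)(a\mid s)\,d\lambda(a)$; $\langle L_tq,\pi_t\rangle(s)=\int_{\mathcal A_t}(L_tq)(s,a)\,\pi_t(a\mid s)\,d\lambda(a)$.
   Formalization: Added, since (ii) does not justify the limits: the discounted sum is integrable under P^{π_ε} for small ε, and the likelihood ratio of S_t times q_t(π_{t,ε}−π_t)/ε has an ε-free integrable pointwise envelope. Without it mass escaping to infinity breaks the forward formula. *)

theory Defs
  imports "HOL-Probability.Probability"
begin

section \<open>Trajectories and histories\<close>

text \<open>
  The probability space carries the observed variables as well as the potential outcomes.
  The covariate space \<open>\<X>\<^sub>t\<close> may vary with \<open>t\<close>: it is the measurable space \<open>cov_space M t\<close>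
  on a subset of the type \<open>'x\<close>.
\<close>

record ('w, 'x, 'a) trajectory_model =
  obs :: "'w measure"
  horizon :: nat
  cov_space :: "nat \<Rightarrow> 'x measure"
  ref :: "'a measure"
  acts :: "nat \<Rightarrow> 'a set"
  covariate :: "nat \<Rightarrow> 'w \<Rightarrow> 'x"
  action :: "nat \<Rightarrow> 'w \<Rightarrow> 'a"
  outcome :: "nat \<Rightarrow> 'w \<Rightarrow> real"

text \<open>
  The history \<open>S\<^sub>t\<close> is the triple \<open>(X\<^bsub>1..t\<^esub>, A\<^bsub>1..t-1\<^esub>, Y\<^bsub>1..t-1\<^esub>)\<close> of extensional functions
  on index intervals. In particular the whole trajectory \<open>Z\<close> is the history at time \<open>T + 1\<close>.
\<close>

type_synonym ('x, 'a) history = "(nat \<Rightarrow> 'x) \<times> (nat \<Rightarrow> 'a) \<times> (nat \<Rightarrow> real)"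

type_synonym ('x, 'a) policy = "nat \<Rightarrow> ('x, 'a) history \<Rightarrow> 'a \<Rightarrow> real"

definition act_space :: "('w, 'x, 'a) trajectory_model \<Rightarrow> nat \<Rightarrow> 'a measure" where
  "act_space M t = restrict_space (ref M) (acts M t)"

definition hist_space :: "('w, 'x, 'a) trajectory_model \<Rightarrow> nat \<Rightarrow> ('x, 'a) history measure" where
  "hist_space M t =
     PiM {1..t} (cov_space M) \<Otimes>\<^sub>M (PiM {1..<t} (act_space M) \<Otimes>\<^sub>M PiM {1..<t} (\<lambda>_. borel))"

definition sa_space ::
  "('w, 'x, 'a) trajectory_model \<Rightarrow> nat \<Rightarrow> (('x, 'a) history \<times> 'a) measure" where
  "sa_space M t = hist_space M t \<Otimes>\<^sub>M act_space M t"

definition hist :: "('w, 'x, 'a) trajectory_model \<Rightarrow> nat \<Rightarrow> 'w \<Rightarrow> ('x, 'a) history" where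
  "hist M t \<omega> =
     (\<lambda>k\<in>{1..t}. covariate M k \<omega>, \<lambda>k\<in>{1..<t}. action M k \<omega>, \<lambda>k\<in>{1..<t}. outcome M k \<omega>)"

definition hist_law :: "('w, 'x, 'a) trajectory_model \<Rightarrow> nat \<Rightarrow> ('x, 'a) history measure" where
  "hist_law M t = distr (obs M) (hist_space M t) (hist M t)"

definition sa_law ::
  "('w, 'x, 'a) trajectory_model \<Rightarrow> nat \<Rightarrow> (('x, 'a) history \<times> 'a) measure" where
  "sa_law M t = distr (obs M) (sa_space M t) (\<lambda>\<omega>. (hist M t \<omega>, action M t \<omega>))"

definition is_trajectory_model :: "('w, 'x, 'a) trajectory_model \<Rightarrow> bool" where
  "is_trajectory_model M \<longleftrightarrow>
     prob_space (obs M) \<and> sigma_finite_measure (ref M) \<and>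
     (\<forall>t\<in>{1..horizon M}. acts M t \<in> sets (ref M)) \<and>
     (\<forall>t\<in>{1..horizon M + 1}. covariate M t \<in> measurable (obs M) (cov_space M t)) \<and>
     (\<forall>t\<in>{1..horizon M}. action M t \<in> measurable (obs M) (act_space M t) \<and>
        outcome M t \<in> borel_measurable (obs M))"


section \<open>Policies and the g-formula\<close>

definition is_policy :: "('w, 'x, 'a) trajectory_model \<Rightarrow> ('x, 'a) policy \<Rightarrow> bool" where
  "is_policy M \<pi> \<longleftrightarrow>
     (\<forall>t\<in>{1..horizon M}.
        (\<lambda>(s, a). \<pi> t s a) \<in> borel_measurable (sa_space M t) \<and>
        (AE s in hist_law M t.
           (\<forall>a\<in>space (act_space M t). 0 \<le> \<pi> t s a) \<and>
           (\<integral>\<^sup>+a. ennreal (\<pi> t s a) \<partial>act_space M t) = 1))"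

definition is_status_quo :: "('w, 'x, 'a) trajectory_model \<Rightarrow> ('x, 'a) policy \<Rightarrow> bool" where
  "is_status_quo M \<pi> \<longleftrightarrow>
     (\<forall>t\<in>{1..horizon M}.
        sa_law M t = density (hist_law M t \<Otimes>\<^sub>M act_space M t) (\<lambda>(s, a). ennreal (\<pi> t s a)))"

text \<open>\<open>K t\<close> is a regular version of the conditional law \<open>P(x\<^bsub>t+1\<^esub>, y\<^sub>t | s\<^sub>t, a\<^sub>t)\<close>.\<close>

definition is_transition_law ::
  "('w, 'x, 'a) trajectory_model \<Rightarrow> (nat \<Rightarrow> ('x, 'a) history \<times> 'a \<Rightarrow> ('x \<times> real) measure) \<Rightarrow> bool" where
  "is_transition_law M K \<longleftrightarrow>
     (\<forall>t\<in>{1..horizon M}.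
        K t \<in> measurable (sa_space M t) (prob_algebra (cov_space M (t + 1) \<Otimes>\<^sub>M borel)) \<and>
        (\<forall>B\<in>sets (sa_space M t). \<forall>C\<in>sets (cov_space M (t + 1) \<Otimes>\<^sub>M borel).
           emeasure (obs M) {\<omega>\<in>space (obs M). (hist M t \<omega>, action M t \<omega>) \<in> B \<and>
                               (covariate M (t + 1) \<omega>, outcome M t \<omega>) \<in> C}
           = (\<integral>\<^sup>+h\<in>B. emeasure (K t h) C \<partial>sa_law M t)))"

fun extend_hist :: "nat \<Rightarrow> ('x, 'a) history \<times> 'a \<Rightarrow> 'x \<times> real \<Rightarrow> ('x, 'a) history" where
  "extend_hist t ((x, a, y), b) (x', y') = (x(t + 1 := x'), a(t := b), y(t := y'))"

text \<open>
  \<open>g_law M K \<pi> n\<close> is the law of \<open>S\<^bsub>n+1\<^esub>\<close> under the g-formula, so that \<open>P\<^sup>\<pi>\<close> is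
  \<open>g_law M K \<pi> (horizon M)\<close>. The start is the observed law of \<open>X\<^sub>1\<close>, and stage \<open>t\<close> multiplies
  by \<open>\<pi>\<^sub>t(a\<^sub>t | s\<^sub>t) d\<lambda>(a\<^sub>t) P(dx\<^bsub>t+1\<^esub>, dy\<^sub>t | s\<^sub>t, a\<^sub>t)\<close>.
\<close>

primrec g_law ::
  "('w, 'x, 'a) trajectory_model \<Rightarrow> (nat \<Rightarrow> ('x, 'a) history \<times> 'a \<Rightarrow> ('x \<times> real) measure) \<Rightarrow>
   ('x, 'a) policy \<Rightarrow> nat \<Rightarrow> ('x, 'a) history measure" where
  "g_law M K \<pi> 0 = hist_law M 1"
| "g_law M K \<pi> (Suc n) =
     density (g_law M K \<pi> n \<Otimes>\<^sub>M act_space M (Suc n)) (\<lambda>(s, a). ennreal (\<pi> (Suc n) s a)) \<bind>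
       (\<lambda>h. distr (K (Suc n) h) (hist_space M (Suc (Suc n))) (extend_hist (Suc n) h))"

definition cf_law ::
  "('w, 'x, 'a) trajectory_model \<Rightarrow> (nat \<Rightarrow> ('x, 'a) history \<times> 'a \<Rightarrow> ('x \<times> real) measure) \<Rightarrow>
   ('x, 'a) policy \<Rightarrow> ('x, 'a) history measure" where
  "cf_law M K \<pi> = g_law M K \<pi> (horizon M)"

definition discounted_sum :: "('w, 'x, 'a) trajectory_model \<Rightarrow> real \<Rightarrow> ('x, 'a) history \<Rightarrow> real" where
  "discounted_sum M \<gamma> = (\<lambda>(x, a, y). \<Sum>k\<in>{1..horizon M}. \<gamma> ^ (k - 1) * y k)"


section \<open>Potential outcomes\<close>

text \<open>
  \<open>PX t a\<close> and \<open>PY t a\<close> are \<open>X\<^bsub>t+1\<^esub>(a\<^bsub>1:t\<^esub>)\<close> and \<open>Y\<^sub>t(a\<^bsub>1:t\<^esub>)\<close>, where \<open>a\<close> is an extensional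
  function on \<open>{1..t}\<close>.
\<close>

definition potential_outcomes ::
  "('w, 'x, 'a) trajectory_model \<Rightarrow> (nat \<Rightarrow> (nat \<Rightarrow> 'a) \<Rightarrow> 'w \<Rightarrow> 'x) \<Rightarrow>
   (nat \<Rightarrow> (nat \<Rightarrow> 'a) \<Rightarrow> 'w \<Rightarrow> real) \<Rightarrow> bool" where
  "potential_outcomes M PX PY \<longleftrightarrow>
     (\<forall>t\<in>{1..horizon M}. \<forall>a\<in>space (PiM {1..t} (act_space M)).
        PX t a \<in> measurable (obs M) (cov_space M (t + 1)) \<and> PY t a \<in> borel_measurable (obs M))"

definition consistency ::
  "('w, 'x, 'a) trajectory_model \<Rightarrow> (nat \<Rightarrow> (nat \<Rightarrow> 'a) \<Rightarrow> 'w \<Rightarrow> 'x) \<Rightarrow>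
   (nat \<Rightarrow> (nat \<Rightarrow> 'a) \<Rightarrow> 'w \<Rightarrow> real) \<Rightarrow> bool" where
  "consistency M PX PY \<longleftrightarrow>
     (AE \<omega> in obs M. \<forall>t\<in>{1..horizon M}.
        covariate M (t + 1) \<omega> = PX t (\<lambda>k\<in>{1..t}. action M k \<omega>) \<omega> \<and>
        outcome M t \<omega> = PY t (\<lambda>k\<in>{1..t}. action M k \<omega>) \<omega>)"

definition cond_indep_rv ::
  "'w measure \<Rightarrow> 'u measure \<Rightarrow> ('w \<Rightarrow> 'u) \<Rightarrow> 'v measure \<Rightarrow> ('w \<Rightarrow> 'v) \<Rightarrow> 's measure \<Rightarrow> ('w \<Rightarrow> 's) \<Rightarrow> bool" where
  "cond_indep_rv P N1 U N2 V N3 S \<longleftrightarrow>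
     U \<in> measurable P N1 \<and> V \<in> measurable P N2 \<and> S \<in> measurable P N3 \<and>
     (\<forall>B\<in>sets N1. \<forall>C\<in>sets N2. AE \<omega> in P.
        real_cond_exp P (vimage_algebra (space P) S N3)
          (indicator {\<omega>\<in>space P. U \<omega> \<in> B \<and> V \<omega> \<in> C}) \<omega> =
        real_cond_exp P (vimage_algebra (space P) S N3) (indicator {\<omega>\<in>space P. U \<omega> \<in> B}) \<omega> *
        real_cond_exp P (vimage_algebra (space P) S N3) (indicator {\<omega>\<in>space P. V \<omega> \<in> C}) \<omega>)"

text \<open>The action sequence \<open>(A\<^bsub>1:t-1\<^esub>, a\<^sub>t, \<dots>, a\<^sub>k)\<close>.\<close>

definition splice ::
  "('w, 'x, 'a) trajectory_model \<Rightarrow> nat \<Rightarrow> (nat \<Rightarrow> 'a) \<Rightarrow> nat \<Rightarrow> 'w \<Rightarrow> nat \<Rightarrow> 'a" where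
  "splice M t a k \<omega> = (\<lambda>j\<in>{1..k}. if j < t then action M j \<omega> else a j)"

definition sequential_unconfoundedness ::
  "('w, 'x, 'a) trajectory_model \<Rightarrow> (nat \<Rightarrow> (nat \<Rightarrow> 'a) \<Rightarrow> 'w \<Rightarrow> 'x) \<Rightarrow>
   (nat \<Rightarrow> (nat \<Rightarrow> 'a) \<Rightarrow> 'w \<Rightarrow> real) \<Rightarrow> bool" where
  "sequential_unconfoundedness M PX PY \<longleftrightarrow>
     (\<forall>t\<in>{1..horizon M}. \<forall>a\<in>space (PiM {t..horizon M} (act_space M)).
        cond_indep_rv (obs M)
          (act_space M t) (action M t)
          (PiM {t..horizon M} (\<lambda>k. cov_space M (k + 1) \<Otimes>\<^sub>M borel))
          (\<lambda>\<omega>. \<lambda>k\<in>{t..horizon M}. (PX k (splice M t a k \<omega>) \<omega>, PY k (splice M t a k \<omega>) \<omega>))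
          (hist_space M t) (hist M t))"


section \<open>Values\<close>

definition ret :: "('w, 'x, 'a) trajectory_model \<Rightarrow> real \<Rightarrow> nat \<Rightarrow> 'w \<Rightarrow> real" where
  "ret M \<gamma> t \<omega> = (\<Sum>k\<in>{t..horizon M}. \<gamma> ^ (k - t) * outcome M k \<omega>)"

text \<open>\<open>q t\<close> is a (fixed, jointly measurable) version of \<open>E[\<Gamma>\<^sub>t | S\<^sub>t = s, A\<^sub>t = a]\<close>.\<close>

definition is_action_value ::
  "('w, 'x, 'a) trajectory_model \<Rightarrow> real \<Rightarrow> (nat \<Rightarrow> ('x, 'a) history \<Rightarrow> 'a \<Rightarrow> real) \<Rightarrow> bool" where
  "is_action_value M \<gamma> q \<longleftrightarrow>
     (\<forall>t\<in>{1..horizon M}.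
        (\<lambda>(s, a). q t s a) \<in> borel_measurable (sa_space M t) \<and>
        (AE \<omega> in obs M.
           real_cond_exp (obs M)
             (vimage_algebra (space (obs M)) (\<lambda>\<omega>. (hist M t \<omega>, action M t \<omega>)) (sa_space M t))
             (ret M \<gamma> t) \<omega>
           = q t (hist M t \<omega>) (action M t \<omega>)))"


section \<open>Convolutional perturbation paths\<close>

text \<open>
  \<open>\<pi>\<epsilon> \<epsilon>\<close> is the perturbed policy, \<open>Mk t \<epsilon> (s, a\<^sub>0)\<close> the probability measure
  \<open>M\<^bsub>t,\<epsilon>\<^esub>(\<cdot> | a\<^sub>0, s)\<close> (which need not have a density), \<open>Lf t\<close> the function \<open>L\<^sub>t\<^sup>*\<pi>\<^sub>t\<close>,
  \<open>Lb t\<close> the backward operator and \<open>Q t\<close> its function class. Densities being determined only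
  almost everywhere, the limits are required almost everywhere, and \<open>Lf\<close> and \<open>Lb\<close> are
  measurable versions of them.
\<close>

definition convolutional_path ::
  "('w, 'x, 'a) trajectory_model \<Rightarrow> real \<Rightarrow> ('x, 'a) policy \<Rightarrow> (real \<Rightarrow> ('x, 'a) policy) \<Rightarrow>
   (nat \<Rightarrow> real \<Rightarrow> ('x, 'a) history \<times> 'a \<Rightarrow> 'a measure) \<Rightarrow>
   (nat \<Rightarrow> ('x, 'a) history \<Rightarrow> 'a \<Rightarrow> real) \<Rightarrow>
   (nat \<Rightarrow> (('x, 'a) history \<Rightarrow> 'a \<Rightarrow> real) \<Rightarrow> ('x, 'a) history \<Rightarrow> 'a \<Rightarrow> real) \<Rightarrow>
   (nat \<Rightarrow> (('x, 'a) history \<Rightarrow> 'a \<Rightarrow> real) set) \<Rightarrow> bool" where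
  "convolutional_path M eps \<pi> \<pi>\<epsilon> Mk Lf Lb Q \<longleftrightarrow>
     0 < eps \<and>
     (\<forall>\<epsilon>\<in>{0..<eps}. is_policy M (\<pi>\<epsilon> \<epsilon>)) \<and>
     (\<forall>t\<in>{1..horizon M}.
        (\<forall>\<epsilon>\<in>{0..<eps}. Mk t \<epsilon> \<in> measurable (sa_space M t) (prob_algebra (act_space M t))) \<and>
        (\<forall>\<epsilon>\<in>{0..<eps}. AE s in hist_law M t.
           density (act_space M t) (\<lambda>a. ennreal (\<pi>\<epsilon> \<epsilon> t s a)) =
           density (act_space M t) (\<lambda>a. ennreal (\<pi> t s a)) \<bind> (\<lambda>a\<^sub>0. Mk t \<epsilon> (s, a\<^sub>0))) \<and>
        (\<forall>s\<in>space (hist_space M t). \<forall>a\<^sub>0\<in>space (act_space M t).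
           Mk t 0 (s, a\<^sub>0) = return (act_space M t) a\<^sub>0) \<and>
        (\<forall>\<^sub>F \<epsilon> in at_right 0. AE s in hist_law M t. AE a in act_space M t.
           \<pi> t s a = 0 \<longrightarrow> \<pi>\<epsilon> \<epsilon> t s a = 0) \<and>
        (\<lambda>(s, a). Lf t s a) \<in> borel_measurable (sa_space M t) \<and>
        (AE (s, a) in hist_law M t \<Otimes>\<^sub>M act_space M t.
           ((\<lambda>\<epsilon>. (\<pi>\<epsilon> \<epsilon> t s a - \<pi> t s a) / \<epsilon>) \<longlongrightarrow> Lf t s a) (at_right 0)) \<and>
        (\<forall>f\<in>Q t.
           (\<lambda>(s, a). f s a) \<in> borel_measurable (sa_space M t) \<and>
           (\<lambda>(s, a). Lb t f s a) \<in> borel_measurable (sa_space M t) \<and>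
           (AE (s, a\<^sub>0) in sa_law M t.
              (\<forall>\<^sub>F \<epsilon> in at_right 0. integrable (Mk t \<epsilon> (s, a\<^sub>0)) (f s)) \<and>
              ((\<lambda>\<epsilon>. ((\<integral>a. f s a \<partial>Mk t \<epsilon> (s, a\<^sub>0)) - f s a\<^sub>0) / \<epsilon>) \<longlongrightarrow> Lb t f s a\<^sub>0) (at_right 0))))"

text \<open>The quotient below is only used where \<open>\<pi>\<^sub>t(a | s) > 0\<close>, which holds at \<open>(S\<^sub>t, A\<^sub>t)\<close> almost surely.\<close>

definition score ::
  "('x, 'a) policy \<Rightarrow> (nat \<Rightarrow> ('x, 'a) history \<Rightarrow> 'a \<Rightarrow> real) \<Rightarrow> nat \<Rightarrow> ('x, 'a) history \<Rightarrow> 'a \<Rightarrow> real" where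
  "score \<pi> Lf t s a = Lf t s a / \<pi> t s a"

definition pairing ::
  "('w, 'x, 'a) trajectory_model \<Rightarrow> nat \<Rightarrow> (('x, 'a) history \<Rightarrow> 'a \<Rightarrow> real) \<Rightarrow>
   (('x, 'a) history \<Rightarrow> 'a \<Rightarrow> real) \<Rightarrow> ('x, 'a) history \<Rightarrow> real" where
  "pairing M t f g s = (\<integral>a. f s a * g s a \<partial>act_space M t)"


section \<open>Passing to the limit along the path\<close>

text \<open>
  For \<open>T \<ge> 2\<close> the expectation \<open>E\<^sub>\<epsilon>\<close> weights the local difference quotient at stage \<open>t\<close> by the
  likelihood ratio of \<open>S\<^sub>t\<close>, and its limit has to be exchanged with the integral over \<open>a\<close> as
  well as with the one over histories. An integrable bound on
  \<open>\<integral> |q\<^sub>t (\<pi>\<^bsub>t,\<epsilon>\<^esub> - \<pi>\<^sub>t) / \<epsilon>| d\<lambda>\<close> under the observed law alone does not give this: with action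
  space \<open>\<nat>\<close>, moving mass \<open>\<epsilon>\<close> to an action \<open>n(\<epsilon>) \<longlonglongrightarrow> \<infinity>\<close> with \<open>q = 1\<close> satisfies it, although
  \<open>L\<^sup>*\<pi> = -\<pi>\<close> pairs with \<open>q\<close> to \<open>-1\<close> while the effect is \<open>0\<close>.
\<close>

definition likelihood_ratio ::
  "('w, 'x, 'a) trajectory_model \<Rightarrow> ('x, 'a) policy \<Rightarrow> ('x, 'a) policy \<Rightarrow> nat \<Rightarrow> 'w \<Rightarrow> real" where
  "likelihood_ratio M \<pi> \<pi>' t \<omega> =
     (\<Prod>k\<in>{1..<t}. \<pi>' k (hist M k \<omega>) (action M k \<omega>) / \<pi> k (hist M k \<omega>) (action M k \<omega>))"

definition path_dominated ::
  "('w, 'x, 'a) trajectory_model \<Rightarrow> ('x, 'a) policy \<Rightarrow> (real \<Rightarrow> ('x, 'a) policy) \<Rightarrow>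
   (nat \<Rightarrow> ('x, 'a) history \<Rightarrow> 'a \<Rightarrow> real) \<Rightarrow> nat \<Rightarrow> bool" where
  "path_dominated M \<pi> \<pi>\<epsilon> q t \<longleftrightarrow>
     (\<exists>C. integrable (obs M \<Otimes>\<^sub>M act_space M t) C \<and>
        (\<forall>\<^sub>F \<epsilon> in at_right 0. AE (\<omega>, a) in obs M \<Otimes>\<^sub>M act_space M t.
           \<bar>likelihood_ratio M \<pi> (\<pi>\<epsilon> \<epsilon>) t \<omega> *
            (q t (hist M t \<omega>) a *
              ((\<pi>\<epsilon> \<epsilon> t (hist M t \<omega>) a - \<pi> t (hist M t \<omega>) a) / \<epsilon>))\<bar> \<le> C (\<omega>, a)))"

end

theory Submission
  imports Defs
begin

text \<open>
  By the g-formula the law of the trajectory under \<open>\<pi>\<^sub>\<epsilon>\<close> has the likelihood ratio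
  \<open>L\<^bsub>T+1\<^esub>\<close> as density with respect to the observed law, where
  \<open>L\<^sub>t = \<Prod>\<^bsub>k<t\<^esub> \<pi>\<^bsub>k,\<epsilon>\<^esub> / \<pi>\<^sub>k\<close>. Conditioning \<open>L\<^bsub>T+1\<^esub> \<Gamma>\<^sub>1\<close> successively on
  \<open>(S\<^sub>T, A\<^sub>T), S\<^sub>T, \<dots>, S\<^sub>1\<close> and replacing one policy factor at a time gives the
  performance difference identity
  \<open>E\<^sub>\<epsilon> \<Gamma>\<^sub>1 - E \<Gamma>\<^sub>1 = \<Sum>\<^sub>t \<gamma>\<^bsup>t-1\<^esup> E [L\<^sub>t \<integral> q\<^sub>t (\<pi>\<^bsub>t,\<epsilon>\<^esub> - \<pi>\<^sub>t) d\<lambda>]\<close>.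
  Dividing by \<open>\<epsilon>\<close>, dominated convergence and \<open>L\<^sub>t \<longlongrightarrow> 1\<close> yield the forward
  representation. The score form follows because \<open>L\<^sub>t\<^sup>*\<pi>\<^sub>t\<close> vanishes almost everywhere on
  \<open>{\<pi>\<^sub>t = 0}\<close>. For the backward form, the same difference quotient at stage \<open>t\<close> is
  rewritten with the kernel, \<open>\<integral> q\<^sub>t (\<pi>\<^bsub>t,\<epsilon>\<^esub> - \<pi>\<^sub>t) d\<lambda> = \<integral> (\<integral> q\<^sub>t dM\<^bsub>t,\<epsilon>\<^esub> - q\<^sub>t) \<pi>\<^sub>t d\<lambda>\<close>,
  and both sides are passed to the limit.
\<close>

section \<open>Conditional expectations and kernels\<close>

text \<open>The telescoping puts the perturbed policy before the change point and the baseline value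
  \<open>q\<close> after it. No value function of the perturbed policy occurs, and
  \<open>\<epsilon>\<close> enters only through the likelihood ratio and the quotient of the
  densities; the opposite order would need convergence of perturbed action values. The two
  representations ask for different exchanges of limits. The forward one takes place on the product
  of outcomes and actions, where the bound \<open>C\<close> of \<open>path_dominated\<close>
  controls the weighted quotient under both integrals at once. The backward limit cannot be matched
  with it action by action, since a kernel moves mass between actions and may be singular; only the
  integrals over actions agree, by an identity at fixed \<open>\<epsilon>\<close>. That identity
  lives under the observed law, without weights, so the unweighted quotient needs a limit argument
  of its own, in which \<open>C\<close> serves only after the likelihood ratio is divided
  out.\<close>

text \<open>
  Neither \<open>\<rho> R\<close> nor \<open>L q\<close> need be integrable, so the pull-out property is applied on the sets
  \<open>{\<bar>L\<bar> \<le> n, \<bar>R\<bar> \<le> n}\<close>, which exhaust the space.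
\<close>

lemma (in sigma_finite_subalgebra) real_cond_exp_mult_localized:
  fixes L R \<rho> q :: "'a \<Rightarrow> real"
  assumes L [measurable]: "L \<in> borel_measurable F" and R [measurable]: "R \<in> borel_measurable F"
    and \<rho>: "integrable M \<rho>" "AE x in M. real_cond_exp M F \<rho> x = 1"
    and q: "integrable M q"
    and U: "integrable M (\<lambda>x. L x * (\<rho> x * R x + q x))"
  shows "AE x in M. real_cond_exp M F (\<lambda>x. L x * (\<rho> x * R x + q x)) x = L x * (R x + real_cond_exp M F q x)"
proof -
  have [measurable]: "\<rho> \<in> borel_measurable M" "q \<in> borel_measurable M"
    using \<rho> q by auto
  note measurable_from_subalg[OF subalg L, measurable] measurable_from_subalg[OF subalg R, measurable]
  let ?U = "\<lambda>x. L x * (\<rho> x * R x + q x)"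
  have "AE x in M. \<bar>L x\<bar> \<le> real n \<and> \<bar>R x\<bar> \<le> real n \<longrightarrow>
      real_cond_exp M F ?U x = L x * (R x + real_cond_exp M F q x)" for n :: nat
  proof -
    define b where "b x = (if \<bar>L x\<bar> \<le> real n \<and> \<bar>R x\<bar> \<le> real n then 1 else 0 :: real)" for x
    have [measurable]: "b \<in> borel_measurable F" unfolding b_def by measurable
    have [measurable]: "b \<in> borel_measurable M"
      by (rule measurable_from_subalg[OF subalg]) measurable
    have bL: "\<bar>b x * L x\<bar> \<le> real n" for x by (auto simp: b_def)
    have bLR: "\<bar>b x * L x * R x\<bar> \<le> real n * real n" for x
      by (auto simp: b_def abs_mult intro!: mult_mono)
    have i1: "integrable M (\<lambda>x. (b x * L x * R x) * \<rho> x)"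
      by (rule Bochner_Integration.integrable_bound[OF integrable_mult_right[OF integrable_norm[OF \<rho>(1)], of "real n * real n"]])
         (auto simp: abs_mult[of _ "\<rho> _"] intro!: mult_right_mono bLR)
    have i2: "integrable M (\<lambda>x. (b x * L x) * q x)"
      by (rule Bochner_Integration.integrable_bound[OF integrable_mult_right[OF integrable_norm[OF q], of "real n"]])
         (auto simp: abs_mult[of _ "q _"] intro!: mult_right_mono bL)
    have i3: "integrable M (\<lambda>x. b x * ?U x)"
      by (rule Bochner_Integration.integrable_bound[OF U]) (auto simp: b_def)
    have "(\<lambda>x. b x * ?U x) = (\<lambda>x. (b x * L x * R x) * \<rho> x + (b x * L x) * q x)"
      by (auto simp: algebra_simps)
    then have "AE x in M. real_cond_exp M F (\<lambda>x. b x * ?U x) x =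
        real_cond_exp M F (\<lambda>x. (b x * L x * R x) * \<rho> x) x + real_cond_exp M F (\<lambda>x. (b x * L x) * q x) x"
      using real_cond_exp_add[OF i1 i2] by simp
    moreover have "AE x in M. real_cond_exp M F (\<lambda>x. (b x * L x * R x) * \<rho> x) x
        = (b x * L x * R x) * real_cond_exp M F \<rho> x"
      by (rule real_cond_exp_mult[OF _ _ i1]) measurable
    moreover have "AE x in M. real_cond_exp M F (\<lambda>x. (b x * L x) * q x) x
        = (b x * L x) * real_cond_exp M F q x"
      by (rule real_cond_exp_mult[OF _ _ i2]) measurable
    \<comment> \<open>Above, \<open>b\<close> was absorbed into the coefficients of
      \<open>\<rho>\<close> and \<open>q\<close>; here it is pulled out of \<open>?U\<close>.
      Comparing the two where \<open>b\<close> is 1 gives the claim.\<close>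
    moreover have "AE x in M. real_cond_exp M F (\<lambda>x. b x * ?U x) x = b x * real_cond_exp M F ?U x"
      by (rule real_cond_exp_mult[OF _ _ i3]) measurable
    ultimately show ?thesis
      using \<rho>(2) by eventually_elim (auto simp: b_def algebra_simps)
  qed
  then have "AE x in M. \<forall>n::nat. \<bar>L x\<bar> \<le> real n \<and> \<bar>R x\<bar> \<le> real n \<longrightarrow>
      real_cond_exp M F ?U x = L x * (R x + real_cond_exp M F q x)"
    by (intro AE_all_countable[THEN iffD2] allI)
  then show ?thesis
  proof eventually_elim
    case (elim x)
    obtain n :: nat where "max \<bar>L x\<bar> \<bar>R x\<bar> \<le> real n" using real_arch_simple by blast
    with elim show ?case by auto
  qed
qed

text \<open>Fubini for a kernel and a signed integrand: \<open>nn_integral_bind\<close> is applied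
  to the positive and the negative part of \<open>f\<close>, and the exceptional points where a part
  has infinite mass form a null set. It is what later turns integration against the perturbed policy
  into integration against the kernel.\<close>

lemma integral_bind_integrable:
  fixes f :: "'b \<Rightarrow> real"
  assumes k: "k \<in> measurable N (subprob_algebra B)" and N: "space N \<noteq> {}"
    and f: "integrable (N \<bind> k) f"
  shows "integrable N (\<lambda>x. \<integral>y. f y \<partial>k x)" "(\<integral>x. (\<integral>y. f y \<partial>k x) \<partial>N) = (\<integral>y. f y \<partial>(N \<bind> k))"
proof -
  have sets [measurable_cong]: "sets (N \<bind> k) = sets B" by (rule sets_bind[OF _ N]) (rule sets_kernel[OF k])
  have fB [measurable]: "f \<in> borel_measurable B"
    using borel_measurable_integrable[OF f] measurable_cong_sets[OF sets refl] by blast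
  have ksets: "sets (k x) = sets B" if "x \<in> space N" for x using sets_kernel[OF k that] .
  have fk: "f \<in> borel_measurable (k x)" if "x \<in> space N" for x
    using fB measurable_cong_sets[OF ksets[OF that] refl] by blast
  \<comment> \<open>Since \<open>ennreal\<close> sends negative reals to 0, the choices 1 and -1 for
    \<open>c\<close> give the integrals of the positive and of the negative part of
    \<open>f\<close>.\<close>
  define g where "g c x = (\<integral>\<^sup>+y. ennreal (c * f y) \<partial>k x)" for c :: real and x
  have g_meas [measurable]: "g c \<in> borel_measurable N" for c
    unfolding g_def
    by (rule nn_integral_measurable_subprob_algebra2[OF _ k]) simp
  have g_int: "(\<integral>\<^sup>+x. g c x \<partial>N) = (\<integral>\<^sup>+y. ennreal (c * f y) \<partial>(N \<bind> k))" for c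
    unfolding g_def by (rule nn_integral_bind[OF _ k, symmetric]) simp
  have g_fin: "(\<integral>\<^sup>+x. g c x \<partial>N) < \<infinity>" for c
  proof -
    have "integrable (N \<bind> k) (\<lambda>y. c * f y)" using f by simp
    then have "(\<integral>\<^sup>+y. ennreal (norm (c * f y)) \<partial>(N \<bind> k)) < \<infinity>"
      unfolding integrable_iff_bounded by simp
    then show ?thesis
      unfolding g_int by (rule le_less_trans[rotated]) (auto intro!: nn_integral_mono ennreal_leI)
  qed
  have g_AE: "AE x in N. g c x \<noteq> \<infinity>" for c
    by (rule nn_integral_PInf_AE) (use g_fin[of c] in auto)
  have g_intg: "integrable N (\<lambda>x. enn2real (g c x))" for c
  proof (rule integrableI_bounded)
    have "(\<integral>\<^sup>+x. ennreal (norm (enn2real (g c x))) \<partial>N) \<le> (\<integral>\<^sup>+x. g c x \<partial>N)"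
      by (intro nn_integral_mono) (simp add: ennreal_enn2real_if)
    then show "(\<integral>\<^sup>+x. ennreal (norm (enn2real (g c x))) \<partial>N) < \<infinity>" using g_fin[of c] by simp
  qed measurable
  have g_val: "(\<integral>x. enn2real (g c x) \<partial>N) = enn2real (\<integral>\<^sup>+y. ennreal (c * f y) \<partial>(N \<bind> k))" for c
  proof -
    have "(\<integral>x. enn2real (g c x) \<partial>N) = enn2real (\<integral>\<^sup>+x. ennreal (enn2real (g c x)) \<partial>N)"
      by (rule integral_eq_nn_integral) auto
    also have "(\<integral>\<^sup>+x. ennreal (enn2real (g c x)) \<partial>N) = (\<integral>\<^sup>+x. g c x \<partial>N)"
      using g_AE[of c] by (intro nn_integral_cong_AE) (auto simp: ennreal_enn2real_if)
    finally show ?thesis by (simp add: g_int)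
  qed
  have eq: "AE x in N. (\<integral>y. f y \<partial>k x) = enn2real (g 1 x) - enn2real (g (-1) x)"
    using g_AE[of 1] g_AE[of "-1"] AE_space
  proof eventually_elim
    case (elim x)
    have "integrable (k x) f"
      unfolding real_integrable_def using elim fk by (auto simp: g_def)
    then show ?case by (simp add: real_lebesgue_integral_def g_def)
  qed
  have meas [measurable]: "(\<lambda>x. \<integral>y. f y \<partial>k x) \<in> borel_measurable N"
    by (rule measurable_compose[OF k integral_measurable_subprob_algebra[OF fB]])
  show "integrable N (\<lambda>x. \<integral>y. f y \<partial>k x)"
    by (rule integrable_cong_AE_imp[OF Bochner_Integration.integrable_diff[OF g_intg[of 1] g_intg[of "-1"]] meas])
       (use eq in auto)
  have "(\<integral>x. (\<integral>y. f y \<partial>k x) \<partial>N) = (\<integral>x. enn2real (g 1 x) - enn2real (g (-1) x) \<partial>N)"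
    by (rule integral_cong_AE) (use eq in auto)
  also have "\<dots> = (\<integral>y. f y \<partial>(N \<bind> k))"
    using g_intg by (simp add: g_val real_lebesgue_integral_def[OF f])
  finally show "(\<integral>x. (\<integral>y. f y \<partial>k x) \<partial>N) = (\<integral>y. f y \<partial>(N \<bind> k))" .
qed

section \<open>One decision stage\<close>

text \<open>A single decision detached from the trajectory: \<open>S\<close> is the history,
  \<open>U\<close> the action, \<open>p\<close> the policy density. The later decisions and outcomes
  remain hidden in \<open>P\<close>, so each stage lemma serves every \<open>t\<close>.\<close>

locale policy_stage = prob_space P + A: sigma_finite_measure A
  for P :: "'w measure" and A :: "'a measure" +
  fixes H :: "'s measure" and S :: "'w \<Rightarrow> 's" and U :: "'w \<Rightarrow> 'a" and p :: "'s \<Rightarrow> 'a \<Rightarrow> real"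
  assumes S_meas [measurable]: "S \<in> measurable P H"
    and U_meas [measurable]: "U \<in> measurable P A"
    and p_meas [measurable]: "(\<lambda>(s, a). p s a) \<in> borel_measurable (H \<Otimes>\<^sub>M A)"
    and law: "distr P (H \<Otimes>\<^sub>M A) (\<lambda>\<omega>. (S \<omega>, U \<omega>)) = density (distr P H S \<Otimes>\<^sub>M A) (\<lambda>(s, a). ennreal (p s a))"
    and p_dens: "AE s in distr P H S. (\<forall>a\<in>space A. 0 \<le> p s a) \<and> (\<integral>\<^sup>+a. ennreal (p s a) \<partial>A) = 1"
begin

sublocale SA: pair_sigma_finite "distr P H S" A
  by (simp add: pair_sigma_finite_def A.sigma_finite_measure_axioms prob_space_imp_sigma_finite prob_space_distr)

sublocale PA: pair_sigma_finite P A ..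

lemma sets_SA [measurable_cong]: "sets (distr P H S \<Otimes>\<^sub>M A) = sets (H \<Otimes>\<^sub>M A)"
  by (intro sets_pair_measure_cong) auto

lemma measurable_SA_cong: "f \<in> measurable (distr P H S \<Otimes>\<^sub>M A) N \<longleftrightarrow> f \<in> measurable (H \<Otimes>\<^sub>M A) N"
  using measurable_cong_sets[OF sets_SA refl] by blast

text \<open>Policies and path limits are described under the law of the history, likelihood ratios
  and conditional expectations on outcomes. Through this identity almost everywhere statements pass
  from the first product space to the second.\<close>

lemma distr_pair:
  "distr P H S \<Otimes>\<^sub>M A = distr (P \<Otimes>\<^sub>M A) (H \<Otimes>\<^sub>M A) (\<lambda>(\<omega>, a). (S \<omega>, a))"
  using pair_measure_distr[OF S_meas measurable_ident_sets[OF refl, of A]] A.sigma_finite_measure_axioms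
  by simp

lemma AE_pairD:
  assumes "AE (s, a) in distr P H S \<Otimes>\<^sub>M A. Q s a"
  shows "AE (\<omega>, a) in P \<Otimes>\<^sub>M A. Q (S \<omega>) a"
  using AE_distrD[OF _ assms[unfolded distr_pair]] by (auto simp: case_prod_beta)

lemma AE_lawD:
  assumes "AE (s, a) in distr P (H \<Otimes>\<^sub>M A) (\<lambda>\<omega>. (S \<omega>, U \<omega>)). Q s a"
  shows "AE \<omega> in P. Q (S \<omega>) (U \<omega>)"
  using AE_distrD[OF _ assms] by auto

lemma AE_density_lawI:
  assumes "AE (s, a) in distr P H S \<Otimes>\<^sub>M A. 0 < p s a \<longrightarrow> Q s a"
  shows "AE \<omega> in P. Q (S \<omega>) (U \<omega>)"
proof (rule AE_lawD)
  have "(\<lambda>(s, a). ennreal (p s a)) \<in> borel_measurable (distr P H S \<Otimes>\<^sub>M A)"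
    using measurable_compose[OF p_meas measurable_ennreal] by (simp add: measurable_SA_cong case_prod_beta')
  then show "AE (s, a) in distr P (H \<Otimes>\<^sub>M A) (\<lambda>\<omega>. (S \<omega>, U \<omega>)). Q s a"
    unfolding law using assms by (simp add: AE_density case_prod_beta')
qed

lemma AE_actD:
  assumes "AE (s, a) in distr P H S \<Otimes>\<^sub>M A. Q s a"
  shows "AE \<omega> in P. Q (S \<omega>) (U \<omega>)"
  by (rule AE_density_lawI) (use assms in auto)

text \<open>The zero set of \<open>p\<close> has no mass under a law with density \<open>p\<close>.
  This legitimates division by \<open>p\<close> at the observed pair, although \<open>p\<close> may
  vanish on a large set of pairs under the reference measure.\<close>

lemma p_pos: "AE \<omega> in P. 0 < p (S \<omega>) (U \<omega>)"
  by (rule AE_density_lawI) auto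

lemma AE_nonneg_pair:
  assumes [measurable]: "(\<lambda>(s, a). p' s a) \<in> borel_measurable (H \<Otimes>\<^sub>M A)"
    and "AE s in distr P H S. (\<forall>a\<in>space A. 0 \<le> p' s a) \<and> (\<integral>\<^sup>+a. ennreal (p' s a) \<partial>A) = 1"
  shows "AE (s, a) in distr P H S \<Otimes>\<^sub>M A. 0 \<le> (p' s a :: real)"
proof -
  have m: "(\<lambda>x. p' (fst x) (snd x)) \<in> borel_measurable (H \<Otimes>\<^sub>M A)"
    using assms(1) by (simp add: case_prod_beta')
  have "AE x in distr P H S \<Otimes>\<^sub>M A. 0 \<le> p' (fst x) (snd x)"
  proof (rule SA.AE_pair_measure)
    have "{x \<in> space (H \<Otimes>\<^sub>M A). 0 \<le> p' (fst x) (snd x)} \<in> sets (H \<Otimes>\<^sub>M A)"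
      using m by measurable
    moreover have "sets (distr P H S \<Otimes>\<^sub>M A) = sets (H \<Otimes>\<^sub>M A)" by (intro sets_pair_measure_cong) auto
    ultimately show "{x \<in> space (distr P H S \<Otimes>\<^sub>M A). 0 \<le> p' (fst x) (snd x)} \<in> sets (distr P H S \<Otimes>\<^sub>M A)"
      using sets_eq_imp_space_eq by metis
    show "AE x in distr P H S. AE y in A. 0 \<le> p' (fst (x, y)) (snd (x, y))"
      using assms(2) by eventually_elim auto
  qed
  then show ?thesis by (simp add: case_prod_beta')
qed

lemmas p_nonneg = AE_nonneg_pair[OF p_meas p_dens]

lemma measurable_SU:
  assumes "(\<lambda>(s, a). f s a) \<in> measurable (H \<Otimes>\<^sub>M A) N"
  shows "(\<lambda>\<omega>. f (S \<omega>) (U \<omega>)) \<in> measurable P N" "(\<lambda>(\<omega>, a). f (S \<omega>) a) \<in> measurable (P \<Otimes>\<^sub>M A) N"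
proof -
  show "(\<lambda>\<omega>. f (S \<omega>) (U \<omega>)) \<in> measurable P N"
    using measurable_compose[OF _ assms, of "\<lambda>\<omega>. (S \<omega>, U \<omega>)" P] by simp
  have "(\<lambda>(\<omega>, a). (S \<omega>, a)) \<in> measurable (P \<Otimes>\<^sub>M A) (H \<Otimes>\<^sub>M A)" by measurable
  from measurable_compose[OF this assms]
  show "(\<lambda>(\<omega>, a). f (S \<omega>) a) \<in> measurable (P \<Otimes>\<^sub>M A) N" by (simp add: case_prod_beta')
qed

text \<open>The \<open>ennreal\<close> density becomes a real factor because \<open>p\<close> is
  nonnegative almost everywhere. \<open>integral_law\<close> carries no integrability assumption: if
  integrability fails, it fails on both sides and both integrals are 0.\<close>

lemma
  fixes f :: "'s \<Rightarrow> 'a \<Rightarrow> real"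
  assumes f [measurable]: "(\<lambda>(s, a). f s a) \<in> borel_measurable (H \<Otimes>\<^sub>M A)"
  shows integrable_law_iff:
      "integrable P (\<lambda>\<omega>. f (S \<omega>) (U \<omega>)) \<longleftrightarrow> integrable (P \<Otimes>\<^sub>M A) (\<lambda>(\<omega>, a). p (S \<omega>) a * f (S \<omega>) a)"
    and integral_law:
      "(\<integral>\<omega>. f (S \<omega>) (U \<omega>) \<partial>P) = (\<integral>(\<omega>, a). p (S \<omega>) a * f (S \<omega>) a \<partial>(P \<Otimes>\<^sub>M A))"
proof -
  let ?D = "distr P (H \<Otimes>\<^sub>M A) (\<lambda>\<omega>. (S \<omega>, U \<omega>))" and ?N = "distr P H S \<Otimes>\<^sub>M A"
  let ?f = "\<lambda>(s, a). f s a" and ?p = "\<lambda>(s, a). p s a"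
  have fN: "?f \<in> borel_measurable ?N" and pN: "?p \<in> borel_measurable ?N"
    using f p_meas by (simp_all only: measurable_SA_cong)
  have nn: "AE x in ?N. 0 \<le> ?p x" using p_nonneg by (simp add: case_prod_beta')
  have D: "?D = density ?N (\<lambda>x. ennreal (?p x))" by (simp add: law case_prod_beta')
  have pf: "(\<lambda>x. ?p x * ?f x) \<in> borel_measurable (H \<Otimes>\<^sub>M A)" by measurable
  have T: "(\<lambda>(\<omega>, a). (S \<omega>, a)) \<in> measurable (P \<Otimes>\<^sub>M A) (H \<Otimes>\<^sub>M A)" by measurable
  have "integrable P (\<lambda>\<omega>. ?f (S \<omega>, U \<omega>)) \<longleftrightarrow> integrable ?D ?f"
    by (rule integrable_distr_eq[symmetric]) measurable
  also have "\<dots> \<longleftrightarrow> integrable ?N (\<lambda>x. ?p x * ?f x)"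
    unfolding D using integrable_density[OF fN pN nn] by simp
  also have "\<dots> \<longleftrightarrow> integrable (P \<Otimes>\<^sub>M A) (\<lambda>x. ?p ((\<lambda>(\<omega>, a). (S \<omega>, a)) x) * ?f ((\<lambda>(\<omega>, a). (S \<omega>, a)) x))"
    unfolding distr_pair using integrable_distr_eq[OF T pf] .
  finally show "integrable P (\<lambda>\<omega>. f (S \<omega>) (U \<omega>)) \<longleftrightarrow> integrable (P \<Otimes>\<^sub>M A) (\<lambda>(\<omega>, a). p (S \<omega>) a * f (S \<omega>) a)"
    by (simp add: case_prod_beta')
  have "(\<integral>\<omega>. ?f (S \<omega>, U \<omega>) \<partial>P) = (\<integral>x. ?f x \<partial>?D)"
    by (rule integral_distr[symmetric]) measurable
  also have "\<dots> = (\<integral>x. ?p x * ?f x \<partial>?N)"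
    unfolding D using integral_density[OF fN pN nn] by simp
  also have "\<dots> = (\<integral>x. ?p ((\<lambda>(\<omega>, a). (S \<omega>, a)) x) * ?f ((\<lambda>(\<omega>, a). (S \<omega>, a)) x) \<partial>(P \<Otimes>\<^sub>M A))"
    unfolding distr_pair using integral_distr[OF T pf] .
  finally show "(\<integral>\<omega>. f (S \<omega>) (U \<omega>) \<partial>P) = (\<integral>(\<omega>, a). p (S \<omega>) a * f (S \<omega>) a \<partial>(P \<Otimes>\<^sub>M A))"
    by (simp add: case_prod_beta')
qed

lemma nn_integral_law:
  assumes f [measurable]: "(\<lambda>(s, a). f s a) \<in> borel_measurable (H \<Otimes>\<^sub>M A)"
  shows "(\<integral>\<^sup>+\<omega>. f (S \<omega>) (U \<omega>) \<partial>P) = (\<integral>\<^sup>+\<omega>. (\<integral>\<^sup>+a. ennreal (p (S \<omega>) a) * f (S \<omega>) a \<partial>A) \<partial>P)"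
proof -
  have m: "(\<lambda>(s, a). ennreal (p s a) * f s a) \<in> borel_measurable (H \<Otimes>\<^sub>M A)"
  proof -
    have "(\<lambda>x. ennreal (case x of (s, a) \<Rightarrow> p s a) * (case x of (s, a) \<Rightarrow> f s a)) \<in> borel_measurable (H \<Otimes>\<^sub>M A)"
      by measurable
    then show ?thesis by (simp add: case_prod_beta')
  qed
  have "(\<integral>\<^sup>+\<omega>. f (S \<omega>) (U \<omega>) \<partial>P) = (\<integral>\<^sup>+x. (case x of (s, a) \<Rightarrow> f s a) \<partial>distr P (H \<Otimes>\<^sub>M A) (\<lambda>\<omega>. (S \<omega>, U \<omega>)))"
    by (subst nn_integral_distr) auto
  also have "\<dots> = (\<integral>\<^sup>+x. (case x of (s, a) \<Rightarrow> ennreal (p s a)) * (case x of (s, a) \<Rightarrow> f s a) \<partial>(distr P H S \<Otimes>\<^sub>M A))"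
    unfolding law using f p_meas
    by (subst nn_integral_density) (auto simp: measurable_SA_cong case_prod_beta')
  also have "\<dots> = (\<integral>\<^sup>+(s, a). ennreal (p s a) * f s a \<partial>(distr P H S \<Otimes>\<^sub>M A))"
    by (simp add: case_prod_beta')
  also have "\<dots> = (\<integral>\<^sup>+(\<omega>, a). ennreal (p (S \<omega>) a) * f (S \<omega>) a \<partial>(P \<Otimes>\<^sub>M A))"
    unfolding distr_pair using m
    by (subst nn_integral_distr) (auto simp: case_prod_beta')
  also have "\<dots> = (\<integral>\<^sup>+\<omega>. (\<integral>\<^sup>+a. ennreal (p (S \<omega>) a) * f (S \<omega>) a \<partial>A) \<partial>P)"
    using measurable_SU(2)[OF m] by (subst A.nn_integral_fst[symmetric]) auto
  finally show ?thesis .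
qed

end

section \<open>Histories and the status-quo model\<close>

text \<open>A transition law is specified on rectangles only. Rectangles are an intersection-stable
  generator and the joint law is finite, so that law is the composition of the first marginal with
  the kernel, and integrands on the whole product follow.\<close>

lemma nn_integral_disintegration:
  assumes P: "prob_space P" and V [measurable]: "V \<in> measurable P B" and Z [measurable]: "Z \<in> measurable P C"
    and k: "k \<in> measurable B (prob_algebra C)"
    and rect: "\<And>b c. b \<in> sets B \<Longrightarrow> c \<in> sets C \<Longrightarrow>
      emeasure P {\<omega>\<in>space P. V \<omega> \<in> b \<and> Z \<omega> \<in> c} = (\<integral>\<^sup>+h\<in>b. emeasure (k h) c \<partial>distr P B V)"
    and f [measurable]: "f \<in> borel_measurable (B \<Otimes>\<^sub>M C)"
  shows "(\<integral>\<^sup>+\<omega>. f (V \<omega>, Z \<omega>) \<partial>P) = (\<integral>\<^sup>+h. (\<integral>\<^sup>+z. f (h, z) \<partial>k h) \<partial>distr P B V)"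
proof -
  interpret P: prob_space P by fact
  have k1 [measurable]: "k \<in> measurable B (subprob_algebra C)" by (rule measurable_prob_algebraD[OF k])
  have ksets: "sets (k h) = sets C" if "h \<in> space B" for h using sets_kernel[OF k1 that] .
  \<comment> \<open>The kernel is made to remember its starting point, so that the bind is the joint
    law and not just the law of \<open>Z\<close>.\<close>
  let ?j = "\<lambda>h. distr (k h) (B \<Otimes>\<^sub>M C) (Pair h)"
  have j: "?j \<in> measurable (distr P B V) (subprob_algebra (B \<Otimes>\<^sub>M C))"
    unfolding measurable_distr_eq1
    by (rule measurable_distr2[where M = C]) measurable
  have ne: "space (distr P B V) \<noteq> {}" using P.not_empty measurable_space[OF V] by auto
  let ?\<nu> = "distr P B V \<bind> ?j"
  have sets_\<nu>: "sets ?\<nu> = sets (B \<Otimes>\<^sub>M C)" by (rule sets_bind[OF _ ne]) simp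
  let ?E = "{a \<times> b |a b. a \<in> sets B \<and> b \<in> sets C}"
  have em: "emeasure ?\<nu> X = (\<integral>\<^sup>+h. emeasure (k h) (Pair h -` X) \<partial>distr P B V)" if X: "X \<in> sets (B \<Otimes>\<^sub>M C)" for X
  proof -
    have "emeasure ?\<nu> X = (\<integral>\<^sup>+h. emeasure (?j h) X \<partial>distr P B V)"
      by (rule emeasure_bind[OF ne j X])
    also have "\<dots> = (\<integral>\<^sup>+h. emeasure (k h) (Pair h -` X) \<partial>distr P B V)"
    proof (rule nn_integral_cong)
      fix h assume "h \<in> space (distr P B V)"
      then have h: "h \<in> space B" by simp
      have "Pair h -` X \<inter> space (k h) = Pair h -` X"
        using sets.sets_into_space[OF X] h sets_eq_imp_space_eq[OF ksets[OF h]] by (auto simp: space_pair_measure)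
      moreover have "Pair h \<in> measurable (k h) (B \<Otimes>\<^sub>M C)"
        using measurable_Pair1'[OF h] measurable_cong_sets[OF ksets[OF h] refl] by blast
      ultimately show "emeasure (?j h) X = emeasure (k h) (Pair h -` X)"
        using X by (simp add: emeasure_distr)
    qed
    finally show ?thesis .
  qed
  have eq: "distr P (B \<Otimes>\<^sub>M C) (\<lambda>\<omega>. (V \<omega>, Z \<omega>)) = ?\<nu>"
  proof (rule measure_eqI_generator_eq[OF Int_stable_pair_measure_generator[of B C], where A = "\<lambda>_. space B \<times> space C"])
    show "?E \<subseteq> Pow (space B \<times> space C)"
      by (rule pair_measure_closed)
    show "sets (distr P (B \<Otimes>\<^sub>M C) (\<lambda>\<omega>. (V \<omega>, Z \<omega>))) = sigma_sets (space B \<times> space C) ?E"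
      by (simp add: sets_pair_measure)
    show "sets ?\<nu> = sigma_sets (space B \<times> space C) ?E"
      by (simp add: sets_\<nu> sets_pair_measure)
    show "range (\<lambda>_. space B \<times> space C) \<subseteq> ?E" by auto
    show "(\<Union>i. space B \<times> space C) = space B \<times> space C" by simp
    interpret D: prob_space "distr P (B \<Otimes>\<^sub>M C) (\<lambda>\<omega>. (V \<omega>, Z \<omega>))" by (rule P.prob_space_distr) simp
    show "emeasure (distr P (B \<Otimes>\<^sub>M C) (\<lambda>\<omega>. (V \<omega>, Z \<omega>))) (space B \<times> space C) \<noteq> \<infinity>"
      by simp
  next
    fix X assume "X \<in> ?E"
    then obtain b c where X: "X = b \<times> c" and [measurable]: "b \<in> sets B" "c \<in> sets C" by auto
    have "emeasure (distr P (B \<Otimes>\<^sub>M C) (\<lambda>\<omega>. (V \<omega>, Z \<omega>))) X = emeasure P {\<omega>\<in>space P. V \<omega> \<in> b \<and> Z \<omega> \<in> c}"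
      unfolding X by (subst emeasure_distr) (auto intro!: arg_cong[where f = "emeasure P"])
    also have "\<dots> = (\<integral>\<^sup>+h. emeasure (k h) (Pair h -` X) \<partial>distr P B V)"
      unfolding X by (subst rect) (auto intro!: nn_integral_cong split: split_indicator)
    finally show "emeasure (distr P (B \<Otimes>\<^sub>M C) (\<lambda>\<omega>. (V \<omega>, Z \<omega>))) X = emeasure ?\<nu> X"
      using em[of X] by (simp add: X)
  qed
  have "(\<integral>\<^sup>+\<omega>. f (V \<omega>, Z \<omega>) \<partial>P) = (\<integral>\<^sup>+x. f x \<partial>?\<nu>)"
    unfolding eq[symmetric] by (subst nn_integral_distr) auto
  also have "\<dots> = (\<integral>\<^sup>+h. (\<integral>\<^sup>+x. f x \<partial>?j h) \<partial>distr P B V)"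
    by (rule nn_integral_bind[OF f j])
  also have "\<dots> = (\<integral>\<^sup>+h. (\<integral>\<^sup>+z. f (h, z) \<partial>k h) \<partial>distr P B V)"
  proof (rule nn_integral_cong)
    fix h assume "h \<in> space (distr P B V)"
    then have h: "h \<in> space B" by simp
    have "Pair h \<in> measurable (k h) (B \<Otimes>\<^sub>M C)"
      using measurable_Pair1'[OF h] measurable_cong_sets[OF ksets[OF h] refl] by blast
    then show "(\<integral>\<^sup>+x. f x \<partial>?j h) = (\<integral>\<^sup>+z. f (h, z) \<partial>k h)"
      by (subst nn_integral_distr) auto
  qed
  finally show ?thesis .
qed

section \<open>Likelihood ratios as functions of the history\<close>

fun trunc_hist :: "nat \<Rightarrow> ('x, 'a) history \<Rightarrow> ('x, 'a) history" where
  "trunc_hist k (x, a, y) = (restrict x {1..k}, restrict a {1..<k}, restrict y {1..<k})"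

lemma trunc_hist_hist: "k \<le> t \<Longrightarrow> trunc_hist k (hist M t \<omega>) = hist M k \<omega>"
  by (auto simp: hist_def fun_eq_iff)

lemma measurable_trunc_hist:
  "k \<le> t \<Longrightarrow> trunc_hist k \<in> measurable (hist_space M t) (hist_space M k)"
proof -
  assume kt: "k \<le> t"
  have "(\<lambda>(x, a, y). (restrict x {1..k}, restrict a {1..<k}, restrict y {1..<k}))
      \<in> measurable (hist_space M t) (hist_space M k)" (is "?f \<in> _")
    unfolding hist_space_def using kt
    by (auto simp: case_prod_beta' intro!: measurable_Pair measurable_compose[OF _ measurable_restrict_subset])
  moreover have "?f = trunc_hist k"
    by auto
  ultimately show ?thesis by (simp only:)
qed

text \<open>Earlier histories and actions are read off from the current history. In this form the
  ratio can be a density on \<open>hist_space\<close> and is visibly measurable for the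
  sigma-algebra of the history.\<close>

definition hist_ratio :: "('x, 'a) policy \<Rightarrow> ('x, 'a) policy \<Rightarrow> nat \<Rightarrow> ('x, 'a) history \<Rightarrow> real" where
  "hist_ratio \<pi> \<pi>' t s =
     (\<Prod>k\<in>{1..<t}. \<pi>' k (trunc_hist k s) (fst (snd s) k) / \<pi> k (trunc_hist k s) (fst (snd s) k))"

lemma likelihood_ratio_hist: "likelihood_ratio M \<pi> \<pi>' t \<omega> = hist_ratio \<pi> \<pi>' t (hist M t \<omega>)"
  unfolding likelihood_ratio_def hist_ratio_def
  by (intro prod.cong refl) (auto simp: trunc_hist_hist, auto simp: hist_def)

lemma likelihood_ratio_Suc:
  "1 \<le> t \<Longrightarrow> likelihood_ratio M \<pi> \<pi>' (Suc t) \<omega> =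
     likelihood_ratio M \<pi> \<pi>' t \<omega> * (\<pi>' t (hist M t \<omega>) (action M t \<omega>) / \<pi> t (hist M t \<omega>) (action M t \<omega>))"
  by (simp add: likelihood_ratio_def atLeastLessThanSuc mult.commute)

lemma measurable_extend_hist:
  assumes "1 \<le> t"
  shows "(\<lambda>(h, z). extend_hist t h z) \<in>
    measurable (sa_space M t \<Otimes>\<^sub>M (cov_space M (t + 1) \<Otimes>\<^sub>M borel)) (hist_space M (Suc t))"
proof -
  let ?N = "sa_space M t \<Otimes>\<^sub>M (cov_space M (t + 1) \<Otimes>\<^sub>M (borel :: real measure))"
  \<comment> \<open>The index sets grow differently: the step past time \<open>t\<close> adds
    covariate \<open>t + 1\<close>, but action and outcome \<open>t\<close>.\<close>
  have *: "{1..Suc t} = {1..t} \<union> {t + 1}" "{1..<Suc t} = {1..<t} \<union> {t}" using assms by auto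
  have "(\<lambda>w. (fst (fst (fst w)))(t + 1 := fst (snd w))) \<in> measurable ?N (PiM {1..Suc t} (cov_space M))"
    by (rule measurable_fun_upd[OF *(1)]) (simp_all add: sa_space_def hist_space_def)
  moreover have "(\<lambda>w. (fst (snd (fst (fst w))))(t := snd (fst w))) \<in> measurable ?N (PiM {1..<Suc t} (act_space M))"
    by (rule measurable_fun_upd[OF *(2)]) (simp_all add: sa_space_def hist_space_def)
  moreover have "(\<lambda>w. (snd (snd (fst (fst w))))(t := snd (snd w))) \<in> measurable ?N (PiM {1..<Suc t} (\<lambda>_. borel))"
    by (rule measurable_fun_upd[OF *(2)]) (simp_all add: sa_space_def hist_space_def)
  ultimately have "(\<lambda>w. ((fst (fst (fst w)))(t + 1 := fst (snd w)),
      (fst (snd (fst (fst w))))(t := snd (fst w)), (snd (snd (fst (fst w))))(t := snd (snd w))))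
      \<in> measurable ?N (hist_space M (Suc t))" (is "?f \<in> _")
    unfolding hist_space_def[of M "Suc t"] by (intro measurable_Pair) auto
  moreover have "?f = (\<lambda>(h, z). extend_hist t h z)"
    by (auto simp: fun_eq_iff)
  ultimately show ?thesis by simp
qed

lemma extend_hist_hist:
  assumes "1 \<le> t"
  shows "extend_hist t (hist M t \<omega>, action M t \<omega>) (covariate M (t + 1) \<omega>, outcome M t \<omega>) = hist M (Suc t) \<omega>"
  using assms by (auto simp: hist_def fun_eq_iff)

lemma sets_hist_law [measurable_cong, simp]: "sets (hist_law M t) = sets (hist_space M t)"
  by (simp add: hist_law_def)

lemma sets_sa_law [measurable_cong, simp]: "sets (sa_law M t) = sets (sa_space M t)"
  by (simp add: sa_law_def)

locale status_quo_model =
  fixes M :: "('w, 'x, 'a) trajectory_model" and \<pi> :: "('x, 'a) policy"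
  assumes model: "is_trajectory_model M"
    and policy: "is_policy M \<pi>"
    and status_quo: "is_status_quo M \<pi>"
begin

lemma prob_space_obs: "prob_space (obs M)"
  using model by (simp add: is_trajectory_model_def)

sublocale prob_space "obs M" by (rule prob_space_obs)

lemma sigma_finite_act: "t \<in> {1..horizon M} \<Longrightarrow> sigma_finite_measure (act_space M t)"
  unfolding act_space_def
  using model by (intro sigma_finite_measure_restrict_space) (auto simp: is_trajectory_model_def)

lemma measurable_hist [measurable]:
  assumes "1 \<le> t" "t \<le> Suc (horizon M)"
  shows "hist M t \<in> measurable (obs M) (hist_space M t)"
proof -
  have "(\<lambda>\<omega>. \<lambda>k\<in>{1..t}. covariate M k \<omega>) \<in> measurable (obs M) (PiM {1..t} (cov_space M))"
    using model assms by (intro measurable_restrict) (auto simp: is_trajectory_model_def)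
  moreover have "(\<lambda>\<omega>. \<lambda>k\<in>{1..<t}. action M k \<omega>) \<in> measurable (obs M) (PiM {1..<t} (act_space M))"
    using model assms by (intro measurable_restrict) (auto simp: is_trajectory_model_def)
  moreover have "(\<lambda>\<omega>. \<lambda>k\<in>{1..<t}. outcome M k \<omega>) \<in> measurable (obs M) (PiM {1..<t} (\<lambda>_. borel))"
    using model assms by (intro measurable_restrict) (auto simp: is_trajectory_model_def)
  ultimately show ?thesis
    unfolding hist_space_def hist_def[abs_def] by (intro measurable_Pair) auto
qed

lemma stage:
  assumes "t \<in> {1..horizon M}"
  shows "policy_stage (obs M) (act_space M t) (hist_space M t) (hist M t) (action M t) (\<pi> t)"
proof -
  interpret A: sigma_finite_measure "act_space M t" by (rule sigma_finite_act[OF assms])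
  show ?thesis
  proof unfold_locales
    show "hist M t \<in> measurable (obs M) (hist_space M t)" using assms by (intro measurable_hist) auto
    show "action M t \<in> measurable (obs M) (act_space M t)"
      using model assms by (simp add: is_trajectory_model_def)
    show "(\<lambda>(s, a). \<pi> t s a) \<in> borel_measurable (hist_space M t \<Otimes>\<^sub>M act_space M t)"
      using policy assms by (simp add: is_policy_def sa_space_def)
    show "distr (obs M) (hist_space M t \<Otimes>\<^sub>M act_space M t) (\<lambda>\<omega>. (hist M t \<omega>, action M t \<omega>)) =
        density (distr (obs M) (hist_space M t) (hist M t) \<Otimes>\<^sub>M act_space M t) (\<lambda>(s, a). ennreal (\<pi> t s a))"
      using status_quo assms by (simp add: is_status_quo_def sa_law_def hist_law_def sa_space_def)
    show "AE s in distr (obs M) (hist_space M t) (hist M t).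
        (\<forall>a\<in>space (act_space M t). 0 \<le> \<pi> t s a) \<and> (\<integral>\<^sup>+a. ennreal (\<pi> t s a) \<partial>act_space M t) = 1"
      using policy assms unfolding is_policy_def hist_law_def by blast
  qed
qed

lemma measurable_hist_ratio:
  assumes "is_policy M \<pi>'" "1 \<le> t" "t \<le> Suc (horizon M)"
  shows "hist_ratio \<pi> \<pi>' t \<in> borel_measurable (hist_space M t)"
proof -
  have *: "(\<lambda>s. p k (trunc_hist k s) (fst (snd s) k)) \<in> borel_measurable (hist_space M t)"
    if k: "k \<in> {1..<t}" and p: "is_policy M p" for k and p :: "('x, 'a) policy"
  proof -
    have "(\<lambda>s. (trunc_hist k s, fst (snd s) k)) \<in> measurable (hist_space M t) (sa_space M k)"
      unfolding sa_space_def
    proof (rule measurable_Pair)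
      show "trunc_hist k \<in> measurable (hist_space M t) (hist_space M k)"
        using k by (intro measurable_trunc_hist) auto
      show "(\<lambda>s. fst (snd s) k) \<in> measurable (hist_space M t) (act_space M k)"
        unfolding hist_space_def
        by (rule measurable_compose[OF _ measurable_component_singleton[OF k]]) simp
    qed
    moreover have "(\<lambda>(s, a). p k s a) \<in> borel_measurable (sa_space M k)"
      using p k assms by (auto simp: is_policy_def)
    ultimately have "(\<lambda>s. case (trunc_hist k s, fst (snd s) k) of (s, a) \<Rightarrow> p k s a) \<in> borel_measurable (hist_space M t)"
      by (rule measurable_compose)
    then show ?thesis by simp
  qed
  show ?thesis
    unfolding hist_ratio_def[abs_def]
    by (intro borel_measurable_prod borel_measurable_divide * assms(1) policy)
qed

text \<open>The product stops before stage \<open>t\<close>, so the action at \<open>t\<close> has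
  no influence on it. This predictability is what allows the ratio to be pulled out of conditional
  expectations given the history.\<close>

lemma measurable_likelihood_ratio:
  assumes "is_policy M \<pi>'" "1 \<le> t" "t \<le> Suc (horizon M)"
  shows "likelihood_ratio M \<pi> \<pi>' t \<in> borel_measurable (obs M)"
    "likelihood_ratio M \<pi> \<pi>' t \<in> borel_measurable (vimage_algebra (space (obs M)) (hist M t) (hist_space M t))"
proof -
  have eq: "likelihood_ratio M \<pi> \<pi>' t = (\<lambda>\<omega>. hist_ratio \<pi> \<pi>' t (hist M t \<omega>))"
    by (auto simp: likelihood_ratio_hist)
  show "likelihood_ratio M \<pi> \<pi>' t \<in> borel_measurable (obs M)"
    unfolding eq by (rule measurable_compose[OF measurable_hist measurable_hist_ratio]) (use assms in auto)
  show "likelihood_ratio M \<pi> \<pi>' t \<in> borel_measurable (vimage_algebra (space (obs M)) (hist M t) (hist_space M t))"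
    unfolding eq using measurable_hist[OF assms(2,3)]
    by (intro measurable_compose[OF measurable_vimage_algebra1 measurable_hist_ratio] assms)
       (auto simp: measurable_def)
qed

end

section \<open>Changing the policy at one stage\<close>

text \<open>Used to order the information at successive times: the history at \<open>t\<close>, the
  history with the action at \<open>t\<close>, the history at \<open>t + 1\<close>. Each is a
  function of the next.\<close>

lemma subalgebra_vimage_compose:
  assumes "V \<in> \<Omega> \<rightarrow> space N1" "g \<in> measurable N1 N2" "\<And>\<omega>. \<omega> \<in> \<Omega> \<Longrightarrow> W \<omega> = g (V \<omega>)"
  shows "subalgebra (vimage_algebra \<Omega> V N1) (vimage_algebra \<Omega> W N2)"
  unfolding subalgebra_def
proof (intro conjI subsetI)
  have W: "W \<in> \<Omega> \<rightarrow> space N2" using assms(1,3) by (auto intro!: measurable_space[OF assms(2)])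
  fix X assume "X \<in> sets (vimage_algebra \<Omega> W N2)"
  then obtain B where B: "B \<in> sets N2" "X = W -` B \<inter> \<Omega>"
    by (auto simp: sets_vimage_algebra2[OF W])
  have "X = V -` (g -` B \<inter> space N1) \<inter> \<Omega>" using B(2) assms by auto
  then show "X \<in> sets (vimage_algebra \<Omega> V N1)"
    using measurable_sets[OF assms(2) B(1)] unfolding sets_vimage_algebra2[OF assms(1)] by blast
qed simp

lemma subalgebra_vimage:
  "V \<in> measurable P N \<Longrightarrow> subalgebra P (vimage_algebra (space P) V N)"
  unfolding subalgebra_def
  by (auto simp: sets_vimage_algebra2 measurable_def)

locale policy_change = policy_stage +
  fixes p' :: "'c \<Rightarrow> 'b \<Rightarrow> real"
  assumes p'_meas [measurable]: "(\<lambda>(s, a). p' s a) \<in> borel_measurable (H \<Otimes>\<^sub>M A)"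
    and p'_dens: "AE s in distr P H S. (\<forall>a\<in>space A. 0 \<le> p' s a) \<and> (\<integral>\<^sup>+a. ennreal (p' s a) \<partial>A) = 1"
    and p'_ac: "AE s in distr P H S. AE a in A. p s a = 0 \<longrightarrow> p' s a = 0"
begin

abbreviation "ratio s a \<equiv> p' s a / p s a"

text \<open>Where \<open>p\<close> is 0 the ratio is 0 by the convention for division, and absolute
  continuity makes \<open>p'\<close> vanish there too. Hence the product formula survives on the
  zero set of \<open>p\<close>.\<close>

lemma AE_ratio: "AE (s, a) in distr P H S \<Otimes>\<^sub>M A. p s a * ratio s a = p' s a \<and> 0 \<le> ratio s a"
proof -
  have m: "(\<lambda>x. p' (fst x) (snd x)) \<in> borel_measurable (distr P H S \<Otimes>\<^sub>M A)"
    "(\<lambda>x. p (fst x) (snd x)) \<in> borel_measurable (distr P H S \<Otimes>\<^sub>M A)"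
    using p'_meas p_meas by (simp_all add: measurable_SA_cong case_prod_beta')
  have "AE x in distr P H S \<Otimes>\<^sub>M A. p (fst x) (snd x) = 0 \<longrightarrow> p' (fst x) (snd x) = 0"
  proof (rule SA.AE_pair_measure)
    show "{x \<in> space (distr P H S \<Otimes>\<^sub>M A). p (fst x) (snd x) = 0 \<longrightarrow> p' (fst x) (snd x) = 0}
        \<in> sets (distr P H S \<Otimes>\<^sub>M A)"
      using m by measurable
  qed (use p'_ac in simp)
  then show ?thesis
    using p_nonneg AE_nonneg_pair[OF p'_meas p'_dens] unfolding case_prod_beta'
    by eventually_elim auto
qed

lemma ratio_meas [measurable]: "(\<lambda>(s, a). ratio s a) \<in> borel_measurable (H \<Otimes>\<^sub>M A)"
  using borel_measurable_divide[OF p'_meas p_meas] by (simp add: case_prod_beta')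

lemma ratio_meas_P: "(\<lambda>\<omega>. ratio (S \<omega>) (U \<omega>)) \<in> borel_measurable P"
  by (rule measurable_SU(1)[OF ratio_meas])

lemma nn_integral_p': "AE \<omega> in P. (\<integral>\<^sup>+a. ennreal (p' (S \<omega>) a) \<partial>A) = 1 \<and> (\<forall>a\<in>space A. 0 \<le> p' (S \<omega>) a)"
  using AE_distrD[OF S_meas p'_dens] by auto

lemma integrable_p': "integrable (P \<Otimes>\<^sub>M A) (\<lambda>(\<omega>, a). p' (S \<omega>) a)"
proof (rule integrableI_bounded)
  show "(\<lambda>(\<omega>, a). p' (S \<omega>) a) \<in> borel_measurable (P \<Otimes>\<^sub>M A)" by (rule measurable_SU(2)[OF p'_meas])
  then have "(\<integral>\<^sup>+x. ennreal (norm (case x of (\<omega>, a) \<Rightarrow> p' (S \<omega>) a)) \<partial>(P \<Otimes>\<^sub>M A))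
      = (\<integral>\<^sup>+\<omega>. (\<integral>\<^sup>+a. ennreal (norm (p' (S \<omega>) a)) \<partial>A) \<partial>P)"
    by (subst A.nn_integral_fst[symmetric]) auto
  also have "\<dots> = (\<integral>\<^sup>+\<omega>. 1 \<partial>P)"
  proof (rule nn_integral_cong_AE)
    show "AE \<omega> in P. (\<integral>\<^sup>+a. ennreal (norm (p' (S \<omega>) a)) \<partial>A) = 1"
      using nn_integral_p'
    proof eventually_elim
      case (elim \<omega>)
      then have "(\<integral>\<^sup>+a. ennreal (norm (p' (S \<omega>) a)) \<partial>A) = (\<integral>\<^sup>+a. ennreal (p' (S \<omega>) a) \<partial>A)"
        by (intro nn_integral_cong) auto
      with elim show ?case by simp
    qed
  qed
  also have "\<dots> < \<infinity>" by (simp add: emeasure_space_1)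
  finally show "(\<integral>\<^sup>+x. ennreal (norm (case x of (\<omega>, a) \<Rightarrow> p' (S \<omega>) a)) \<partial>(P \<Otimes>\<^sub>M A)) < \<infinity>" .
qed

text \<open>Weighting by the ratio redraws the action from \<open>p'\<close> and leaves the law of
  the history alone. Subtracting 1 from the weight leaves the signed density \<open>p' - p\<close>,
  the numerator of the difference quotient.\<close>

lemma
  fixes f :: "'c \<Rightarrow> 'b \<Rightarrow> real"
  assumes f [measurable]: "(\<lambda>(s, a). f s a) \<in> borel_measurable (H \<Otimes>\<^sub>M A)"
  shows integrable_ratio_iff:
      "integrable P (\<lambda>\<omega>. f (S \<omega>) (U \<omega>) * ratio (S \<omega>) (U \<omega>)) \<longleftrightarrow>
       integrable (P \<Otimes>\<^sub>M A) (\<lambda>(\<omega>, a). f (S \<omega>) a * p' (S \<omega>) a)"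
    and integral_ratio:
      "(\<integral>\<omega>. f (S \<omega>) (U \<omega>) * ratio (S \<omega>) (U \<omega>) \<partial>P) = (\<integral>(\<omega>, a). f (S \<omega>) a * p' (S \<omega>) a \<partial>(P \<Otimes>\<^sub>M A))"
    and integrable_diff_iff:
      "integrable P (\<lambda>\<omega>. f (S \<omega>) (U \<omega>) * (ratio (S \<omega>) (U \<omega>) - 1)) \<longleftrightarrow>
       integrable (P \<Otimes>\<^sub>M A) (\<lambda>(\<omega>, a). f (S \<omega>) a * (p' (S \<omega>) a - p (S \<omega>) a))"
    and integral_diff:
      "(\<integral>\<omega>. f (S \<omega>) (U \<omega>) * (ratio (S \<omega>) (U \<omega>) - 1) \<partial>P) =
       (\<integral>(\<omega>, a). f (S \<omega>) a * (p' (S \<omega>) a - p (S \<omega>) a) \<partial>(P \<Otimes>\<^sub>M A))"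
proof -
  have m: "(\<lambda>x. f (fst x) (snd x)) \<in> borel_measurable (H \<Otimes>\<^sub>M A)" "(\<lambda>x. p (fst x) (snd x)) \<in> borel_measurable (H \<Otimes>\<^sub>M A)"
    "(\<lambda>x. p' (fst x) (snd x)) \<in> borel_measurable (H \<Otimes>\<^sub>M A)"
    using f p_meas p'_meas by (simp_all add: case_prod_beta')
  have m1: "(\<lambda>(s, a). f s a * ratio s a) \<in> borel_measurable (H \<Otimes>\<^sub>M A)"
    and m2: "(\<lambda>(s, a). f s a * (ratio s a - 1)) \<in> borel_measurable (H \<Otimes>\<^sub>M A)"
    and m3: "(\<lambda>(s, a). p s a * (f s a * ratio s a)) \<in> borel_measurable (H \<Otimes>\<^sub>M A)"
    and m4: "(\<lambda>(s, a). p s a * (f s a * (ratio s a - 1))) \<in> borel_measurable (H \<Otimes>\<^sub>M A)"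
    and m5: "(\<lambda>(s, a). f s a * p' s a) \<in> borel_measurable (H \<Otimes>\<^sub>M A)"
    and m6: "(\<lambda>(s, a). f s a * (p' s a - p s a)) \<in> borel_measurable (H \<Otimes>\<^sub>M A)"
    unfolding case_prod_beta' using m by measurable
  have ae: "AE (\<omega>, a) in P \<Otimes>\<^sub>M A. p (S \<omega>) a * ratio (S \<omega>) a = p' (S \<omega>) a \<and> 0 \<le> ratio (S \<omega>) a"
    by (rule AE_pairD[OF AE_ratio])
  have ae1: "AE x in P \<Otimes>\<^sub>M A. (case x of (\<omega>, a) \<Rightarrow> p (S \<omega>) a * (f (S \<omega>) a * ratio (S \<omega>) a)) = (case x of (\<omega>, a) \<Rightarrow> f (S \<omega>) a * p' (S \<omega>) a)"
    using ae by eventually_elim (auto simp: algebra_simps)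
  have ae2: "AE x in P \<Otimes>\<^sub>M A. (case x of (\<omega>, a) \<Rightarrow> p (S \<omega>) a * (f (S \<omega>) a * (ratio (S \<omega>) a - 1)))
      = (case x of (\<omega>, a) \<Rightarrow> f (S \<omega>) a * (p' (S \<omega>) a - p (S \<omega>) a))"
  proof (use ae in eventually_elim)
    case (elim x)
    obtain \<omega> a where x: "x = (\<omega>, a)" by (cases x)
    have "p (S \<omega>) a * (f (S \<omega>) a * (ratio (S \<omega>) a - 1)) = f (S \<omega>) a * (p (S \<omega>) a * ratio (S \<omega>) a - p (S \<omega>) a)"
      by (simp only: algebra_simps)
    with elim show ?case by (simp add: x)
  qed
  show "integrable P (\<lambda>\<omega>. f (S \<omega>) (U \<omega>) * ratio (S \<omega>) (U \<omega>)) \<longleftrightarrow>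
       integrable (P \<Otimes>\<^sub>M A) (\<lambda>(\<omega>, a). f (S \<omega>) a * p' (S \<omega>) a)"
    unfolding integrable_law_iff[OF m1]
    by (rule integrable_cong_AE[OF measurable_SU(2)[OF m3] measurable_SU(2)[OF m5] ae1])
  show "(\<integral>\<omega>. f (S \<omega>) (U \<omega>) * ratio (S \<omega>) (U \<omega>) \<partial>P) = (\<integral>(\<omega>, a). f (S \<omega>) a * p' (S \<omega>) a \<partial>(P \<Otimes>\<^sub>M A))"
    unfolding integral_law[OF m1]
    by (rule integral_cong_AE[OF measurable_SU(2)[OF m3] measurable_SU(2)[OF m5] ae1])
  show "integrable P (\<lambda>\<omega>. f (S \<omega>) (U \<omega>) * (ratio (S \<omega>) (U \<omega>) - 1)) \<longleftrightarrow>
       integrable (P \<Otimes>\<^sub>M A) (\<lambda>(\<omega>, a). f (S \<omega>) a * (p' (S \<omega>) a - p (S \<omega>) a))"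
    unfolding integrable_law_iff[OF m2]
    by (rule integrable_cong_AE[OF measurable_SU(2)[OF m4] measurable_SU(2)[OF m6] ae2])
  show "(\<integral>\<omega>. f (S \<omega>) (U \<omega>) * (ratio (S \<omega>) (U \<omega>) - 1) \<partial>P) =
       (\<integral>(\<omega>, a). f (S \<omega>) a * (p' (S \<omega>) a - p (S \<omega>) a) \<partial>(P \<Otimes>\<^sub>M A))"
    unfolding integral_law[OF m2]
    by (rule integral_cong_AE[OF measurable_SU(2)[OF m4] measurable_SU(2)[OF m6] ae2])
qed

lemma integrable_ratio: "integrable P (\<lambda>\<omega>. ratio (S \<omega>) (U \<omega>))"
  using integrable_ratio_iff[of "\<lambda>_ _. 1"] integrable_p' by simp

abbreviation "sigma_S \<equiv> vimage_algebra (space P) S H"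
abbreviation "sigma_SU \<equiv> vimage_algebra (space P) (\<lambda>\<omega>. (S \<omega>, U \<omega>)) (H \<Otimes>\<^sub>M A)"

lemma subalgebra_S: "subalgebra P sigma_S"
  by (rule subalgebra_vimage) simp

lemma subalgebra_SU: "subalgebra P sigma_SU"
  by (rule subalgebra_vimage) simp

lemma subalgebra_S_SU: "subalgebra sigma_SU sigma_S"
  using measurable_space[OF S_meas] measurable_space[OF U_meas]
  by (intro subalgebra_vimage_compose[where g = fst]) (auto simp: space_pair_measure)

sublocale S: finite_measure_subalgebra P sigma_S
  by unfold_locales (rule subalgebra_S)

sublocale SU: finite_measure_subalgebra P sigma_SU
  by unfold_locales (rule subalgebra_SU)

text \<open>Given the history, the mean of the ratio is the total mass of \<open>p'\<close>. This is
  the martingale property of likelihood ratios; because of it a change of policy does not affect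
  what was earned before the decision.\<close>

lemma real_cond_exp_ratio: "AE \<omega> in P. real_cond_exp P sigma_S (\<lambda>\<omega>. ratio (S \<omega>) (U \<omega>)) \<omega> = 1"
proof (rule S.real_cond_exp_charact)
  fix B assume "B \<in> sets sigma_S"
  then obtain B' where B' [measurable]: "B' \<in> sets H" and B: "B = S -` B' \<inter> space P"
    using measurable_space[OF S_meas] by (auto simp: sets_vimage_algebra2)
  have f: "(\<lambda>(s, a). indicator B' s :: real) \<in> borel_measurable (H \<Otimes>\<^sub>M A)" by measurable
  have int: "integrable (P \<Otimes>\<^sub>M A) (\<lambda>(\<omega>, a). indicator B' (S \<omega>) * p' (S \<omega>) a)"
  proof (rule Bochner_Integration.integrable_bound[OF integrable_p'])
    have "(\<lambda>(s, a). indicator B' s * p' s a) \<in> borel_measurable (H \<Otimes>\<^sub>M A)"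
      using p'_meas by (simp add: case_prod_beta')
    from measurable_SU(2)[OF this]
    show "(\<lambda>(\<omega>, a). indicator B' (S \<omega>) * p' (S \<omega>) a) \<in> borel_measurable (P \<Otimes>\<^sub>M A)" .
  qed (auto split: split_indicator)
  have "(\<integral>\<omega>\<in>B. ratio (S \<omega>) (U \<omega>) \<partial>P) = (\<integral>\<omega>. indicator B' (S \<omega>) * ratio (S \<omega>) (U \<omega>) \<partial>P)"
    unfolding set_lebesgue_integral_def B by (intro Bochner_Integration.integral_cong) (auto split: split_indicator)
  also have "\<dots> = (\<integral>(\<omega>, a). indicator B' (S \<omega>) * p' (S \<omega>) a \<partial>(P \<Otimes>\<^sub>M A))"
    by (rule integral_ratio[OF f])
  also have "\<dots> = (\<integral>\<omega>. (\<integral>a. indicator B' (S \<omega>) * p' (S \<omega>) a \<partial>A) \<partial>P)"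
    using PA.integral_fst'[OF int] by simp
  also have "\<dots> = (\<integral>\<omega>. indicator B' (S \<omega>) \<partial>P)"
  proof (rule integral_cong_AE)
    show "AE \<omega> in P. (\<integral>a. indicator B' (S \<omega>) * p' (S \<omega>) a \<partial>A) = indicator B' (S \<omega>)"
      using nn_integral_p' AE_space
    proof eventually_elim
      case (elim \<omega>)
      have "(\<lambda>a. p' (S \<omega>) a) \<in> borel_measurable A"
        using measurable_compose[OF measurable_Pair1'[OF measurable_space[OF S_meas elim(2)]] p'_meas] by simp
      then have "(\<integral>a. p' (S \<omega>) a \<partial>A) = enn2real (\<integral>\<^sup>+a. ennreal (p' (S \<omega>) a) \<partial>A)"
        using elim by (intro integral_eq_nn_integral) auto
      then show ?case using elim by simp
    qed
    show "(\<lambda>\<omega>. \<integral>a. indicator B' (S \<omega>) * p' (S \<omega>) a \<partial>A) \<in> borel_measurable P"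
      using PA.integrable_fst'[OF int] by auto
  qed measurable
  also have "\<dots> = (\<integral>\<omega>\<in>B. 1 \<partial>P)"
    unfolding set_lebesgue_integral_def B by (intro Bochner_Integration.integral_cong) (auto split: split_indicator)
  finally show "(\<integral>\<omega>\<in>B. ratio (S \<omega>) (U \<omega>) \<partial>P) = (\<integral>\<omega>\<in>B. 1 \<partial>P)" .
qed (use integrable_ratio in auto)

text \<open>One backward step. \<open>Y\<close> is the total return, \<open>R\<close> the part
  earned before the decision and \<open>G\<close> the information at the next time. Replacing
  \<open>p'\<close> by \<open>p\<close> at this stage costs the integral with weight
  \<open>ratio - 1\<close>. Only the two displayed products are assumed integrable, since
  \<open>L\<close> is unbounded and may not be multiplied into \<open>R\<close> and \<open>q\<close>
  separately.\<close>

lemma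
  assumes Y: "integrable P Y" and G: "subalgebra P G" "subalgebra G sigma_SU"
    and L: "L \<in> borel_measurable sigma_S" and R: "R \<in> borel_measurable sigma_S"
    and q: "(\<lambda>(s, a). q s a) \<in> borel_measurable (H \<Otimes>\<^sub>M A)" "integrable P (\<lambda>\<omega>. q (S \<omega>) (U \<omega>))"
    and Yq: "AE \<omega> in P. real_cond_exp P sigma_SU Y \<omega> = R \<omega> + q (S \<omega>) (U \<omega>)"
    and int_next: "integrable P (\<lambda>\<omega>. L \<omega> * ratio (S \<omega>) (U \<omega>) * real_cond_exp P G Y \<omega>)"
    and int_diff: "integrable P (\<lambda>\<omega>. L \<omega> * (q (S \<omega>) (U \<omega>) * (ratio (S \<omega>) (U \<omega>) - 1)))"
  shows integrable_performance_step: "integrable P (\<lambda>\<omega>. L \<omega> * real_cond_exp P sigma_S Y \<omega>)"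
    and performance_step: "(\<integral>\<omega>. L \<omega> * ratio (S \<omega>) (U \<omega>) * real_cond_exp P G Y \<omega> \<partial>P) =
      (\<integral>\<omega>. L \<omega> * (q (S \<omega>) (U \<omega>) * (ratio (S \<omega>) (U \<omega>) - 1)) \<partial>P) + (\<integral>\<omega>. L \<omega> * real_cond_exp P sigma_S Y \<omega> \<partial>P)"
proof -
  interpret G: finite_measure_subalgebra P G by unfold_locales (rule G)
  let ?\<rho> = "\<lambda>\<omega>. ratio (S \<omega>) (U \<omega>)" and ?q = "\<lambda>\<omega>. q (S \<omega>) (U \<omega>)"
  have SUm: "(\<lambda>\<omega>. (S \<omega>, U \<omega>)) \<in> measurable sigma_SU (H \<Otimes>\<^sub>M A)"
    using measurable_space[OF S_meas] measurable_space[OF U_meas]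
    by (intro measurable_vimage_algebra1) (auto simp: space_pair_measure)
  have \<rho>SU [measurable]: "?\<rho> \<in> borel_measurable sigma_SU"
    using measurable_compose[OF SUm ratio_meas] by simp
  have LSU [measurable]: "L \<in> borel_measurable sigma_SU" by (rule measurable_from_subalg[OF subalgebra_S_SU L])
  have [measurable]: "L \<in> borel_measurable P" "R \<in> borel_measurable P" "?\<rho> \<in> borel_measurable P" "?q \<in> borel_measurable P"
    using measurable_from_subalg[OF subalgebra_S L] measurable_from_subalg[OF subalgebra_S R] ratio_meas_P q(2)
    by auto
  let ?V = "\<lambda>\<omega>. L \<omega> * ?\<rho> \<omega> * (R \<omega> + ?q \<omega>)"
  have "AE \<omega> in P. real_cond_exp P sigma_SU (real_cond_exp P G Y) \<omega> = real_cond_exp P sigma_SU Y \<omega>"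
    by (rule SU.real_cond_exp_nested_subalg[OF G Y])
  then have ae: "AE \<omega> in P. L \<omega> * ?\<rho> \<omega> * real_cond_exp P sigma_SU (real_cond_exp P G Y) \<omega> = ?V \<omega>"
    using Yq by eventually_elim simp
  have *: "(\<lambda>\<omega>. L \<omega> * ?\<rho> \<omega>) \<in> borel_measurable sigma_SU" "real_cond_exp P G Y \<in> borel_measurable P"
    by measurable
  \<comment> \<open>\<open>L\<close> times the ratio is measurable for \<open>sigma_SU\<close>, so
    conditioning the remaining factor on \<open>sigma_SU\<close> keeps integrability and the
    integral.\<close>
  note 1 = SU.real_cond_exp_intg[OF int_next *]
  have V: "integrable P ?V"
    by (rule integrable_cong_AE_imp[OF 1(1) _ ae]) measurable
  have V': "(\<integral>\<omega>. ?V \<omega> \<partial>P) = (\<integral>\<omega>. L \<omega> * ?\<rho> \<omega> * real_cond_exp P G Y \<omega> \<partial>P)"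
    unfolding 1(2)[symmetric] by (rule integral_cong_AE) (use ae in \<open>measurable, auto\<close>)
  \<comment> \<open>The ratio is kept at \<open>R\<close> and removed from \<open>q\<close>. As
    \<open>R\<close> depends on the history only and the ratio has conditional mean 1, conditioning
    on \<open>sigma_S\<close> gives \<open>L\<close> times the conditional mean of \<open>Y\<close>.
    Integrability comes from writing \<open>?U\<close> as a difference of two integrable functions,
    not from its summands.\<close>
  let ?U = "\<lambda>\<omega>. L \<omega> * (?\<rho> \<omega> * R \<omega> + ?q \<omega>)"
  have Ueq: "?U = (\<lambda>\<omega>. ?V \<omega> - L \<omega> * (?q \<omega> * (?\<rho> \<omega> - 1)))"
  proof
    have "l * (r * x + y) = l * r * (x + y) - l * (y * (r - 1))" for l r x y :: real
      by (simp add: algebra_simps)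
    then show "?U \<omega> = ?V \<omega> - L \<omega> * (?q \<omega> * (?\<rho> \<omega> - 1))" for \<omega> .
  qed
  have U: "integrable P ?U" unfolding Ueq by (rule Bochner_Integration.integrable_diff[OF V int_diff])
  have U': "(\<integral>\<omega>. ?U \<omega> \<partial>P) = (\<integral>\<omega>. ?V \<omega> \<partial>P) - (\<integral>\<omega>. L \<omega> * (?q \<omega> * (?\<rho> \<omega> - 1)) \<partial>P)"
    unfolding Ueq by (rule Bochner_Integration.integral_diff[OF V int_diff])
  have iR: "integrable P R"
  proof (rule integrable_cong_AE_imp)
    show "integrable P (\<lambda>\<omega>. real_cond_exp P sigma_SU Y \<omega> - ?q \<omega>)"
      using SU.real_cond_exp_int(1)[OF Y] q(2) by simp
    show "AE \<omega> in P. real_cond_exp P sigma_SU Y \<omega> - ?q \<omega> = R \<omega>" using Yq by eventually_elim simp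
  qed measurable
  have "AE \<omega> in P. real_cond_exp P sigma_S (real_cond_exp P sigma_SU Y) \<omega> = real_cond_exp P sigma_S Y \<omega>"
    by (rule S.real_cond_exp_nested_subalg[OF subalgebra_SU subalgebra_S_SU Y])
  moreover have "AE \<omega> in P. real_cond_exp P sigma_S (real_cond_exp P sigma_SU Y) \<omega> = real_cond_exp P sigma_S (\<lambda>\<omega>. R \<omega> + ?q \<omega>) \<omega>"
    by (rule S.real_cond_exp_cong[OF Yq]) measurable
  moreover have "AE \<omega> in P. real_cond_exp P sigma_S (\<lambda>\<omega>. R \<omega> + ?q \<omega>) \<omega> = real_cond_exp P sigma_S R \<omega> + real_cond_exp P sigma_S ?q \<omega>"
    by (rule S.real_cond_exp_add[OF iR q(2)])
  moreover have "AE \<omega> in P. real_cond_exp P sigma_S R \<omega> = R \<omega>"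
    by (rule S.real_cond_exp_F_meas[OF iR R])
  moreover have "AE \<omega> in P. real_cond_exp P sigma_S ?U \<omega> = L \<omega> * (R \<omega> + real_cond_exp P sigma_S ?q \<omega>)"
    by (rule S.real_cond_exp_mult_localized[OF L R integrable_ratio real_cond_exp_ratio q(2) U])
  ultimately have ae2: "AE \<omega> in P. real_cond_exp P sigma_S ?U \<omega> = L \<omega> * real_cond_exp P sigma_S Y \<omega>"
    by eventually_elim simp
  show "integrable P (\<lambda>\<omega>. L \<omega> * real_cond_exp P sigma_S Y \<omega>)"
    by (rule integrable_cong_AE_imp[OF S.real_cond_exp_int(1)[OF U] _ ae2]) measurable
  have "(\<integral>\<omega>. L \<omega> * real_cond_exp P sigma_S Y \<omega> \<partial>P) = (\<integral>\<omega>. real_cond_exp P sigma_S ?U \<omega> \<partial>P)"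
    by (rule integral_cong_AE) (use ae2 in \<open>measurable, auto\<close>)
  then show "(\<integral>\<omega>. L \<omega> * ratio (S \<omega>) (U \<omega>) * real_cond_exp P G Y \<omega> \<partial>P) =
      (\<integral>\<omega>. L \<omega> * (q (S \<omega>) (U \<omega>) * (ratio (S \<omega>) (U \<omega>) - 1)) \<partial>P) + (\<integral>\<omega>. L \<omega> * real_cond_exp P sigma_S Y \<omega> \<partial>P)"
    using S.real_cond_exp_int(2)[OF U] U' V' by simp
qed

end

section \<open>The g-formula as a change of measure\<close>

context status_quo_model
begin

definition abs_cont :: "('x, 'a) policy \<Rightarrow> bool" where
  "abs_cont \<pi>' \<longleftrightarrow> is_policy M \<pi>' \<and>
     (\<forall>t\<in>{1..horizon M}. AE s in hist_law M t. AE a in act_space M t. \<pi> t s a = 0 \<longrightarrow> \<pi>' t s a = 0)"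

lemma stage_change:
  assumes "abs_cont \<pi>'" "t \<in> {1..horizon M}"
  shows "policy_change (obs M) (act_space M t) (hist_space M t) (hist M t) (action M t) (\<pi> t) (\<pi>' t)"
proof -
  interpret policy_stage "obs M" "act_space M t" "hist_space M t" "hist M t" "action M t" "\<pi> t"
    by (rule stage[OF assms(2)])
  show ?thesis
  proof unfold_locales
    show "(\<lambda>(s, a). \<pi>' t s a) \<in> borel_measurable (hist_space M t \<Otimes>\<^sub>M act_space M t)"
      using assms by (simp add: abs_cont_def is_policy_def sa_space_def)
    show "AE s in distr (obs M) (hist_space M t) (hist M t).
        (\<forall>a\<in>space (act_space M t). 0 \<le> \<pi>' t s a) \<and> (\<integral>\<^sup>+a. ennreal (\<pi>' t s a) \<partial>act_space M t) = 1"
      using assms unfolding abs_cont_def is_policy_def hist_law_def by blast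
    show "AE s in distr (obs M) (hist_space M t) (hist M t). AE a in act_space M t. \<pi> t s a = 0 \<longrightarrow> \<pi>' t s a = 0"
      using assms unfolding abs_cont_def hist_law_def by blast
  qed
qed

lemma sa_law_density:
  "t \<in> {1..horizon M} \<Longrightarrow>
    sa_law M t = density (hist_law M t \<Otimes>\<^sub>M act_space M t) (\<lambda>(s, a). ennreal (\<pi> t s a))"
  using status_quo by (simp add: is_status_quo_def)

text \<open>The decision half of one step of \<open>g_law\<close>: a weight on histories followed by
  a draw from \<open>\<pi>'\<close> equals the observed law of the pair with the weight multiplied
  by the ratio, because \<open>\<pi>\<close> times the ratio is \<open>\<pi>'\<close> almost
  everywhere.\<close>

lemma g_step_density:
  assumes ac: "abs_cont \<pi>'" and t: "t \<in> {1..horizon M}"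
    and w [measurable]: "w \<in> borel_measurable (hist_space M t)"
  shows "density (density (hist_law M t) (\<lambda>s. ennreal (w s)) \<Otimes>\<^sub>M act_space M t) (\<lambda>(s, a). ennreal (\<pi>' t s a)) =
    density (sa_law M t) (\<lambda>(s, a). ennreal (w s * (\<pi>' t s a / \<pi> t s a)))"
proof -
  interpret policy_change "obs M" "act_space M t" "hist_space M t" "hist M t" "action M t" "\<pi> t" "\<pi>' t"
    by (rule stage_change[OF ac t])
  let ?A = "act_space M t" and ?H = "hist_space M t"
  let ?N = "hist_law M t \<Otimes>\<^sub>M ?A"
  have N: "distr (obs M) ?H (hist M t) = hist_law M t" by (simp add: hist_law_def)
  have sN: "sets ?N = sets (?H \<Otimes>\<^sub>M ?A)" using sets_SA unfolding N .
  have m: "(\<lambda>x. \<pi>' t (fst x) (snd x)) \<in> borel_measurable ?N" "(\<lambda>x. \<pi> t (fst x) (snd x)) \<in> borel_measurable ?N"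
    using p'_meas p_meas measurable_cong_sets[OF sN refl] by (auto simp: case_prod_beta')
  have wN: "(\<lambda>x. w (fst x)) \<in> borel_measurable ?N"
    by measurable
  \<comment> \<open>The action measure is written as a density 1 over itself so that
    \<open>pair_measure_density\<close> can move the weight to the product.\<close>
  have "density (hist_law M t) (\<lambda>s. ennreal (w s)) \<Otimes>\<^sub>M ?A =
      density (hist_law M t) (\<lambda>s. ennreal (w s)) \<Otimes>\<^sub>M density ?A (\<lambda>_. 1)"
    by (simp add: density_1)
  also have "\<dots> = density ?N (\<lambda>(s, a). ennreal (w s) * 1)"
    by (rule pair_measure_density) (auto simp: density_1 A.sigma_finite_measure_axioms)
  finally have 1: "density (hist_law M t) (\<lambda>s. ennreal (w s)) \<Otimes>\<^sub>M ?A = density ?N (\<lambda>x. ennreal (w (fst x)))"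
    by (simp add: case_prod_beta')
  have "density (density ?N (\<lambda>x. ennreal (w (fst x)))) (\<lambda>x. ennreal (\<pi>' t (fst x) (snd x))) =
      density ?N (\<lambda>x. ennreal (w (fst x)) * ennreal (\<pi>' t (fst x) (snd x)))"
    using m wN by (intro density_density_eq) auto
  also have "\<dots> = density ?N (\<lambda>x. ennreal (\<pi> t (fst x) (snd x)) * ennreal (w (fst x) * (\<pi>' t (fst x) (snd x) / \<pi> t (fst x) (snd x))))"
  proof (rule density_cong)
    show "AE x in ?N. ennreal (w (fst x)) * ennreal (\<pi>' t (fst x) (snd x)) =
        ennreal (\<pi> t (fst x) (snd x)) * ennreal (w (fst x) * (\<pi>' t (fst x) (snd x) / \<pi> t (fst x) (snd x)))"
      using AE_ratio p_nonneg unfolding N case_prod_beta'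
    proof eventually_elim
      case (elim x)
      let ?p = "\<pi> t (fst x) (snd x)" and ?r = "\<pi>' t (fst x) (snd x) / \<pi> t (fst x) (snd x)"
      \<comment> \<open>No sign of \<open>w\<close> is known here. \<open>ennreal\<close> cuts off
        both sides alike because the factors beside \<open>w\<close> are nonnegative.\<close>
      have "ennreal ?p * ennreal (w (fst x) * ?r) = ennreal (?p * (w (fst x) * ?r))"
        using elim by (intro ennreal_mult'[symmetric]) auto
      also have "?p * (w (fst x) * ?r) = w (fst x) * \<pi>' t (fst x) (snd x)"
        using elim by (metis mult.left_commute)
      also have "ennreal \<dots> = ennreal (w (fst x)) * ennreal (\<pi>' t (fst x) (snd x))"
        using elim by (intro ennreal_mult'') (metis mult_nonneg_nonneg)
      finally show ?case by simp
    qed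
  qed (use m wN in auto)
  also have "\<dots> = density (density ?N (\<lambda>x. ennreal (\<pi> t (fst x) (snd x))))
      (\<lambda>x. ennreal (w (fst x) * (\<pi>' t (fst x) (snd x) / \<pi> t (fst x) (snd x))))"
    using m wN by (intro density_density_eq[symmetric]) auto
  finally show ?thesis
    unfolding 1 sa_law_density[OF t] by (simp add: case_prod_beta')
qed

text \<open>Observed and perturbed model share the transition law \<open>K\<close>, so only the
  decisions contribute factors to the density. Stage by stage, the weight is a function of history
  and action and is merely carried through the draw of the next covariate and outcome.\<close>

lemma g_law_density:
  assumes ac: "abs_cont \<pi>'" and K: "is_transition_law M K" and n: "n \<le> horizon M"
  shows "g_law M K \<pi>' n = density (hist_law M (Suc n)) (\<lambda>s. ennreal (hist_ratio \<pi> \<pi>' (Suc n) s))"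
  using n
proof (induction n)
  case 0
  \<comment> \<open>\<open>g_law\<close> at 0 is the law of the first history, for which the product
    of ratios is empty.\<close>
  show ?case by (simp add: hist_ratio_def density_1)
next
  case (Suc n)
  let ?t = "Suc n"
  have t: "?t \<in> {1..horizon M}" using Suc.prems by auto
  have pol: "is_policy M \<pi>'" using ac by (simp add: abs_cont_def)
  interpret policy_change "obs M" "act_space M ?t" "hist_space M ?t" "hist M ?t" "action M ?t" "\<pi> ?t" "\<pi>' ?t"
    by (rule stage_change[OF ac t])
  let ?w = "hist_ratio \<pi> \<pi>' ?t" and ?C = "cov_space M (?t + 1) \<Otimes>\<^sub>M (borel :: real measure)"
  let ?H' = "hist_space M (Suc ?t)"
  let ?V = "\<lambda>\<omega>. (hist M ?t \<omega>, action M ?t \<omega>)" and ?Z = "\<lambda>\<omega>. (covariate M (?t + 1) \<omega>, outcome M ?t \<omega>)"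
  let ?g = "\<lambda>(s, a). ennreal (?w s * ratio s a)"
  have w: "?w \<in> borel_measurable (hist_space M ?t)"
    using Suc.prems by (intro measurable_hist_ratio[OF pol]) auto
  have H'm [measurable]: "hist M (Suc ?t) \<in> measurable (obs M) ?H'"
    using Suc.prems by (intro measurable_hist) auto
  have Vm: "?V \<in> measurable (obs M) (sa_space M ?t)"
    unfolding sa_space_def by measurable
  have Zm: "?Z \<in> measurable (obs M) ?C"
    using model t unfolding is_trajectory_model_def by (intro measurable_Pair) auto
  have Km: "K ?t \<in> measurable (sa_space M ?t) (prob_algebra ?C)"
    using K t unfolding is_transition_law_def by blast
  have ext: "(\<lambda>(h, z). extend_hist ?t h z) \<in> measurable (sa_space M ?t \<Otimes>\<^sub>M ?C) ?H'"
    by (rule measurable_extend_hist) simp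
  have gm: "?g \<in> borel_measurable (sa_space M ?t)"
  proof -
    have "(\<lambda>x. ?w (fst x) * ratio (fst x) (snd x)) \<in> borel_measurable (hist_space M ?t \<Otimes>\<^sub>M act_space M ?t)"
      using w ratio_meas unfolding case_prod_beta' by (intro borel_measurable_times) auto
    then show ?thesis by (auto simp: sa_space_def case_prod_beta')
  qed
  let ?D = "density (sa_law M ?t) ?g" and ?k = "\<lambda>h. distr (K ?t h) ?H' (extend_hist ?t h)"
  have D: "density (g_law M K \<pi>' n \<Otimes>\<^sub>M act_space M ?t) (\<lambda>(s, a). ennreal (\<pi>' ?t s a)) = ?D"
    using Suc.IH Suc.prems g_step_density[OF ac t w] by simp
  have km: "?k \<in> measurable (sa_space M ?t) (subprob_algebra ?H')"
    using measurable_distr2[OF ext measurable_prob_algebraD[OF Km]] .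
  have km': "?k \<in> measurable ?D (subprob_algebra ?H')"
    using km measurable_cong_sets[of ?D "sa_space M ?t"] by simp
  have ne: "space ?D \<noteq> {}"
    using not_empty measurable_space[OF Vm] by (auto simp: sa_law_def)
  have setsg: "sets (g_law M K \<pi>' ?t) = sets ?H'"
    unfolding g_law.simps D by (rule sets_bind[OF _ ne]) simp
  show ?case
  proof (rule measure_eqI)
    show "sets (g_law M K \<pi>' ?t) = sets (density (hist_law M (Suc ?t)) (\<lambda>s. ennreal (hist_ratio \<pi> \<pi>' (Suc ?t) s)))"
      using setsg by simp
    fix E assume "E \<in> sets (g_law M K \<pi>' ?t)"
    then have E [measurable]: "E \<in> sets ?H'" using setsg by simp
    \<comment> \<open>Weight and event are combined into one function of the pair before and the
      pair after the transition, so that \<open>nn_integral_disintegration\<close>, read from right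
      to left, restores the observed outcomes.\<close>
    let ?f = "\<lambda>x. ?g (fst x) * indicator E (extend_hist ?t (fst x) (snd x))"
    have iE: "(\<lambda>x. indicator E (extend_hist ?t (fst x) (snd x)) :: ennreal) \<in> borel_measurable (sa_space M ?t \<Otimes>\<^sub>M ?C)"
      using measurable_compose[OF ext borel_measurable_indicator[OF E]] by (simp add: case_prod_beta')
    have f: "?f \<in> borel_measurable (sa_space M ?t \<Otimes>\<^sub>M ?C)"
      by (intro borel_measurable_times_ennreal iE measurable_compose[OF measurable_fst gm])
    have Kh: "emeasure (?k h) E = (\<integral>\<^sup>+z. indicator E (extend_hist ?t h z) \<partial>K ?t h)"
      if h: "h \<in> space (sa_space M ?t)" for h
    proof -
      have "extend_hist ?t h \<in> measurable (K ?t h) ?H'"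
        using measurable_compose[OF measurable_Pair1'[OF h] ext]
          measurable_cong_sets[OF sets_kernel[OF measurable_prob_algebraD[OF Km] h] refl] by auto
      then show ?thesis
        using E by (simp add: nn_integral_distr flip: nn_integral_indicator)
    qed
    have mE: "(\<lambda>h. emeasure (?k h) E) \<in> borel_measurable (sa_law M ?t)"
      using measurable_compose[OF km measurable_emeasure_subprob_algebra[OF E]]
        measurable_cong_sets[of "sa_law M ?t" "sa_space M ?t"] by simp
    have "emeasure (g_law M K \<pi>' ?t) E = (\<integral>\<^sup>+h. emeasure (?k h) E \<partial>?D)"
      unfolding g_law.simps D by (rule emeasure_bind[OF ne km' E])
    also have "\<dots> = (\<integral>\<^sup>+h. ?g h * emeasure (?k h) E \<partial>sa_law M ?t)"
      by (rule nn_integral_density) (use gm mE measurable_cong_sets[of "sa_law M ?t" "sa_space M ?t"] in auto)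
    also have "\<dots> = (\<integral>\<^sup>+h. (\<integral>\<^sup>+z. ?f (h, z) \<partial>K ?t h) \<partial>sa_law M ?t)"
    proof (rule nn_integral_cong)
      fix h assume "h \<in> space (sa_law M ?t)"
      then have h: "h \<in> space (sa_space M ?t)" by (simp add: sa_law_def)
      have "(\<lambda>z. indicator E (extend_hist ?t h z) :: ennreal) \<in> borel_measurable (K ?t h)"
        using measurable_compose[OF measurable_Pair1'[OF h] iE]
          measurable_cong_sets[OF sets_kernel[OF measurable_prob_algebraD[OF Km] h] refl] by auto
      then show "?g h * emeasure (?k h) E = (\<integral>\<^sup>+z. ?f (h, z) \<partial>K ?t h)"
        unfolding Kh[OF h] by (simp add: nn_integral_cmult)
    qed
    also have "\<dots> = (\<integral>\<^sup>+\<omega>. ?f (?V \<omega>, ?Z \<omega>) \<partial>obs M)"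
      unfolding sa_law_def
    proof (rule nn_integral_disintegration[symmetric, OF prob_space_obs Vm Zm Km _ f])
      fix b c assume "b \<in> sets (sa_space M ?t)" "c \<in> sets ?C"
      then show "emeasure (obs M) {\<omega> \<in> space (obs M). ?V \<omega> \<in> b \<and> ?Z \<omega> \<in> c} =
          (\<integral>\<^sup>+h\<in>b. emeasure (K ?t h) c \<partial>distr (obs M) (sa_space M ?t) ?V)"
        using K t unfolding is_transition_law_def sa_law_def by blast
    qed
    also have "\<dots> = (\<integral>\<^sup>+\<omega>. ennreal (hist_ratio \<pi> \<pi>' (Suc ?t) (hist M (Suc ?t) \<omega>)) * indicator E (hist M (Suc ?t) \<omega>) \<partial>obs M)"
    proof (rule nn_integral_cong)
      fix \<omega>
      have e: "extend_hist ?t (?V \<omega>) (?Z \<omega>) = hist M (Suc ?t) \<omega>"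
        by (rule extend_hist_hist) simp
      have "?g (?V \<omega>) = ennreal (hist_ratio \<pi> \<pi>' (Suc ?t) (hist M (Suc ?t) \<omega>))"
        using likelihood_ratio_Suc[of ?t M \<pi> \<pi>' \<omega>] by (simp add: likelihood_ratio_hist)
      then show "?f (?V \<omega>, ?Z \<omega>) = ennreal (hist_ratio \<pi> \<pi>' (Suc ?t) (hist M (Suc ?t) \<omega>)) * indicator E (hist M (Suc ?t) \<omega>)"
        unfolding fst_conv snd_conv e by simp
    qed
    also have "\<dots> = emeasure (density (hist_law M (Suc ?t)) (\<lambda>s. ennreal (hist_ratio \<pi> \<pi>' (Suc ?t) s))) E"
    proof -
      have wm: "(\<lambda>s. ennreal (hist_ratio \<pi> \<pi>' (Suc ?t) s)) \<in> borel_measurable ?H'"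
        using measurable_hist_ratio[OF pol, of "Suc ?t"] Suc.prems by auto
      then show ?thesis
        unfolding hist_law_def by (simp add: emeasure_density nn_integral_distr)
    qed
    finally show "emeasure (g_law M K \<pi>' ?t) E =
        emeasure (density (hist_law M (Suc ?t)) (\<lambda>s. ennreal (hist_ratio \<pi> \<pi>' (Suc ?t) s))) E" .
  qed
qed

end

section \<open>Performance difference identity\<close>

lemma integrable_ret_1:
  assumes "\<And>t. t \<in> {1..horizon M} \<Longrightarrow> integrable P (ret M \<gamma> t)"
  shows "integrable P (ret M \<gamma> 1)"
\<comment> \<open>For horizon 0 the assumption says nothing about time 1, but then the return is an
  empty sum.\<close>
proof (cases "horizon M = 0")
  case True
  then have "ret M \<gamma> 1 = (\<lambda>_. 0)" by (simp add: ret_def fun_eq_iff)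
  then show ?thesis by simp
qed (use assms[of 1] in auto)

lemma ret_split:
  assumes "t \<in> {1..horizon M}"
  shows "ret M \<gamma> 1 \<omega> = (\<Sum>k\<in>{1..<t}. \<gamma> ^ (k - 1) * outcome M k \<omega>) + \<gamma> ^ (t - 1) * ret M \<gamma> t \<omega>"
proof -
  have "{1..horizon M} = {1..<t} \<union> {t..horizon M}" "{1..<t} \<inter> {t..horizon M} = {}" using assms by auto
  then have "ret M \<gamma> 1 \<omega> = (\<Sum>k\<in>{1..<t}. \<gamma> ^ (k - 1) * outcome M k \<omega>) + (\<Sum>k\<in>{t..horizon M}. \<gamma> ^ (k - 1) * outcome M k \<omega>)"
    unfolding ret_def by (simp only: sum.union_disjoint finite_atLeastLessThan finite_atLeastAtMost)
  also have "(\<Sum>k\<in>{t..horizon M}. \<gamma> ^ (k - 1) * outcome M k \<omega>) = \<gamma> ^ (t - 1) * ret M \<gamma> t \<omega>"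
    unfolding ret_def sum_distrib_left using assms
    by (intro sum.cong refl) (auto simp flip: power_add mult.assoc)
  finally show ?thesis .
qed

lemma discounted_sum_hist: "discounted_sum M \<gamma> (hist M (Suc (horizon M)) \<omega>) = ret M \<gamma> 1 \<omega>"
  unfolding ret_def discounted_sum_def hist_def by (auto intro!: sum.cong)

lemma measurable_partial_return:
  assumes "\<And>k. k \<in> I \<Longrightarrow> k \<in> {1..<t}"
  shows "(\<lambda>(x, a, y). \<Sum>k\<in>I. c k * y k) \<in> borel_measurable (hist_space M t)"
proof -
  have "(\<lambda>s. \<Sum>k\<in>I. c k * snd (snd s) k) \<in> borel_measurable (hist_space M t)"
  proof (rule borel_measurable_sum)
    fix k assume "k \<in> I"
    then have k: "k \<in> {1..<t}" by (rule assms)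
    have "(\<lambda>s. snd (snd s) k) \<in> measurable (hist_space M t) borel"
      unfolding hist_space_def
      by (rule measurable_compose[OF _ measurable_component_singleton[OF k]]) simp
    then show "(\<lambda>s. c k * snd (snd s) k) \<in> borel_measurable (hist_space M t)" by simp
  qed
  then show ?thesis by (simp add: case_prod_beta')
qed

context status_quo_model
begin

lemma AE_likelihood_ratio_nonneg:
  assumes ac: "abs_cont \<pi>'" and t: "t \<le> Suc (horizon M)"
  shows "AE \<omega> in obs M. 0 \<le> likelihood_ratio M \<pi> \<pi>' t \<omega>"
proof -
  have "AE \<omega> in obs M. 0 \<le> \<pi>' k (hist M k \<omega>) (action M k \<omega>) / \<pi> k (hist M k \<omega>) (action M k \<omega>)"
    if "k \<in> {1..<t}" for k
  proof -
    interpret policy_change "obs M" "act_space M k" "hist_space M k" "hist M k" "action M k" "\<pi> k" "\<pi>' k"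
      by (rule stage_change[OF ac]) (use that t in auto)
    have "AE (s, a) in distr (obs M) (hist_space M k) (hist M k) \<Otimes>\<^sub>M act_space M k. 0 \<le> ratio s a"
      using AE_ratio by eventually_elim auto
    from AE_actD[OF this] show ?thesis .
  qed
  then have "AE \<omega> in obs M. \<forall>k\<in>{1..<t}. 0 \<le> \<pi>' k (hist M k \<omega>) (action M k \<omega>) / \<pi> k (hist M k \<omega>) (action M k \<omega>)"
    by (intro AE_finite_allI) auto
  then show ?thesis
    unfolding likelihood_ratio_def by eventually_elim (auto intro: prod_nonneg)
qed

text \<open>The history at time \<open>T + 1\<close> is the whole trajectory, so the last density of
  the g-formula is the only one needed. Nonnegativity of the ratio turns the \<open>ennreal\<close>
  density into a real weight.\<close>

lemma
  assumes ac: "abs_cont \<pi>'" and K: "is_transition_law M K"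
  shows integrable_cf_law_iff: "integrable (cf_law M K \<pi>') (discounted_sum M \<gamma>) \<longleftrightarrow>
      integrable (obs M) (\<lambda>\<omega>. likelihood_ratio M \<pi> \<pi>' (Suc (horizon M)) \<omega> * ret M \<gamma> 1 \<omega>)"
    and integral_cf_law: "(\<integral>z. discounted_sum M \<gamma> z \<partial>cf_law M K \<pi>') =
      (\<integral>\<omega>. likelihood_ratio M \<pi> \<pi>' (Suc (horizon M)) \<omega> * ret M \<gamma> 1 \<omega> \<partial>obs M)"
proof -
  let ?n = "Suc (horizon M)"
  let ?w = "hist_ratio \<pi> \<pi>' ?n"
  have cf: "cf_law M K \<pi>' = density (hist_law M ?n) (\<lambda>s. ennreal (?w s))"
    unfolding cf_law_def by (rule g_law_density[OF ac K order_refl])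
  have h [measurable]: "hist M ?n \<in> measurable (obs M) (hist_space M ?n)" by (rule measurable_hist) auto
  have w [measurable]: "?w \<in> borel_measurable (hist_space M ?n)"
    using ac by (intro measurable_hist_ratio) (auto simp: abs_cont_def)
  have d [measurable]: "discounted_sum M \<gamma> \<in> borel_measurable (hist_space M ?n)"
    unfolding discounted_sum_def by (rule measurable_partial_return) auto
  have nn: "AE s in hist_law M ?n. 0 \<le> ?w s"
    unfolding hist_law_def using AE_likelihood_ratio_nonneg[OF ac order_refl]
    by (subst AE_distr_iff) (auto simp: likelihood_ratio_hist)
  have wl: "?w \<in> borel_measurable (hist_law M ?n)" "discounted_sum M \<gamma> \<in> borel_measurable (hist_law M ?n)"
    by measurable
  show "integrable (cf_law M K \<pi>') (discounted_sum M \<gamma>) \<longleftrightarrow>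
      integrable (obs M) (\<lambda>\<omega>. likelihood_ratio M \<pi> \<pi>' ?n \<omega> * ret M \<gamma> 1 \<omega>)"
    unfolding cf integrable_density[OF wl(2,1) nn] unfolding hist_law_def
    by (subst integrable_distr_eq) (auto simp: likelihood_ratio_hist discounted_sum_hist)
  show "(\<integral>z. discounted_sum M \<gamma> z \<partial>cf_law M K \<pi>') =
      (\<integral>\<omega>. likelihood_ratio M \<pi> \<pi>' ?n \<omega> * ret M \<gamma> 1 \<omega> \<partial>obs M)"
    unfolding cf integral_density[OF wl(2,1) nn] unfolding hist_law_def
    by (subst integral_distr) (auto simp: likelihood_ratio_hist discounted_sum_hist)
qed

lemma integrable_action_value:
  assumes q: "is_action_value M \<gamma> q" and t: "t \<in> {1..horizon M}" and int: "integrable (obs M) (ret M \<gamma> t)"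
  shows "integrable (obs M) (\<lambda>\<omega>. q t (hist M t \<omega>) (action M t \<omega>))"
proof -
  interpret policy_stage "obs M" "act_space M t" "hist_space M t" "hist M t" "action M t" "\<pi> t"
    by (rule stage[OF t])
  let ?F = "vimage_algebra (space (obs M)) (\<lambda>\<omega>. (hist M t \<omega>, action M t \<omega>)) (sa_space M t)"
  interpret F: finite_measure_subalgebra "obs M" ?F
    by unfold_locales (rule subalgebra_vimage, simp add: sa_space_def)
  have qm: "(\<lambda>(s, a). q t s a) \<in> borel_measurable (hist_space M t \<Otimes>\<^sub>M act_space M t)"
    using q t by (simp add: is_action_value_def sa_space_def)
  show ?thesis
  proof (rule integrable_cong_AE_imp[OF F.real_cond_exp_int(1)[OF int]])
    show "AE \<omega> in obs M. real_cond_exp (obs M) ?F (ret M \<gamma> t) \<omega> = q t (hist M t \<omega>) (action M t \<omega>)"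
      using q t by (simp add: is_action_value_def)
  qed (rule measurable_SU(1)[OF qm])
qed

text \<open>
  Under the perturbed law only the total return is integrable, not each outcome. The backward
  induction therefore runs on \<open>E [L\<^sub>t E [\<Gamma>\<^sub>1 | S\<^sub>t]]\<close> and never splits \<open>\<Gamma>\<^sub>1\<close> under that law.
\<close>

lemma performance_difference:
  assumes ac: "abs_cont \<pi>'" and K: "is_transition_law M K" and q: "is_action_value M \<gamma> q"
    and ret: "\<And>t. t \<in> {1..horizon M} \<Longrightarrow> integrable (obs M) (ret M \<gamma> t)"
    and cf: "integrable (cf_law M K \<pi>') (discounted_sum M \<gamma>)"
    and diff: "\<And>t. t \<in> {1..horizon M} \<Longrightarrow> integrable (obs M \<Otimes>\<^sub>M act_space M t)
      (\<lambda>(\<omega>, a). likelihood_ratio M \<pi> \<pi>' t \<omega> * (q t (hist M t \<omega>) a * (\<pi>' t (hist M t \<omega>) a - \<pi> t (hist M t \<omega>) a)))"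
  shows "(\<integral>z. discounted_sum M \<gamma> z \<partial>cf_law M K \<pi>') =
    (\<integral>\<omega>. ret M \<gamma> 1 \<omega> \<partial>obs M) + (\<Sum>t\<in>{1..horizon M}. \<gamma> ^ (t - 1) *
      (\<integral>(\<omega>, a). likelihood_ratio M \<pi> \<pi>' t \<omega> * (q t (hist M t \<omega>) a * (\<pi>' t (hist M t \<omega>) a - \<pi> t (hist M t \<omega>) a))
        \<partial>(obs M \<Otimes>\<^sub>M act_space M t)))"
proof -
  let ?T = "horizon M"
  define L where "L t = likelihood_ratio M \<pi> \<pi>' t" for t
  define Y where "Y = ret M \<gamma> 1"
  define F where "F t = vimage_algebra (space (obs M)) (hist M t) (hist_space M t)" for t
  define J where "J t = (\<integral>(\<omega>, a). L t \<omega> * (q t (hist M t \<omega>) a * (\<pi>' t (hist M t \<omega>) a - \<pi> t (hist M t \<omega>) a))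
        \<partial>(obs M \<Otimes>\<^sub>M act_space M t))" for t
  have pol: "is_policy M \<pi>'" using ac by (simp add: abs_cont_def)
  have Y: "integrable (obs M) Y" unfolding Y_def by (rule integrable_ret_1[OF ret])
  have hist_pi: "hist M t \<in> space (obs M) \<rightarrow> space (hist_space M t)" if "1 \<le> t" "t \<le> Suc ?T" for t
    using measurable_hist[OF that] by (auto simp: measurable_def)
  have sub: "subalgebra (obs M) (F t)" if "1 \<le> t" "t \<le> Suc ?T" for t
    unfolding F_def by (rule subalgebra_vimage[OF measurable_hist[OF that]])
  \<comment> \<open>Downward induction from \<open>T + 1\<close> to 1. Integrability belongs to the
    claim because each step takes it as input from the later time and hands it on to the earlier
    one.\<close>
  have "integrable (obs M) (\<lambda>\<omega>. L t \<omega> * real_cond_exp (obs M) (F t) Y \<omega>) \<and>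
      (\<integral>\<omega>. L (Suc ?T) \<omega> * Y \<omega> \<partial>obs M) =
      (\<Sum>k\<in>{t..?T}. \<gamma> ^ (k - 1) * J k) + (\<integral>\<omega>. L t \<omega> * real_cond_exp (obs M) (F t) Y \<omega> \<partial>obs M)"
    if "t \<le> Suc ?T" "1 \<le> t" for t
    using that
  proof (induction rule: inc_induct)
    case base
    interpret FT: finite_measure_subalgebra "obs M" "F (Suc ?T)" by unfold_locales (rule sub, auto)
    \<comment> \<open>At time \<open>T + 1\<close> everything has been observed, so conditioning
      leaves the total return unchanged and the integrability of the perturbed value starts the
      induction.\<close>
    have "Y \<in> borel_measurable (F (Suc ?T))"
    proof -
      have "discounted_sum M \<gamma> \<in> borel_measurable (hist_space M (Suc ?T))"
        unfolding discounted_sum_def by (rule measurable_partial_return) auto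
      from measurable_compose[OF measurable_vimage_algebra1[OF hist_pi[of "Suc ?T"]] this]
      show ?thesis by (simp add: F_def Y_def discounted_sum_hist[abs_def])
    qed
    from FT.real_cond_exp_F_meas[OF Y this]
    have ae: "AE \<omega> in obs M. L (Suc ?T) \<omega> * Y \<omega> = L (Suc ?T) \<omega> * real_cond_exp (obs M) (F (Suc ?T)) Y \<omega>"
      by eventually_elim simp
    have LY: "integrable (obs M) (\<lambda>\<omega>. L (Suc ?T) \<omega> * Y \<omega>)"
      using cf unfolding integrable_cf_law_iff[OF ac K] L_def Y_def .
    have [measurable]: "L (Suc ?T) \<in> borel_measurable (obs M)"
      unfolding L_def by (rule measurable_likelihood_ratio(1)[OF pol]) auto
    have m: "(\<lambda>\<omega>. L (Suc ?T) \<omega> * real_cond_exp (obs M) (F (Suc ?T)) Y \<omega>) \<in> borel_measurable (obs M)" by measurable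
    show ?case
      using integrable_cong_AE_imp[OF LY m ae] integral_cong_AE[OF borel_measurable_integrable[OF LY] m ae] by simp
  next
    case (step t)
    have t: "t \<in> {1..?T}" using step by auto
    interpret policy_change "obs M" "act_space M t" "hist_space M t" "hist M t" "action M t" "\<pi> t" "\<pi>' t"
      by (rule stage_change[OF ac t])
    \<comment> \<open>\<open>R\<close> is the return already earned at stage \<open>t\<close> and
      \<open>Q\<close> the value still to come, discounted to time 1; their sum is the conditional
      mean of \<open>Y\<close> given history and action.\<close>
    define R where "R \<omega> = (\<Sum>k\<in>{1..<t}. \<gamma> ^ (k - 1) * outcome M k \<omega>)" for \<omega>
    define Q where "Q s a = \<gamma> ^ (t - 1) * q t s a" for s a
    have qm: "(\<lambda>(s, a). q t s a) \<in> borel_measurable (hist_space M t \<Otimes>\<^sub>M act_space M t)"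
      using q t by (simp add: is_action_value_def sa_space_def)
    then have Qm: "(\<lambda>(s, a). Q s a) \<in> borel_measurable (hist_space M t \<Otimes>\<^sub>M act_space M t)"
      by (simp add: Q_def case_prod_beta')
    have F: "F t = sigma_S" by (simp add: F_def)
    have Lm: "L t \<in> borel_measurable sigma_S"
      unfolding L_def using t by (intro measurable_likelihood_ratio(2)[OF pol]) auto
    have Rm: "R \<in> borel_measurable sigma_S"
    proof -
      have "(\<lambda>(x, a, y). \<Sum>k\<in>{1..<t}. \<gamma> ^ (k - 1) * y k) \<in> borel_measurable (hist_space M t)"
        by (rule measurable_partial_return)
      from measurable_compose[OF measurable_vimage_algebra1[OF hist_pi[of t]] this] t
      have "(\<lambda>\<omega>. \<Sum>k\<in>{1..<t}. \<gamma> ^ (k - 1) * (\<lambda>k\<in>{1..<t}. outcome M k \<omega>) k) \<in> borel_measurable sigma_S"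
        by (simp add: hist_def)
      moreover have "(\<lambda>\<omega>. \<Sum>k\<in>{1..<t}. \<gamma> ^ (k - 1) * (\<lambda>k\<in>{1..<t}. outcome M k \<omega>) k) = R"
        by (auto simp: R_def fun_eq_iff intro!: sum.cong)
      ultimately show ?thesis by simp
    qed
    have [measurable]: "R \<in> borel_measurable (obs M)" by (rule measurable_from_subalg[OF subalgebra_S Rm])
    have Y_split: "Y \<omega> = R \<omega> + \<gamma> ^ (t - 1) * ret M \<gamma> t \<omega>" for \<omega>
      unfolding Y_def R_def by (rule ret_split[OF t])
    have iR: "integrable (obs M) R"
    proof -
      have "R = (\<lambda>\<omega>. Y \<omega> - \<gamma> ^ (t - 1) * ret M \<gamma> t \<omega>)" by (simp add: Y_split)
      then show ?thesis using Y ret[OF t] by simp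
    qed
    have igr: "integrable (obs M) (\<lambda>\<omega>. \<gamma> ^ (t - 1) * ret M \<gamma> t \<omega>)" using ret[OF t] by simp
    have Y_eq: "(\<lambda>\<omega>. R \<omega> + \<gamma> ^ (t - 1) * ret M \<gamma> t \<omega>) = Y" by (simp add: Y_split fun_eq_iff)
    have Yq: "AE \<omega> in obs M. real_cond_exp (obs M) sigma_SU Y \<omega> = R \<omega> + Q (hist M t \<omega>) (action M t \<omega>)"
    proof -
      have "AE \<omega> in obs M. real_cond_exp (obs M) sigma_SU (\<lambda>\<omega>. R \<omega> + \<gamma> ^ (t - 1) * ret M \<gamma> t \<omega>) \<omega> =
          real_cond_exp (obs M) sigma_SU R \<omega> + real_cond_exp (obs M) sigma_SU (\<lambda>\<omega>. \<gamma> ^ (t - 1) * ret M \<gamma> t \<omega>) \<omega>"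
        by (rule SU.real_cond_exp_add[OF iR igr])
      moreover have "AE \<omega> in obs M. real_cond_exp (obs M) sigma_SU R \<omega> = R \<omega>"
        by (rule SU.real_cond_exp_F_meas[OF iR measurable_from_subalg[OF subalgebra_S_SU Rm]])
      moreover have "AE \<omega> in obs M. real_cond_exp (obs M) sigma_SU (\<lambda>\<omega>. \<gamma> ^ (t - 1) * ret M \<gamma> t \<omega>) \<omega> =
          \<gamma> ^ (t - 1) * real_cond_exp (obs M) sigma_SU (ret M \<gamma> t) \<omega>"
        by (rule SU.real_cond_exp_cmult[OF ret[OF t]])
      moreover have "AE \<omega> in obs M. real_cond_exp (obs M) sigma_SU (ret M \<gamma> t) \<omega> = q t (hist M t \<omega>) (action M t \<omega>)"
        using q t by (simp add: is_action_value_def sa_space_def)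
      ultimately show ?thesis unfolding Y_eq by eventually_elim (simp add: Q_def)
    qed
    have iQ: "integrable (obs M) (\<lambda>\<omega>. Q (hist M t \<omega>) (action M t \<omega>))"
      unfolding Q_def using integrable_action_value[OF q t ret[OF t]] by simp
    have subF: "subalgebra (F (Suc t)) sigma_SU"
      unfolding F_def
    proof (rule subalgebra_vimage_compose[where g = "\<lambda>s. (trunc_hist t s, fst (snd s) t)"])
      show "hist M (Suc t) \<in> space (obs M) \<rightarrow> space (hist_space M (Suc t))" using t by (intro hist_pi) auto
      have tm: "t \<in> {1..<Suc t}" using t by auto
      have "(\<lambda>s. fst (snd s) t) \<in> measurable (hist_space M (Suc t)) (act_space M t)"
        unfolding hist_space_def
        by (rule measurable_compose[OF _ measurable_component_singleton[OF tm]]) simp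
      then show "(\<lambda>s. (trunc_hist t s, fst (snd s) t)) \<in> measurable (hist_space M (Suc t)) (hist_space M t \<Otimes>\<^sub>M act_space M t)"
        by (intro measurable_Pair measurable_trunc_hist) auto
      show "(hist M t \<omega>, action M t \<omega>) = (trunc_hist t (hist M (Suc t) \<omega>), fst (snd (hist M (Suc t) \<omega>)) t)" for \<omega>
        using t by (simp add: trunc_hist_hist) (simp add: hist_def)
    qed
    have LSuc: "L (Suc t) \<omega> = L t \<omega> * ratio (hist M t \<omega>) (action M t \<omega>)" for \<omega>
      unfolding L_def using t by (intro likelihood_ratio_Suc) auto
    have IH: "integrable (obs M) (\<lambda>\<omega>. L (Suc t) \<omega> * real_cond_exp (obs M) (F (Suc t)) Y \<omega>)"
      "(\<integral>\<omega>. L (Suc ?T) \<omega> * Y \<omega> \<partial>obs M) = (\<Sum>k\<in>{Suc t..?T}. \<gamma> ^ (k - 1) * J k) +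
        (\<integral>\<omega>. L (Suc t) \<omega> * real_cond_exp (obs M) (F (Suc t)) Y \<omega> \<partial>obs M)"
      using step.IH by auto
    define f where "f s a = hist_ratio \<pi> \<pi>' t s * q t s a" for s a
    have fm: "(\<lambda>(s, a). f s a) \<in> borel_measurable (hist_space M t \<Otimes>\<^sub>M act_space M t)"
    proof -
      have "hist_ratio \<pi> \<pi>' t \<in> borel_measurable (hist_space M t)"
        using t by (intro measurable_hist_ratio[OF pol]) auto
      then show ?thesis using qm by (simp add: f_def case_prod_beta')
    qed
    have f_hist: "f (hist M t \<omega>) a * c = L t \<omega> * (q t (hist M t \<omega>) a * c)" for \<omega> a c
      by (simp add: f_def L_def likelihood_ratio_hist)
    have id: "integrable (obs M) (\<lambda>\<omega>. L t \<omega> * (q t (hist M t \<omega>) (action M t \<omega>) * (ratio (hist M t \<omega>) (action M t \<omega>) - 1)))"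
      using integrable_diff_iff[OF fm] diff[OF t] unfolding f_hist L_def by simp
    have Jt: "(\<integral>\<omega>. L t \<omega> * (q t (hist M t \<omega>) (action M t \<omega>) * (ratio (hist M t \<omega>) (action M t \<omega>) - 1)) \<partial>obs M) = J t"
      using integral_diff[OF fm] unfolding f_hist J_def .
    have Q_eq: "L t \<omega> * (Q (hist M t \<omega>) (action M t \<omega>) * c) = \<gamma> ^ (t - 1) * (L t \<omega> * (q t (hist M t \<omega>) (action M t \<omega>) * c))" for \<omega> c
      by (simp add: Q_def)
    have id': "integrable (obs M) (\<lambda>\<omega>. L t \<omega> * (Q (hist M t \<omega>) (action M t \<omega>) * (ratio (hist M t \<omega>) (action M t \<omega>) - 1)))"
      unfolding Q_eq by (rule integrable_mult_right[OF id])
    have Jt': "(\<integral>\<omega>. L t \<omega> * (Q (hist M t \<omega>) (action M t \<omega>) * (ratio (hist M t \<omega>) (action M t \<omega>) - 1)) \<partial>obs M) = \<gamma> ^ (t - 1) * J t"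
      unfolding Q_eq Jt[symmetric] by (rule integral_mult_right_zero)
    have subP: "subalgebra (obs M) (F (Suc t))" using t by (intro sub) auto
    note ps = Y subP subF Lm Rm Qm iQ Yq IH(1)[unfolded LSuc] id'
    have sum: "(\<Sum>k\<in>{t..?T}. \<gamma> ^ (k - 1) * J k) = \<gamma> ^ (t - 1) * J t + (\<Sum>k\<in>{Suc t..?T}. \<gamma> ^ (k - 1) * J k)"
      using t by (simp add: sum.atLeast_Suc_atMost)
    show ?case
      unfolding F sum IH(2)
      using integrable_performance_step[OF ps] performance_step[OF ps] Jt'
      by (simp only: LSuc) simp
  qed
  from this[of 1]
  have *: "(\<integral>\<omega>. L (Suc ?T) \<omega> * Y \<omega> \<partial>obs M) =
      (\<Sum>k\<in>{1..?T}. \<gamma> ^ (k - 1) * J k) + (\<integral>\<omega>. L 1 \<omega> * real_cond_exp (obs M) (F 1) Y \<omega> \<partial>obs M)" by simp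
  interpret F1: finite_measure_subalgebra "obs M" "F 1" by unfold_locales (rule sub, auto)
  \<comment> \<open>At time 1 the product is empty, and what remains is the unperturbed mean of the
    total return.\<close>
  have "L 1 = (\<lambda>_. 1)" by (auto simp: L_def likelihood_ratio_def)
  then have "(\<integral>\<omega>. L 1 \<omega> * real_cond_exp (obs M) (F 1) Y \<omega> \<partial>obs M) = (\<integral>\<omega>. Y \<omega> \<partial>obs M)"
    using F1.real_cond_exp_int(2)[OF Y] by simp
  with * show ?thesis
    unfolding integral_cf_law[OF ac K] by (simp only: L_def Y_def J_def add.commute)
qed

end

section \<open>Limits along the path\<close>

text \<open>Convergence along \<open>at_right c\<close> is tested on sequences, and along one
  sequence the bound fails on countably many null sets at most. This is why a bound whose
  exceptional set varies with \<open>\<epsilon>\<close> is enough.\<close>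

lemma
  fixes s :: "real \<Rightarrow> 'a \<Rightarrow> real" and c :: real
  assumes w: "integrable M w" and f: "f \<in> borel_measurable M"
    and s: "\<forall>\<^sub>F \<epsilon> in at_right c. s \<epsilon> \<in> borel_measurable M"
    and lim: "AE x in M. ((\<lambda>\<epsilon>. s \<epsilon> x) \<longlongrightarrow> f x) (at_right c)"
    and bound: "\<forall>\<^sub>F \<epsilon> in at_right c. AE x in M. \<bar>s \<epsilon> x\<bar> \<le> w x"
  shows tendsto_integral_at_right: "((\<lambda>\<epsilon>. \<integral>x. s \<epsilon> x \<partial>M) \<longlongrightarrow> (\<integral>x. f x \<partial>M)) (at_right c)"
    and integrable_limit_at_right: "integrable M f"
proof -
  have *: "(\<lambda>n. \<integral>x. s (X n) x \<partial>M) \<longlonglongrightarrow> (\<integral>x. f x \<partial>M) \<and> integrable M f"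
    if X: "filterlim X (at_right c) sequentially" for X :: "nat \<Rightarrow> real"
  proof -
    have "\<forall>\<^sub>F n in sequentially. s (X n) \<in> borel_measurable M \<and> (AE x in M. \<bar>s (X n) x\<bar> \<le> w x)"
      using eventually_conj[OF s bound] X by (rule eventually_compose_filterlim)
    then obtain N where N: "s (X n) \<in> borel_measurable M" "AE x in M. \<bar>s (X n) x\<bar> \<le> w x" if "n \<ge> N" for n
      unfolding eventually_sequentially by blast
    have lim': "AE x in M. (\<lambda>n. s (X (n + N)) x) \<longlonglongrightarrow> f x"
      using lim
    proof eventually_elim
      case (elim x)
      from filterlim_compose[OF this X] show ?case by (rule LIMSEQ_ignore_initial_segment)
    qed
    have b: "AE x in M. norm (s (X (n + N)) x) \<le> w x" for n using N(2)[of "n + N"] by simp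
    have m: "s (X (n + N)) \<in> borel_measurable M" for n using N(1)[of "n + N"] by simp
    have "(\<lambda>n. \<integral>x. s (X (n + N)) x \<partial>M) \<longlonglongrightarrow> (\<integral>x. f x \<partial>M)"
      by (rule integral_dominated_convergence[OF f m w lim' b])
    moreover have "integrable M f"
      by (rule integrable_dominated_convergence[OF f m w lim' b])
    ultimately show ?thesis using LIMSEQ_offset[of "\<lambda>n. \<integral>x. s (X n) x \<partial>M" N] by simp
  qed
  show "((\<lambda>\<epsilon>. \<integral>x. s \<epsilon> x \<partial>M) \<longlongrightarrow> (\<integral>x. f x \<partial>M)) (at_right c)"
    unfolding tendsto_at_iff_sequentially comp_def
  proof (intro allI impI)
    fix X :: "nat \<Rightarrow> real"
    assume "\<forall>i. X i \<in> {c<..} - {c}" "X \<longlonglongrightarrow> c"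
    then have "filterlim X (at_right c) sequentially"
      by (auto simp: filterlim_at intro!: always_eventually)
    from *[OF this] show "(\<lambda>n. \<integral>x. s (X n) x \<partial>M) \<longlonglongrightarrow> (\<integral>x. f x \<partial>M)" by simp
  qed
  \<comment> \<open>Integrability of the limit needs a single sequence that approaches
    \<open>c\<close> from the right.\<close>
  have "filterlim (\<lambda>n. c + inverse (real (Suc n))) (at_right c) sequentially"
    using tendsto_add[OF tendsto_const LIMSEQ_inverse_real_of_nat, of c]
    by (auto simp: filterlim_at intro!: always_eventually)
  from *[OF this] show "integrable M f" by simp
qed

text \<open>Used where a property holds almost everywhere for each small \<open>\<epsilon>\<close>:
  along the sequence the exceptional sets are countably many and have a common null set.\<close>

lemma eventually_at_right_sequence:
  fixes c :: real
  assumes "\<forall>\<^sub>F \<epsilon> in at_right c. P \<epsilon>"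
  obtains X :: "nat \<Rightarrow> real" where "filterlim X (at_right c) sequentially" "\<And>n. P (X n)"
proof -
  have "filterlim (\<lambda>n. c + inverse (real (Suc n))) (at_right c) sequentially" (is "filterlim ?X _ _")
    using tendsto_add[OF tendsto_const LIMSEQ_inverse_real_of_nat, of c]
    by (auto simp: filterlim_at intro!: always_eventually)
  then have "\<forall>\<^sub>F n in sequentially. P (?X n)" and lim: "filterlim ?X (at_right c) sequentially"
    using assms by (auto intro: eventually_compose_filterlim)
  then obtain N where N: "\<And>n. n \<ge> N \<Longrightarrow> P (?X n)" unfolding eventually_sequentially by blast
  have "P (?X (n + N))" for n by (rule N) simp
  moreover have "filterlim (\<lambda>n. ?X (n + N)) (at_right c) sequentially"
    using lim filterlim_compose filterlim_add_const_nat_at_top by blast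
  ultimately show ?thesis by (rule that[rotated])
qed

text \<open>\<open>P\<close> will be convergence of the likelihood ratio over a continuum of
  \<open>\<epsilon>\<close>, a set that is not known to be measurable. Its complement is therefore
  covered by a measurable null set \<open>E\<close>, and \<open>E\<close> times the space is null
  even if the space has infinite measure.\<close>

lemma (in sigma_finite_measure) AE_pair_fst:
  assumes "AE x in N. P x"
  shows "AE x in N \<Otimes>\<^sub>M M. P (fst x)"
proof -
  obtain E where E: "{x \<in> space N. \<not> P x} \<subseteq> E" "E \<in> null_sets N" using assms by (rule AE_E3) auto
  then have [measurable]: "E \<in> sets N" by auto
  have "emeasure (N \<Otimes>\<^sub>M M) (E \<times> space M) = 0"
    using E by (subst emeasure_pair_measure_Times) auto
  then have "E \<times> space M \<in> null_sets (N \<Otimes>\<^sub>M M)" by auto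
  then show ?thesis
    by (rule AE_I') (use E in \<open>auto simp: space_pair_measure\<close>)
qed

section \<open>Convergence of the weighted quotient and the forward representation\<close>

locale policy_path = status_quo_model +
  fixes \<pi>\<epsilon> :: "real \<Rightarrow> ('b, 'c) policy" and Lf :: "nat \<Rightarrow> ('b, 'c) history \<Rightarrow> 'c \<Rightarrow> real"
  assumes path_ac: "\<forall>\<^sub>F \<epsilon> in at_right 0. abs_cont (\<pi>\<epsilon> \<epsilon>)"
    and Lf_meas: "\<And>t. t \<in> {1..horizon M} \<Longrightarrow> (\<lambda>(s, a). Lf t s a) \<in> borel_measurable (sa_space M t)"
    and path_lim: "\<And>t. t \<in> {1..horizon M} \<Longrightarrow> AE (s, a) in hist_law M t \<Otimes>\<^sub>M act_space M t.
        ((\<lambda>\<epsilon>. (\<pi>\<epsilon> \<epsilon> t s a - \<pi> t s a) / \<epsilon>) \<longlongrightarrow> Lf t s a) (at_right 0)"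
begin

text \<open>A limit of the difference quotient forces the perturbed density to tend to
  \<open>\<pi>\<close>. At the observed action \<open>\<pi>\<close> is positive almost surely, so
  each of the finitely many factors tends to 1.\<close>

lemma likelihood_ratio_tendsto:
  assumes t: "t \<le> Suc (horizon M)"
  shows "AE \<omega> in obs M. ((\<lambda>\<epsilon>. likelihood_ratio M \<pi> (\<pi>\<epsilon> \<epsilon>) t \<omega>) \<longlongrightarrow> 1) (at_right 0)"
proof -
  have "AE \<omega> in obs M. ((\<lambda>\<epsilon>. \<pi>\<epsilon> \<epsilon> k (hist M k \<omega>) (action M k \<omega>) / \<pi> k (hist M k \<omega>) (action M k \<omega>)) \<longlongrightarrow> 1) (at_right 0)"
    if "k \<in> {1..<t}" for k
  proof -
    have k: "k \<in> {1..horizon M}" using that t by auto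
    interpret policy_stage "obs M" "act_space M k" "hist_space M k" "hist M k" "action M k" "\<pi> k"
      by (rule stage[OF k])
    from AE_actD[OF path_lim[OF k, unfolded hist_law_def]] p_pos show ?thesis
    proof eventually_elim
      case (elim \<omega>)
      let ?p = "\<pi> k (hist M k \<omega>) (action M k \<omega>)" and ?p' = "\<lambda>\<epsilon>. \<pi>\<epsilon> \<epsilon> k (hist M k \<omega>) (action M k \<omega>)"
      have "((\<lambda>\<epsilon>. ((?p' \<epsilon> - ?p) / \<epsilon> * \<epsilon> + ?p) / ?p) \<longlongrightarrow> (Lf k (hist M k \<omega>) (action M k \<omega>) * 0 + ?p) / ?p) (at_right 0)"
        using elim by (intro tendsto_intros) auto
      moreover have "\<forall>\<^sub>F \<epsilon> in at_right 0. ((?p' \<epsilon> - ?p) / \<epsilon> * \<epsilon> + ?p) / ?p = ?p' \<epsilon> / ?p"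
        using eventually_at_right_less[of "0::real"] by eventually_elim simp
      ultimately have "((\<lambda>\<epsilon>. ?p' \<epsilon> / ?p) \<longlongrightarrow> (Lf k (hist M k \<omega>) (action M k \<omega>) * 0 + ?p) / ?p) (at_right 0)"
        by (rule Lim_transform_eventually)
      then show ?case using elim by simp
    qed
  qed
  then have "AE \<omega> in obs M. \<forall>k\<in>{1..<t}. ((\<lambda>\<epsilon>. \<pi>\<epsilon> \<epsilon> k (hist M k \<omega>) (action M k \<omega>) / \<pi> k (hist M k \<omega>) (action M k \<omega>)) \<longlongrightarrow> 1) (at_right 0)"
    by (intro AE_finite_allI) auto
  then show ?thesis
  proof eventually_elim
    case (elim \<omega>)
    have "((\<lambda>\<epsilon>. \<Prod>k\<in>{1..<t}. \<pi>\<epsilon> \<epsilon> k (hist M k \<omega>) (action M k \<omega>) / \<pi> k (hist M k \<omega>) (action M k \<omega>)) \<longlongrightarrow> (\<Prod>k\<in>{1..<t}. 1)) (at_right 0)"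
      using elim by (intro tendsto_prod) auto
    then show ?case by (simp add: likelihood_ratio_def)
  qed
qed

text \<open>Along a suitable sequence the perturbed densities vanish wherever \<open>\<pi>\<close>
  does, outside one null set, so the quotient is constantly 0 there. This keeps the score from
  losing mass on the zero set of \<open>\<pi>\<close>.\<close>

lemma Lf_eq_0:
  assumes t: "t \<in> {1..horizon M}"
  shows "AE (s, a) in hist_law M t \<Otimes>\<^sub>M act_space M t. \<pi> t s a = 0 \<longrightarrow> Lf t s a = 0"
proof -
  obtain X :: "nat \<Rightarrow> real" where X: "filterlim X (at_right 0) sequentially" "\<And>n. abs_cont (\<pi>\<epsilon> (X n))"
    using eventually_at_right_sequence[OF path_ac] by blast
  have "AE (s, a) in hist_law M t \<Otimes>\<^sub>M act_space M t. \<pi> t s a = 0 \<longrightarrow> \<pi>\<epsilon> (X n) t s a = 0" for n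
  proof -
    interpret policy_change "obs M" "act_space M t" "hist_space M t" "hist M t" "action M t" "\<pi> t" "\<pi>\<epsilon> (X n) t"
      by (rule stage_change[OF X(2) t])
    show ?thesis unfolding hist_law_def using AE_ratio by eventually_elim auto
  qed
  then have "AE x in hist_law M t \<Otimes>\<^sub>M act_space M t. \<forall>n. case x of (s, a) \<Rightarrow> \<pi> t s a = 0 \<longrightarrow> \<pi>\<epsilon> (X n) t s a = 0"
    by (intro AE_all_countable[THEN iffD2] allI)
  with path_lim[OF t] show ?thesis
  proof eventually_elim
    case (elim x)
    obtain s a where x: "x = (s, a)" by (cases x)
    have "Lf t s a = 0" if "\<pi> t s a = 0"
    proof -
      have "((\<lambda>n. (\<pi>\<epsilon> (X n) t s a - \<pi> t s a) / X n) \<longlonglongrightarrow> Lf t s a)"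
        using filterlim_compose[OF _ X(1)] elim by (auto simp: x)
      then have "((\<lambda>n. 0) \<longlonglongrightarrow> Lf t s a)" using elim that by (simp add: x)
      then show ?thesis using LIMSEQ_unique tendsto_const by metis
    qed
    then show ?case by (simp add: x)
  qed
qed

lemma measurable_pair_Lf:
  assumes t: "t \<in> {1..horizon M}"
    and q: "(\<lambda>(s, a). q s a) \<in> borel_measurable (sa_space M t)"
  shows "(\<lambda>(s, a). q s a * Lf t s a) \<in> borel_measurable (hist_space M t \<Otimes>\<^sub>M act_space M t)"
    "(\<lambda>(\<omega>, a). q (hist M t \<omega>) a * Lf t (hist M t \<omega>) a) \<in> borel_measurable (obs M \<Otimes>\<^sub>M act_space M t)"
proof -
  interpret policy_stage "obs M" "act_space M t" "hist_space M t" "hist M t" "action M t" "\<pi> t"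
    by (rule stage[OF t])
  show m: "(\<lambda>(s, a). q s a * Lf t s a) \<in> borel_measurable (hist_space M t \<Otimes>\<^sub>M act_space M t)"
    using Lf_meas[OF t] q by (auto simp: sa_space_def case_prod_beta')
  show "(\<lambda>(\<omega>, a). q (hist M t \<omega>) a * Lf t (hist M t \<omega>) a) \<in> borel_measurable (obs M \<Otimes>\<^sub>M act_space M t)"
    by (rule measurable_SU(2)[OF m])
qed

lemma measurable_pair_quotient:
  assumes t: "t \<in> {1..horizon M}" and ac: "abs_cont \<pi>'"
    and q: "(\<lambda>(s, a). q s a) \<in> borel_measurable (sa_space M t)"
  shows "(\<lambda>(s, a). q s a * ((\<pi>' t s a - \<pi> t s a) / \<epsilon>)) \<in> borel_measurable (hist_space M t \<Otimes>\<^sub>M act_space M t)"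
    "(\<lambda>(\<omega>, a). q (hist M t \<omega>) a * ((\<pi>' t (hist M t \<omega>) a - \<pi> t (hist M t \<omega>) a) / \<epsilon>))
      \<in> borel_measurable (obs M \<Otimes>\<^sub>M act_space M t)"
    "(\<lambda>(\<omega>, a). likelihood_ratio M \<pi> \<pi>' t \<omega> * (q (hist M t \<omega>) a * ((\<pi>' t (hist M t \<omega>) a - \<pi> t (hist M t \<omega>) a) / \<epsilon>)))
      \<in> borel_measurable (obs M \<Otimes>\<^sub>M act_space M t)"
proof -
  interpret policy_change "obs M" "act_space M t" "hist_space M t" "hist M t" "action M t" "\<pi> t" "\<pi>' t"
    by (rule stage_change[OF ac t])
  show m: "(\<lambda>(s, a). q s a * ((\<pi>' t s a - \<pi> t s a) / \<epsilon>)) \<in> borel_measurable (hist_space M t \<Otimes>\<^sub>M act_space M t)"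
    using p_meas p'_meas q by (auto simp: sa_space_def case_prod_beta')
  show m2: "(\<lambda>(\<omega>, a). q (hist M t \<omega>) a * ((\<pi>' t (hist M t \<omega>) a - \<pi> t (hist M t \<omega>) a) / \<epsilon>))
      \<in> borel_measurable (obs M \<Otimes>\<^sub>M act_space M t)"
    by (rule measurable_SU(2)[OF m])
  have l: "likelihood_ratio M \<pi> \<pi>' t \<in> borel_measurable (obs M)"
    using ac t by (intro measurable_likelihood_ratio(1)) (auto simp: abs_cont_def)
  show "(\<lambda>(\<omega>, a). likelihood_ratio M \<pi> \<pi>' t \<omega> * (q (hist M t \<omega>) a * ((\<pi>' t (hist M t \<omega>) a - \<pi> t (hist M t \<omega>) a) / \<epsilon>)))
      \<in> borel_measurable (obs M \<Otimes>\<^sub>M act_space M t)"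
    using borel_measurable_times[OF measurable_compose[OF measurable_fst l] m2] by (simp add: case_prod_beta')
qed

text \<open>Dominated convergence on the product space exchanges the limit with both integrals in
  one stroke. The weight tends to 1, so it disappears from the limit, and the bound \<open>C\<close>
  on the weighted quotients passes to the unweighted limit.\<close>

lemma
  assumes t: "t \<in> {1..horizon M}"
    and q: "(\<lambda>(s, a). q t s a) \<in> borel_measurable (sa_space M t)"
    and dom: "path_dominated M \<pi> \<pi>\<epsilon> q t"
  shows integrable_forward:
      "integrable (obs M \<Otimes>\<^sub>M act_space M t) (\<lambda>(\<omega>, a). q t (hist M t \<omega>) a * Lf t (hist M t \<omega>) a)"
    and eventually_integrable_quotient:
      "\<forall>\<^sub>F \<epsilon> in at_right 0. integrable (obs M \<Otimes>\<^sub>M act_space M t)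
        (\<lambda>(\<omega>, a). likelihood_ratio M \<pi> (\<pi>\<epsilon> \<epsilon>) t \<omega> *
          (q t (hist M t \<omega>) a * ((\<pi>\<epsilon> \<epsilon> t (hist M t \<omega>) a - \<pi> t (hist M t \<omega>) a) / \<epsilon>)))"
    and forward_tendsto:
      "((\<lambda>\<epsilon>. \<integral>(\<omega>, a). likelihood_ratio M \<pi> (\<pi>\<epsilon> \<epsilon>) t \<omega> *
          (q t (hist M t \<omega>) a * ((\<pi>\<epsilon> \<epsilon> t (hist M t \<omega>) a - \<pi> t (hist M t \<omega>) a) / \<epsilon>)) \<partial>(obs M \<Otimes>\<^sub>M act_space M t))
        \<longlongrightarrow> (\<integral>(\<omega>, a). q t (hist M t \<omega>) a * Lf t (hist M t \<omega>) a \<partial>(obs M \<Otimes>\<^sub>M act_space M t))) (at_right 0)"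
proof -
  interpret policy_stage "obs M" "act_space M t" "hist_space M t" "hist M t" "action M t" "\<pi> t"
    by (rule stage[OF t])
  let ?N = "obs M \<Otimes>\<^sub>M act_space M t"
  let ?s = "\<lambda>\<epsilon> (\<omega>, a). likelihood_ratio M \<pi> (\<pi>\<epsilon> \<epsilon>) t \<omega> *
          (q t (hist M t \<omega>) a * ((\<pi>\<epsilon> \<epsilon> t (hist M t \<omega>) a - \<pi> t (hist M t \<omega>) a) / \<epsilon>))"
  let ?f = "\<lambda>(\<omega>, a). q t (hist M t \<omega>) a * Lf t (hist M t \<omega>) a"
  from dom obtain C where C: "integrable ?N C"
    and bd: "\<forall>\<^sub>F \<epsilon> in at_right 0. AE (\<omega>, a) in ?N. \<bar>?s \<epsilon> (\<omega>, a)\<bar> \<le> C (\<omega>, a)"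
    unfolding path_dominated_def by auto
  have bd': "\<forall>\<^sub>F \<epsilon> in at_right 0. AE x in ?N. \<bar>?s \<epsilon> x\<bar> \<le> C x"
    using bd by (simp add: case_prod_beta')
  have m: "\<forall>\<^sub>F \<epsilon> in at_right 0. ?s \<epsilon> \<in> borel_measurable ?N"
    using path_ac by eventually_elim (rule measurable_pair_quotient(3)[OF t _ q])
  have f: "?f \<in> borel_measurable ?N" by (rule measurable_pair_Lf(2)[OF t q])
  have "AE x in ?N. ((\<lambda>\<epsilon>. likelihood_ratio M \<pi> (\<pi>\<epsilon> \<epsilon>) t (fst x)) \<longlongrightarrow> 1) (at_right 0)"
    using t by (intro A.AE_pair_fst likelihood_ratio_tendsto) auto
  moreover have "AE (\<omega>, a) in ?N. ((\<lambda>\<epsilon>. (\<pi>\<epsilon> \<epsilon> t (hist M t \<omega>) a - \<pi> t (hist M t \<omega>) a) / \<epsilon>) \<longlongrightarrow> Lf t (hist M t \<omega>) a) (at_right 0)"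
    by (rule AE_pairD[OF path_lim[OF t, unfolded hist_law_def]])
  ultimately have lim: "AE x in ?N. ((\<lambda>\<epsilon>. ?s \<epsilon> x) \<longlongrightarrow> ?f x) (at_right 0)"
  proof eventually_elim
    case (elim x)
    obtain \<omega> a where x: "x = (\<omega>, a)" by (cases x)
    have "((\<lambda>\<epsilon>. ?s \<epsilon> (\<omega>, a)) \<longlongrightarrow> 1 * (q t (hist M t \<omega>) a * Lf t (hist M t \<omega>) a)) (at_right 0)"
      using elim unfolding x split fst_conv by (intro tendsto_mult tendsto_const)
    then show ?case by (simp add: x)
  qed
  show "integrable ?N ?f" by (rule integrable_limit_at_right[OF C f m lim bd'])
  show "((\<lambda>\<epsilon>. integral\<^sup>L ?N (?s \<epsilon>)) \<longlongrightarrow> integral\<^sup>L ?N ?f) (at_right 0)"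
    by (rule tendsto_integral_at_right[OF C f m lim bd'])
  show "\<forall>\<^sub>F \<epsilon> in at_right 0. integrable ?N (?s \<epsilon>)"
    using m bd'
  proof eventually_elim
    case (elim \<epsilon>)
    show ?case
      by (rule Bochner_Integration.integrable_bound[OF C elim(1)]) (use elim(2) in eventually_elim, auto)
  qed
qed

text \<open>The score is a function of history and action, so conditioning replaces the return by
  \<open>q\<close>. Drawing the action from \<open>\<pi>\<close> then cancels the denominator of the
  score.\<close>

lemma score_eq_forward:
  assumes t: "t \<in> {1..horizon M}" and q: "is_action_value M \<gamma> q"
    and ret: "integrable (obs M) (ret M \<gamma> t)"
    and score: "integrable (obs M) (\<lambda>\<omega>. score \<pi> Lf t (hist M t \<omega>) (action M t \<omega>) * ret M \<gamma> t \<omega>)"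
  shows "(\<integral>\<omega>. score \<pi> Lf t (hist M t \<omega>) (action M t \<omega>) * ret M \<gamma> t \<omega> \<partial>obs M) =
    (\<integral>(\<omega>, a). q t (hist M t \<omega>) a * Lf t (hist M t \<omega>) a \<partial>(obs M \<Otimes>\<^sub>M act_space M t))"
proof -
  interpret policy_stage "obs M" "act_space M t" "hist_space M t" "hist M t" "action M t" "\<pi> t"
    by (rule stage[OF t])
  let ?F = "vimage_algebra (space (obs M)) (\<lambda>\<omega>. (hist M t \<omega>, action M t \<omega>)) (sa_space M t)"
  interpret F: finite_measure_subalgebra "obs M" ?F
    by unfold_locales (rule subalgebra_vimage, simp add: sa_space_def)
  have qm: "(\<lambda>(s, a). q t s a) \<in> borel_measurable (sa_space M t)"
    using q t by (simp add: is_action_value_def)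
  have Lm: "(\<lambda>(s, a). Lf t s a) \<in> borel_measurable (hist_space M t \<Otimes>\<^sub>M act_space M t)"
    using Lf_meas[OF t] by (simp add: sa_space_def)
  have hm: "(\<lambda>(s, a). score \<pi> Lf t s a) \<in> borel_measurable (hist_space M t \<Otimes>\<^sub>M act_space M t)"
    unfolding score_def using borel_measurable_divide[OF Lm p_meas] by (simp add: case_prod_beta')
  have gm: "(\<lambda>(s, a). score \<pi> Lf t s a * q t s a) \<in> borel_measurable (hist_space M t \<Otimes>\<^sub>M act_space M t)"
    using hm qm by (simp add: case_prod_beta' sa_space_def)
  have gm': "(\<lambda>(s, a). \<pi> t s a * (score \<pi> Lf t s a * q t s a)) \<in> borel_measurable (hist_space M t \<Otimes>\<^sub>M act_space M t)"
    using gm p_meas by (simp add: case_prod_beta')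
  have SU: "(\<lambda>\<omega>. (hist M t \<omega>, action M t \<omega>)) \<in> measurable ?F (sa_space M t)"
    using measurable_space[OF S_meas] measurable_space[OF U_meas]
    by (intro measurable_vimage_algebra1) (auto simp: sa_space_def space_pair_measure)
  have hF: "(\<lambda>\<omega>. score \<pi> Lf t (hist M t \<omega>) (action M t \<omega>)) \<in> borel_measurable ?F"
    using measurable_compose[OF SU, of "\<lambda>(s, a). score \<pi> Lf t s a" borel] hm by (simp add: sa_space_def)
  have "(\<integral>\<omega>. score \<pi> Lf t (hist M t \<omega>) (action M t \<omega>) * ret M \<gamma> t \<omega> \<partial>obs M) =
      (\<integral>\<omega>. score \<pi> Lf t (hist M t \<omega>) (action M t \<omega>) * real_cond_exp (obs M) ?F (ret M \<gamma> t) \<omega> \<partial>obs M)"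
    using F.real_cond_exp_intg(2)[OF score hF] ret by simp
  also have "\<dots> = (\<integral>\<omega>. score \<pi> Lf t (hist M t \<omega>) (action M t \<omega>) * q t (hist M t \<omega>) (action M t \<omega>) \<partial>obs M)"
  proof (rule integral_cong_AE)
    have "AE \<omega> in obs M. real_cond_exp (obs M) ?F (ret M \<gamma> t) \<omega> = q t (hist M t \<omega>) (action M t \<omega>)"
      using q t by (simp add: is_action_value_def)
    then show "AE \<omega> in obs M. score \<pi> Lf t (hist M t \<omega>) (action M t \<omega>) * real_cond_exp (obs M) ?F (ret M \<gamma> t) \<omega> =
        score \<pi> Lf t (hist M t \<omega>) (action M t \<omega>) * q t (hist M t \<omega>) (action M t \<omega>)"
      by eventually_elim simp
    show "(\<lambda>\<omega>. score \<pi> Lf t (hist M t \<omega>) (action M t \<omega>) * real_cond_exp (obs M) ?F (ret M \<gamma> t) \<omega>) \<in> borel_measurable (obs M)"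
      using measurable_SU(1)[OF hm] by (intro borel_measurable_times borel_measurable_cond_exp2)
  qed (rule measurable_SU(1)[OF gm])
  also have "\<dots> = (\<integral>(\<omega>, a). \<pi> t (hist M t \<omega>) a * (score \<pi> Lf t (hist M t \<omega>) a * q t (hist M t \<omega>) a) \<partial>(obs M \<Otimes>\<^sub>M act_space M t))"
    by (rule integral_law[OF gm])
  also have "\<dots> = (\<integral>(\<omega>, a). q t (hist M t \<omega>) a * Lf t (hist M t \<omega>) a \<partial>(obs M \<Otimes>\<^sub>M act_space M t))"
  proof (rule integral_cong_AE[OF measurable_SU(2)[OF gm'] measurable_pair_Lf(2)[OF t qm]])
    \<comment> \<open>Where \<open>\<pi>\<close> is 0 the left side is 0 whatever the default of the
      division, and the right side is 0 by \<open>Lf_eq_0\<close>.\<close>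
    show "AE x in obs M \<Otimes>\<^sub>M act_space M t. (case x of (\<omega>, a) \<Rightarrow> \<pi> t (hist M t \<omega>) a * (score \<pi> Lf t (hist M t \<omega>) a * q t (hist M t \<omega>) a)) =
        (case x of (\<omega>, a) \<Rightarrow> q t (hist M t \<omega>) a * Lf t (hist M t \<omega>) a)"
      using AE_pairD[OF Lf_eq_0[OF t, unfolded hist_law_def]]
      by eventually_elim (auto simp: score_def)
  qed
  finally show ?thesis .
qed

lemma pairing_integral:
  assumes t: "t \<in> {1..horizon M}"
    and int: "integrable (obs M \<Otimes>\<^sub>M act_space M t) (\<lambda>(\<omega>, a). g (hist M t \<omega>) a * f (hist M t \<omega>) a)"
  shows "(\<integral>\<omega>. pairing M t f g (hist M t \<omega>) \<partial>obs M) =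
    (\<integral>(\<omega>, a). g (hist M t \<omega>) a * f (hist M t \<omega>) a \<partial>(obs M \<Otimes>\<^sub>M act_space M t))"
proof -
  interpret policy_stage "obs M" "act_space M t" "hist_space M t" "hist M t" "action M t" "\<pi> t"
    by (rule stage[OF t])
  show ?thesis
    using PA.integral_fst'[OF int] by (simp add: pairing_def mult.commute)
qed

end

section \<open>Forward and backward quotients at a fixed parameter\<close>

context policy_change
begin

text \<open>The adjoint relation before any limit: averaging \<open>q\<close> over the kernel and
  then over \<open>p\<close> is averaging \<open>q\<close> over \<open>p'\<close>. It holds history
  by history, after integration over actions, and so covers kernels without a density.\<close>

lemma kernel_quotient:
  fixes q :: "'c \<Rightarrow> 'b \<Rightarrow> real"
  assumes q: "(\<lambda>(s, a). q s a) \<in> borel_measurable (H \<Otimes>\<^sub>M A)" "integrable P (\<lambda>\<omega>. q (S \<omega>) (U \<omega>))"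
    and k: "k \<in> measurable (H \<Otimes>\<^sub>M A) (prob_algebra A)"
    and conv: "AE s in distr P H S. density A (\<lambda>a. ennreal (p' s a)) = density A (\<lambda>a. ennreal (p s a)) \<bind> (\<lambda>a. k (s, a))"
    and fin: "AE \<omega> in P. (\<integral>\<^sup>+a. ennreal \<bar>q (S \<omega>) a * ((p' (S \<omega>) a - p (S \<omega>) a) / \<epsilon>)\<bar> \<partial>A) < \<infinity>"
    and \<epsilon>: "\<epsilon> \<noteq> 0"
  shows "AE \<omega> in P. (\<integral>a. p (S \<omega>) a * (((\<integral>b. q (S \<omega>) b \<partial>k (S \<omega>, a)) - q (S \<omega>) a) / \<epsilon>) \<partial>A) =
    (\<integral>a. q (S \<omega>) a * ((p' (S \<omega>) a - p (S \<omega>) a) / \<epsilon>) \<partial>A)"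
proof -
  have "integrable (P \<Otimes>\<^sub>M A) (\<lambda>(\<omega>, a). p (S \<omega>) a * q (S \<omega>) a)"
    using q integrable_law_iff by blast
  from PA.AE_integrable_fst'[OF this]
  have pq: "AE \<omega> in P. integrable A (\<lambda>a. p (S \<omega>) a * q (S \<omega>) a)" by simp
  show ?thesis
    using pq fin AE_distrD[OF S_meas conv] AE_distrD[OF S_meas p_dens] AE_distrD[OF S_meas p'_dens] AE_space
  proof eventually_elim
    case (elim \<omega>)
    let ?s = "S \<omega>"
    have s: "?s \<in> space H" using elim measurable_space[OF S_meas] by auto
    have sec: "(\<lambda>a. f ?s a) \<in> borel_measurable A" if "(\<lambda>(s, a). f s a) \<in> borel_measurable (H \<Otimes>\<^sub>M A)" for f :: "'c \<Rightarrow> 'b \<Rightarrow> real"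
      using measurable_compose[OF measurable_Pair1'[OF s] that] by simp
    have [measurable]: "(\<lambda>a. p ?s a) \<in> borel_measurable A" "(\<lambda>a. p' ?s a) \<in> borel_measurable A" "(\<lambda>a. q ?s a) \<in> borel_measurable A"
      using sec[OF p_meas] sec[OF p'_meas] sec[OF q(1)] by simp_all
    have nn: "AE a in A. 0 \<le> p ?s a" "AE a in A. 0 \<le> p' ?s a" using elim by auto
    have iq: "integrable A (\<lambda>a. q ?s a * ((p' ?s a - p ?s a) / \<epsilon>))"
      using elim(2) by (intro integrableI_bounded) auto
    have iq': "integrable A (\<lambda>a. p' ?s a * q ?s a)"
    proof -
      \<comment> \<open>Integrability of \<open>q\<close> under \<open>p'\<close> is recovered from
        that of the quotient and of \<open>q\<close> under \<open>p\<close>; it is what the signed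
        Fubini theorem for the kernel requires.\<close>
      have eq: "(\<lambda>a. p' ?s a * q ?s a) = (\<lambda>a. \<epsilon> * (q ?s a * ((p' ?s a - p ?s a) / \<epsilon>)) + p ?s a * q ?s a)"
        using \<epsilon> by (auto simp: fun_eq_iff field_simps)
      show ?thesis
        unfolding eq by (intro Bochner_Integration.integrable_add integrable_mult_right iq elim(1))
    qed
    let ?Dp = "density A (\<lambda>a. ennreal (p ?s a))" and ?Dp' = "density A (\<lambda>a. ennreal (p' ?s a))"
    have km: "(\<lambda>a. k (?s, a)) \<in> measurable ?Dp (subprob_algebra A)"
      using measurable_compose[OF measurable_Pair1'[OF s] measurable_prob_algebraD[OF k]] by simp
    have ne: "space ?Dp \<noteq> {}" using elim measurable_space[OF U_meas] by auto
    have iD: "integrable (?Dp \<bind> (\<lambda>a. k (?s, a))) (q ?s)"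
      unfolding elim(3)[symmetric] using iq' nn by (subst integrable_density) auto
    note ib = integral_bind_integrable[OF km ne iD]
    have Km: "(\<lambda>a. \<integral>b. q ?s b \<partial>k (?s, a)) \<in> borel_measurable A"
      using borel_measurable_integrable[OF ib(1)] by simp
    have i1: "integrable A (\<lambda>a. p ?s a * (\<integral>b. q ?s b \<partial>k (?s, a)))"
      using ib(1) nn Km by (subst (asm) integrable_density) auto
    have e1: "(\<integral>a. p ?s a * (\<integral>b. q ?s b \<partial>k (?s, a)) \<partial>A) = (\<integral>a. p' ?s a * q ?s a \<partial>A)"
      using ib(2) nn Km unfolding elim(3)[symmetric] by (simp add: integral_density)
    have "(\<integral>a. p ?s a * (((\<integral>b. q ?s b \<partial>k (?s, a)) - q ?s a) / \<epsilon>) \<partial>A) =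
        (\<integral>a. (p ?s a * (\<integral>b. q ?s b \<partial>k (?s, a)) - p ?s a * q ?s a) / \<epsilon> \<partial>A)"
      by (simp add: algebra_simps)
    also have "\<dots> = ((\<integral>a. p' ?s a * q ?s a \<partial>A) - (\<integral>a. p ?s a * q ?s a \<partial>A)) / \<epsilon>"
      using i1 elim(1) e1 by simp
    also have "\<dots> = (\<integral>a. (p' ?s a * q ?s a - p ?s a * q ?s a) / \<epsilon> \<partial>A)"
      using iq' elim(1) by simp
    also have "\<dots> = (\<integral>a. q ?s a * ((p' ?s a - p ?s a) / \<epsilon>) \<partial>A)"
      by (simp add: algebra_simps)
    finally show ?case .
  qed
qed

end

context policy_stage
begin

text \<open>Needed at \<open>\<epsilon> = 0\<close>, where the Dirac kernels identify the policies
  only as measures. Uniqueness of densities over a sigma-finite measure gives equality almost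
  everywhere, and nonnegativity removes \<open>ennreal\<close>.\<close>

lemma AE_density_eq:
  assumes p' [measurable]: "(\<lambda>(s, a). p' s a) \<in> borel_measurable (H \<Otimes>\<^sub>M A)"
    and p'_dens: "AE s in distr P H S. (\<forall>a\<in>space A. 0 \<le> p' s a) \<and> (\<integral>\<^sup>+a. ennreal (p' s a) \<partial>A) = 1"
    and eq: "AE s in distr P H S. density A (\<lambda>a. ennreal (p' s a)) = density A (\<lambda>a. ennreal (p s a))"
  shows "AE s in distr P H S. AE a in A. p' s a = p s a"
    and "AE (s, a) in distr P H S \<Otimes>\<^sub>M A. p' s a = p s a"
proof -
  show 1: "AE s in distr P H S. AE a in A. p' s a = p s a"
    using p'_dens p_dens eq AE_space
  proof eventually_elim
    case (elim s)
    then have s: "s \<in> space H" by simp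
    have [measurable]: "(\<lambda>a. p s a) \<in> borel_measurable A" "(\<lambda>a. p' s a) \<in> borel_measurable A"
      using measurable_compose[OF measurable_Pair1'[OF s] p_meas] measurable_compose[OF measurable_Pair1'[OF s] p'] by simp_all
    have "AE a in A. ennreal (p' s a) = ennreal (p s a)"
      by (rule A.density_unique) (use elim(3) in auto)
    then show ?case
      using AE_space
    proof eventually_elim
      case (elim a)
      with \<open>(\<forall>a\<in>space A. 0 \<le> p' s a) \<and> _\<close> \<open>(\<forall>a\<in>space A. 0 \<le> p s a) \<and> _\<close>
      show ?case by (auto simp: ennreal_inj)
    qed
  qed
  have m: "(\<lambda>x. p' (fst x) (snd x)) \<in> borel_measurable (distr P H S \<Otimes>\<^sub>M A)"
    "(\<lambda>x. p (fst x) (snd x)) \<in> borel_measurable (distr P H S \<Otimes>\<^sub>M A)"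
    using p' p_meas by (simp_all add: measurable_SA_cong case_prod_beta')
  have "AE x in distr P H S \<Otimes>\<^sub>M A. p' (fst x) (snd x) = p (fst x) (snd x)"
  proof (rule SA.AE_pair_measure)
    show "{x \<in> space (distr P H S \<Otimes>\<^sub>M A). p' (fst x) (snd x) = p (fst x) (snd x)} \<in> sets (distr P H S \<Otimes>\<^sub>M A)"
      using m by measurable
  qed (use 1 in simp)
  then show "AE (s, a) in distr P H S \<Otimes>\<^sub>M A. p' s a = p s a" by (simp add: case_prod_beta')
qed

end

section \<open>The unweighted quotient under the observed law\<close>

context policy_path
begin

text \<open>
  The bound \<open>D\<close> only controls the integral over histories. The limit of the inner integral comes
  from \<open>C\<close>, the likelihood ratio being eventually at least \<open>1/2\<close> at almost every outcome. A
  sequence \<open>X\<close> is used because the exceptional null sets depend on \<open>\<epsilon>\<close>.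
\<close>

lemma stage_quotient_limit:
  assumes t: "t \<in> {1..horizon M}"
    and q: "(\<lambda>(s, a). q t s a) \<in> borel_measurable (sa_space M t)"
    and X: "filterlim X (at_right 0) sequentially" and ac: "\<And>n. abs_cont (\<pi>\<epsilon> (X n))"
    and D: "integrable (obs M) D"
    and D_dom: "\<And>n. AE \<omega> in obs M. (\<integral>\<^sup>+a. ennreal \<bar>q t (hist M t \<omega>) a *
             ((\<pi>\<epsilon> (X n) t (hist M t \<omega>) a - \<pi> t (hist M t \<omega>) a) / X n)\<bar> \<partial>act_space M t) \<le> ennreal (D \<omega>)"
    and C: "integrable (obs M \<Otimes>\<^sub>M act_space M t) C"
    and C_dom: "\<And>n. AE (\<omega>, a) in obs M \<Otimes>\<^sub>M act_space M t.
           \<bar>likelihood_ratio M \<pi> (\<pi>\<epsilon> (X n)) t \<omega> * (q t (hist M t \<omega>) a *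
              ((\<pi>\<epsilon> (X n) t (hist M t \<omega>) a - \<pi> t (hist M t \<omega>) a) / X n))\<bar> \<le> C (\<omega>, a)"
    and int: "integrable (obs M \<Otimes>\<^sub>M act_space M t) (\<lambda>(\<omega>, a). q t (hist M t \<omega>) a * Lf t (hist M t \<omega>) a)"
  shows "(\<lambda>n. \<integral>\<omega>. (\<integral>a. q t (hist M t \<omega>) a *
             ((\<pi>\<epsilon> (X n) t (hist M t \<omega>) a - \<pi> t (hist M t \<omega>) a) / X n) \<partial>act_space M t) \<partial>obs M)
    \<longlonglongrightarrow> (\<integral>(\<omega>, a). q t (hist M t \<omega>) a * Lf t (hist M t \<omega>) a \<partial>(obs M \<Otimes>\<^sub>M act_space M t))"
proof -
  interpret policy_stage "obs M" "act_space M t" "hist_space M t" "hist M t" "action M t" "\<pi> t"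
    by (rule stage[OF t])
  let ?A = "act_space M t"
  define h where "h n \<omega> a = q t (hist M t \<omega>) a * ((\<pi>\<epsilon> (X n) t (hist M t \<omega>) a - \<pi> t (hist M t \<omega>) a) / X n)" for n \<omega> a
  define f where "f \<omega> a = q t (hist M t \<omega>) a * Lf t (hist M t \<omega>) a" for \<omega> a
  have hm: "(\<lambda>(\<omega>, a). h n \<omega> a) \<in> borel_measurable (obs M \<Otimes>\<^sub>M ?A)" for n
    unfolding h_def by (rule measurable_pair_quotient(2)[OF t ac q])
  have fm: "(\<lambda>(\<omega>, a). f \<omega> a) \<in> borel_measurable (obs M \<Otimes>\<^sub>M ?A)"
    unfolding f_def by (rule measurable_pair_Lf(2)[OF t q])
  have "AE x in obs M \<Otimes>\<^sub>M ?A. \<forall>n. case x of (\<omega>, a) \<Rightarrow> \<bar>likelihood_ratio M \<pi> (\<pi>\<epsilon> (X n)) t \<omega> * h n \<omega> a\<bar> \<le> C (\<omega>, a)"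
    unfolding h_def by (intro AE_all_countable[THEN iffD2] allI C_dom)
  from PA.AE_pair[OF this]
  have C_all: "AE \<omega> in obs M. AE a in ?A. \<forall>n. \<bar>likelihood_ratio M \<pi> (\<pi>\<epsilon> (X n)) t \<omega> * h n \<omega> a\<bar> \<le> C (\<omega>, a)"
    by simp
  from PA.AE_pair[OF AE_pairD[OF path_lim[OF t, unfolded hist_law_def]]]
  have lim_all: "AE \<omega> in obs M. AE a in ?A. ((\<lambda>\<epsilon>. (\<pi>\<epsilon> \<epsilon> t (hist M t \<omega>) a - \<pi> t (hist M t \<omega>) a) / \<epsilon>) \<longlongrightarrow> Lf t (hist M t \<omega>) a) (at_right 0)"
    by simp
  have ratio: "AE \<omega> in obs M. ((\<lambda>\<epsilon>. likelihood_ratio M \<pi> (\<pi>\<epsilon> \<epsilon>) t \<omega>) \<longlongrightarrow> 1) (at_right 0)"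
    using t by (intro likelihood_ratio_tendsto) auto
  have lim: "AE \<omega> in obs M. (\<lambda>n. \<integral>a. h n \<omega> a \<partial>?A) \<longlonglongrightarrow> (\<integral>a. f \<omega> a \<partial>?A)"
    using C_all lim_all ratio PA.AE_integrable_fst'[OF C] AE_space
  proof eventually_elim
    case (elim \<omega>)
    have sec: "g \<omega> \<in> borel_measurable ?A" if "(\<lambda>(\<omega>, a). g \<omega> a) \<in> borel_measurable (obs M \<Otimes>\<^sub>M ?A)" for g :: "_ \<Rightarrow> _ \<Rightarrow> real"
      using measurable_compose[OF measurable_Pair1'[OF elim(5)] that] by simp
    from filterlim_compose[OF elim(3) X]
    have "\<forall>\<^sub>F n in sequentially. 1 / 2 < likelihood_ratio M \<pi> (\<pi>\<epsilon> (X n)) t \<omega>"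
      by (rule order_tendstoD(1)) simp
    then obtain N where N: "\<And>n. n \<ge> N \<Longrightarrow> 1 / 2 < likelihood_ratio M \<pi> (\<pi>\<epsilon> (X n)) t \<omega>"
      unfolding eventually_sequentially by blast
    \<comment> \<open>The outcome is fixed, so \<open>N\<close> may depend on it. Dividing by a
      ratio above 1/2 turns the bound on the weighted quotient into \<open>2 * C\<close>, integrable
      over actions for almost every outcome.\<close>
    have "(\<lambda>n. \<integral>a. h (n + N) \<omega> a \<partial>?A) \<longlonglongrightarrow> (\<integral>a. f \<omega> a \<partial>?A)"
    proof (rule integral_dominated_convergence)
      show "f \<omega> \<in> borel_measurable ?A" "\<And>n. h (n + N) \<omega> \<in> borel_measurable ?A"
        using sec[OF fm] sec[OF hm] by auto
      show "integrable ?A (\<lambda>a. 2 * C (\<omega>, a))" using elim(4) by simp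
      show "AE a in ?A. (\<lambda>n. h (n + N) \<omega> a) \<longlonglongrightarrow> f \<omega> a"
        using elim(2)
      proof eventually_elim
        case (elim a)
        from filterlim_compose[OF elim X] have "(\<lambda>n. h n \<omega> a) \<longlonglongrightarrow> f \<omega> a"
          unfolding h_def f_def by (intro tendsto_mult tendsto_const)
        then show ?case by (rule LIMSEQ_ignore_initial_segment)
      qed
      show "AE a in ?A. norm (h (n + N) \<omega> a) \<le> 2 * C (\<omega>, a)" for n
        using elim(1)
      proof eventually_elim
        case (elim a)
        let ?l = "likelihood_ratio M \<pi> (\<pi>\<epsilon> (X (n + N))) t \<omega>"
        have "1 / 2 * \<bar>h (n + N) \<omega> a\<bar> \<le> \<bar>?l\<bar> * \<bar>h (n + N) \<omega> a\<bar>"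
          using N[of "n + N"] by (intro mult_right_mono) auto
        also have "\<dots> \<le> C (\<omega>, a)" using elim by (simp add: abs_mult)
        finally show ?case by simp
      qed
    qed
    then show ?case using LIMSEQ_offset[of "\<lambda>n. \<integral>a. h n \<omega> a \<partial>?A" N] by simp
  qed
  have "(\<lambda>n. \<integral>\<omega>. (\<integral>a. h n \<omega> a \<partial>?A) \<partial>obs M) \<longlonglongrightarrow> (\<integral>\<omega>. (\<integral>a. f \<omega> a \<partial>?A) \<partial>obs M)"
  proof (rule integral_dominated_convergence)
    show "(\<lambda>\<omega>. \<integral>a. f \<omega> a \<partial>?A) \<in> borel_measurable (obs M)"
      by (rule A.borel_measurable_lebesgue_integral[OF fm])
    show "(\<lambda>\<omega>. \<integral>a. h n \<omega> a \<partial>?A) \<in> borel_measurable (obs M)" for n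
      by (rule A.borel_measurable_lebesgue_integral[OF hm])
    show "integrable (obs M) (\<lambda>\<omega>. \<bar>D \<omega>\<bar>)" using D by simp
    show "AE \<omega> in obs M. (\<lambda>n. \<integral>a. h n \<omega> a \<partial>?A) \<longlonglongrightarrow> (\<integral>a. f \<omega> a \<partial>?A)" by (rule lim)
    show "AE \<omega> in obs M. norm (\<integral>a. h n \<omega> a \<partial>?A) \<le> \<bar>D \<omega>\<bar>" for n
      using D_dom[of n] AE_space
    proof eventually_elim
      case (elim \<omega>)
      have m: "h n \<omega> \<in> borel_measurable ?A"
        using measurable_compose[OF measurable_Pair1'[OF elim(2)] hm[of n]] by simp
      have le: "(\<integral>\<^sup>+a. ennreal (norm (h n \<omega> a)) \<partial>?A) \<le> ennreal (D \<omega>)" using elim(1) by (simp add: h_def)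
      then have "integrable ?A (h n \<omega>)"
        using m by (intro integrableI_bounded) (auto intro: le_less_trans)
      from integral_norm_bound_ennreal[OF this]
      have "ennreal (norm (\<integral>a. h n \<omega> a \<partial>?A)) \<le> ennreal \<bar>D \<omega>\<bar>"
        using le by (meson abs_ge_self ennreal_leI order_trans)
      then show ?case by (subst (asm) ennreal_le_iff) auto
    qed
  qed
  also have "(\<integral>\<omega>. (\<integral>a. f \<omega> a \<partial>?A) \<partial>obs M) = (\<integral>(\<omega>, a). f \<omega> a \<partial>(obs M \<Otimes>\<^sub>M ?A))"
    using PA.integral_fst'[of "\<lambda>(\<omega>, a). f \<omega> a"] int by (simp add: f_def)
  finally show ?thesis unfolding h_def f_def .
qed

end

text \<open>The integrand depends on the starting point as well, so the kernel is pushed to pairs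
  and the integrand becomes one fixed function on the product.\<close>

lemma integral_measurable_kernel:
  fixes f :: "'a \<Rightarrow> 'b \<Rightarrow> real"
  assumes f [measurable]: "(\<lambda>(x, y). f x y) \<in> borel_measurable (M \<Otimes>\<^sub>M N)"
    and L [measurable]: "L \<in> measurable M (subprob_algebra N)"
  shows "(\<lambda>x. \<integral>y. f x y \<partial>L x) \<in> borel_measurable M"
proof -
  note measurable_distr2[measurable]
  have "(\<lambda>x. integral\<^sup>L (distr (L x) (M \<Otimes>\<^sub>M N) (\<lambda>y. (x, y))) (\<lambda>(x, y). f x y)) \<in> borel_measurable M"
    by measurable
  then show ?thesis
    by (rule measurable_cong[THEN iffD1, rotated]) (simp add: integral_distr)
qed

context status_quo_model
begin

text \<open>Absolute continuity along the path is known for small positive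
  \<open>\<epsilon>\<close>, so the value at 0 is treated by itself. The policy at 0 is merely a
  version of \<open>\<pi>\<close>, but at observed actions the likelihood ratio is still 1 almost
  surely.\<close>

lemma baseline_value:
  assumes pol: "is_policy M \<pi>'" and K: "is_transition_law M K"
    and eq: "\<And>t. t \<in> {1..horizon M} \<Longrightarrow> AE s in hist_law M t.
      density (act_space M t) (\<lambda>a. ennreal (\<pi>' t s a)) = density (act_space M t) (\<lambda>a. ennreal (\<pi> t s a))"
  shows "(\<integral>z. discounted_sum M \<gamma> z \<partial>cf_law M K \<pi>') = (\<integral>\<omega>. ret M \<gamma> 1 \<omega> \<partial>obs M)"
proof -
  have AE_eq: "AE s in hist_law M t. AE a in act_space M t. \<pi>' t s a = \<pi> t s a"
    "AE \<omega> in obs M. \<pi>' t (hist M t \<omega>) (action M t \<omega>) / \<pi> t (hist M t \<omega>) (action M t \<omega>) = 1"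
    if t: "t \<in> {1..horizon M}" for t
  proof -
    interpret policy_stage "obs M" "act_space M t" "hist_space M t" "hist M t" "action M t" "\<pi> t"
      by (rule stage[OF t])
    have m: "(\<lambda>(s, a). \<pi>' t s a) \<in> borel_measurable (hist_space M t \<Otimes>\<^sub>M act_space M t)"
      using pol t by (simp add: is_policy_def sa_space_def)
    have d: "AE s in distr (obs M) (hist_space M t) (hist M t).
        (\<forall>a\<in>space (act_space M t). 0 \<le> \<pi>' t s a) \<and> (\<integral>\<^sup>+a. ennreal (\<pi>' t s a) \<partial>act_space M t) = 1"
      using pol t unfolding is_policy_def hist_law_def by blast
    note e = AE_density_eq[OF m d eq[OF t, unfolded hist_law_def]]
    show "AE s in hist_law M t. AE a in act_space M t. \<pi>' t s a = \<pi> t s a"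
      unfolding hist_law_def by (rule e(1))
    show "AE \<omega> in obs M. \<pi>' t (hist M t \<omega>) (action M t \<omega>) / \<pi> t (hist M t \<omega>) (action M t \<omega>) = 1"
      using AE_actD[OF e(2)] p_pos by eventually_elim auto
  qed
  have ac: "abs_cont \<pi>'"
    unfolding abs_cont_def
  proof (intro conjI ballI pol)
    fix t assume "t \<in> {1..horizon M}"
    from AE_eq(1)[OF this]
    show "AE s in hist_law M t. AE a in act_space M t. \<pi> t s a = 0 \<longrightarrow> \<pi>' t s a = 0"
    proof eventually_elim
      case (elim s)
      then show ?case by eventually_elim simp
    qed
  qed
  have "AE \<omega> in obs M. \<forall>t\<in>{1..horizon M}. \<pi>' t (hist M t \<omega>) (action M t \<omega>) / \<pi> t (hist M t \<omega>) (action M t \<omega>) = 1"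
    by (intro AE_finite_allI AE_eq(2)) auto
  then have L: "AE \<omega> in obs M. likelihood_ratio M \<pi> \<pi>' (Suc (horizon M)) \<omega> = 1"
    unfolding likelihood_ratio_def atLeastLessThanSuc_atLeastAtMost by eventually_elim (rule prod.neutral)
  have [measurable]: "likelihood_ratio M \<pi> \<pi>' (Suc (horizon M)) \<in> borel_measurable (obs M)"
    by (rule measurable_likelihood_ratio(1)[OF pol]) auto
  have [measurable]: "ret M \<gamma> 1 \<in> borel_measurable (obs M)"
    unfolding ret_def[abs_def] using model
    by (intro borel_measurable_sum borel_measurable_times borel_measurable_const) (auto simp: is_trajectory_model_def)
  show ?thesis
    unfolding integral_cf_law[OF ac K]
    by (rule integral_cong_AE) (use L in \<open>measurable, auto\<close>)
qed

end

section \<open>The backward representation and the derivative\<close>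

context policy_path
begin

text \<open>Two limits of one sequence of numbers. As an expectation at the observed action the
  quotient converges under the bound \<open>D'\<close>; rewritten by \<open>kernel_quotient\<close>
  it converges by \<open>stage_quotient_limit\<close>. Uniqueness of limits identifies the
  results.\<close>

lemma
  fixes Lq :: "('b, 'c) history \<Rightarrow> 'c \<Rightarrow> real"
  assumes t: "t \<in> {1..horizon M}" and q: "is_action_value M \<gamma> q" and ret: "integrable (obs M) (ret M \<gamma> t)"
    and dom: "path_dominated M \<pi> \<pi>\<epsilon> q t"
    and D: "integrable (obs M) D"
    and D_dom: "\<forall>\<^sub>F \<epsilon> in at_right 0. AE \<omega> in obs M. (\<integral>\<^sup>+a. ennreal \<bar>q t (hist M t \<omega>) a *
             ((\<pi>\<epsilon> \<epsilon> t (hist M t \<omega>) a - \<pi> t (hist M t \<omega>) a) / \<epsilon>)\<bar> \<partial>act_space M t) \<le> ennreal (D \<omega>)"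
    and D'_meas: "(\<lambda>(s, a). D' s a) \<in> borel_measurable (sa_space M t)"
    and D'_dom: "\<forall>\<^sub>F \<epsilon> in at_right 0. AE (s, a\<^sub>0) in sa_law M t.
        \<bar>((\<integral>a. q t s a \<partial>k \<epsilon> (s, a\<^sub>0)) - q t s a\<^sub>0) / \<epsilon>\<bar> \<le> D' s a\<^sub>0"
    and D'_int: "(\<integral>\<^sup>+\<omega>. (\<integral>\<^sup>+a\<^sub>0. ennreal (D' (hist M t \<omega>) a\<^sub>0) * ennreal (\<pi> t (hist M t \<omega>) a\<^sub>0) \<partial>act_space M t) \<partial>obs M) < \<infinity>"
    and k: "\<forall>\<^sub>F \<epsilon> in at_right 0. k \<epsilon> \<in> measurable (sa_space M t) (prob_algebra (act_space M t))"
    and conv: "\<forall>\<^sub>F \<epsilon> in at_right 0. AE s in hist_law M t. density (act_space M t) (\<lambda>a. ennreal (\<pi>\<epsilon> \<epsilon> t s a)) =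
           density (act_space M t) (\<lambda>a. ennreal (\<pi> t s a)) \<bind> (\<lambda>a\<^sub>0. k \<epsilon> (s, a\<^sub>0))"
    and Lq_meas: "(\<lambda>(s, a). Lq s a) \<in> borel_measurable (sa_space M t)"
    and Lq_lim: "AE (s, a\<^sub>0) in sa_law M t.
        ((\<lambda>\<epsilon>. ((\<integral>a. q t s a \<partial>k \<epsilon> (s, a\<^sub>0)) - q t s a\<^sub>0) / \<epsilon>) \<longlongrightarrow> Lq s a\<^sub>0) (at_right 0)"
  shows integrable_backward: "integrable (obs M) (\<lambda>\<omega>. Lq (hist M t \<omega>) (action M t \<omega>))"
    and backward_eq_forward: "(\<integral>\<omega>. Lq (hist M t \<omega>) (action M t \<omega>) \<partial>obs M) =
      (\<integral>(\<omega>, a). q t (hist M t \<omega>) a * Lf t (hist M t \<omega>) a \<partial>(obs M \<Otimes>\<^sub>M act_space M t))"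
proof -
  interpret policy_stage "obs M" "act_space M t" "hist_space M t" "hist M t" "action M t" "\<pi> t"
    by (rule stage[OF t])
  let ?H = "hist_space M t" and ?A = "act_space M t"
  have qm: "(\<lambda>(s, a). q t s a) \<in> borel_measurable (sa_space M t)"
    using q t by (simp add: is_action_value_def)
  note iq = integrable_action_value[OF q t ret]
  obtain C where C: "integrable (obs M \<Otimes>\<^sub>M ?A) C"
    and C_dom: "\<forall>\<^sub>F \<epsilon> in at_right 0. AE (\<omega>, a) in obs M \<Otimes>\<^sub>M ?A. \<bar>likelihood_ratio M \<pi> (\<pi>\<epsilon> \<epsilon>) t \<omega> *
            (q t (hist M t \<omega>) a * ((\<pi>\<epsilon> \<epsilon> t (hist M t \<omega>) a - \<pi> t (hist M t \<omega>) a) / \<epsilon>))\<bar> \<le> C (\<omega>, a)"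
    using dom unfolding path_dominated_def by blast
  \<comment> \<open>All conditions that hold for small \<open>\<epsilon>\<close> are secured along
    one common sequence.\<close>
  obtain X :: "nat \<Rightarrow> real" where X: "filterlim X (at_right 0) sequentially"
    and XP: "\<And>n. 0 < X n \<and> abs_cont (\<pi>\<epsilon> (X n)) \<and>
      (AE \<omega> in obs M. (\<integral>\<^sup>+a. ennreal \<bar>q t (hist M t \<omega>) a *
             ((\<pi>\<epsilon> (X n) t (hist M t \<omega>) a - \<pi> t (hist M t \<omega>) a) / X n)\<bar> \<partial>?A) \<le> ennreal (D \<omega>)) \<and>
      (AE (\<omega>, a) in obs M \<Otimes>\<^sub>M ?A. \<bar>likelihood_ratio M \<pi> (\<pi>\<epsilon> (X n)) t \<omega> *
            (q t (hist M t \<omega>) a * ((\<pi>\<epsilon> (X n) t (hist M t \<omega>) a - \<pi> t (hist M t \<omega>) a) / X n))\<bar> \<le> C (\<omega>, a)) \<and>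
      (AE (s, a\<^sub>0) in sa_law M t. \<bar>((\<integral>a. q t s a \<partial>k (X n) (s, a\<^sub>0)) - q t s a\<^sub>0) / X n\<bar> \<le> D' s a\<^sub>0) \<and>
      k (X n) \<in> measurable (sa_space M t) (prob_algebra ?A) \<and>
      (AE s in hist_law M t. density ?A (\<lambda>a. ennreal (\<pi>\<epsilon> (X n) t s a)) =
           density ?A (\<lambda>a. ennreal (\<pi> t s a)) \<bind> (\<lambda>a\<^sub>0. k (X n) (s, a\<^sub>0)))"
    using eventually_at_right_sequence[OF eventually_conj[OF eventually_at_right_less[of "0::real"]
      eventually_conj[OF path_ac eventually_conj[OF D_dom eventually_conj[OF C_dom
      eventually_conj[OF D'_dom eventually_conj[OF k conv]]]]]]] by blast
  have X_ac: "abs_cont (\<pi>\<epsilon> (X n))" for n using XP[of n] by blast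
  have X_D: "AE \<omega> in obs M. (\<integral>\<^sup>+a. ennreal \<bar>q t (hist M t \<omega>) a *
             ((\<pi>\<epsilon> (X n) t (hist M t \<omega>) a - \<pi> t (hist M t \<omega>) a) / X n)\<bar> \<partial>?A) \<le> ennreal (D \<omega>)" for n
    using XP[of n] by blast
  have X_C: "AE (\<omega>, a) in obs M \<Otimes>\<^sub>M ?A. \<bar>likelihood_ratio M \<pi> (\<pi>\<epsilon> (X n)) t \<omega> *
            (q t (hist M t \<omega>) a * ((\<pi>\<epsilon> (X n) t (hist M t \<omega>) a - \<pi> t (hist M t \<omega>) a) / X n))\<bar> \<le> C (\<omega>, a)" for n
    using XP[of n] by blast
  have X_k: "k (X n) \<in> measurable (?H \<Otimes>\<^sub>M ?A) (prob_algebra ?A)" for n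
    using XP[of n] unfolding sa_space_def by blast
  define g where "g n s a\<^sub>0 = ((\<integral>a. q t s a \<partial>k (X n) (s, a\<^sub>0)) - q t s a\<^sub>0) / X n" for n s a\<^sub>0
  have X_D': "AE \<omega> in obs M. \<bar>g n (hist M t \<omega>) (action M t \<omega>)\<bar> \<le> D' (hist M t \<omega>) (action M t \<omega>)" for n
  proof (rule AE_lawD)
    show "AE (s, a) in distr (obs M) (?H \<Otimes>\<^sub>M ?A) (\<lambda>\<omega>. (hist M t \<omega>, action M t \<omega>)). \<bar>g n s a\<bar> \<le> D' s a"
      using XP[of n] unfolding sa_law_def sa_space_def g_def by blast
  qed
  have qm': "(\<lambda>(s, a). q t s a) \<in> borel_measurable (?H \<Otimes>\<^sub>M ?A)" using qm by (simp add: sa_space_def)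
  have gm: "(\<lambda>(s, a). g n s a) \<in> borel_measurable (?H \<Otimes>\<^sub>M ?A)" for n
  proof -
    have "(\<lambda>(x, b). q t (fst x) b) \<in> borel_measurable ((?H \<Otimes>\<^sub>M ?A) \<Otimes>\<^sub>M ?A)"
      using measurable_compose[of "\<lambda>(x, b). (fst x, b)" "(?H \<Otimes>\<^sub>M ?A) \<Otimes>\<^sub>M ?A" "?H \<Otimes>\<^sub>M ?A", OF _ qm']
      by (simp add: case_prod_beta')
    from integral_measurable_kernel[OF this measurable_prob_algebraD[OF X_k]]
    have "(\<lambda>x. \<integral>a. q t (fst x) a \<partial>k (X n) x) \<in> borel_measurable (?H \<Otimes>\<^sub>M ?A)" by simp
    then show ?thesis using qm' by (simp add: g_def case_prod_beta')
  qed
  have gm': "(\<lambda>(s, a). \<pi> t s a * g n s a) \<in> borel_measurable (?H \<Otimes>\<^sub>M ?A)" for n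
    using gm[of n] p_meas by (simp add: case_prod_beta')
  have Lqm: "(\<lambda>\<omega>. Lq (hist M t \<omega>) (action M t \<omega>)) \<in> borel_measurable (obs M)"
    using Lq_meas unfolding sa_space_def by (rule measurable_SU(1))
  have D'm: "(\<lambda>\<omega>. D' (hist M t \<omega>) (action M t \<omega>)) \<in> borel_measurable (obs M)"
    using D'_meas unfolding sa_space_def by (rule measurable_SU(1))
  \<comment> \<open>\<open>D'\<close> dominates an absolute value, so it is nonnegative at the
    observed pair almost surely and its \<open>ennreal\<close> integral controls its norm.\<close>
  have iD': "integrable (obs M) (\<lambda>\<omega>. D' (hist M t \<omega>) (action M t \<omega>))"
  proof (rule integrableI_bounded[OF D'm])
    have "(\<integral>\<^sup>+\<omega>. ennreal (norm (D' (hist M t \<omega>) (action M t \<omega>))) \<partial>obs M) =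
        (\<integral>\<^sup>+\<omega>. ennreal (D' (hist M t \<omega>) (action M t \<omega>)) \<partial>obs M)"
      by (rule nn_integral_cong_AE) (use X_D'[of 0] in \<open>eventually_elim, auto\<close>)
    also have "\<dots> = (\<integral>\<^sup>+\<omega>. (\<integral>\<^sup>+a. ennreal (\<pi> t (hist M t \<omega>) a) * ennreal (D' (hist M t \<omega>) a) \<partial>?A) \<partial>obs M)"
    proof (rule nn_integral_law)
      show "(\<lambda>(s, a). ennreal (D' s a)) \<in> borel_measurable (?H \<Otimes>\<^sub>M ?A)"
        using measurable_compose[OF D'_meas measurable_ennreal] by (simp add: sa_space_def case_prod_beta')
    qed
    also have "\<dots> < \<infinity>" using D'_int by (simp add: mult.commute)
    finally show "(\<integral>\<^sup>+\<omega>. ennreal (norm (D' (hist M t \<omega>) (action M t \<omega>))) \<partial>obs M) < \<infinity>" .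
  qed
  have lim: "AE \<omega> in obs M. (\<lambda>n. g n (hist M t \<omega>) (action M t \<omega>)) \<longlonglongrightarrow> Lq (hist M t \<omega>) (action M t \<omega>)"
    using AE_lawD[OF Lq_lim[unfolded sa_law_def sa_space_def]]
  proof eventually_elim
    case (elim \<omega>)
    from filterlim_compose[OF elim X] show ?case by (simp add: g_def)
  qed
  have bd: "AE \<omega> in obs M. norm (g n (hist M t \<omega>) (action M t \<omega>)) \<le> D' (hist M t \<omega>) (action M t \<omega>)" for n
    using X_D'[of n] by simp
  show "integrable (obs M) (\<lambda>\<omega>. Lq (hist M t \<omega>) (action M t \<omega>))"
    by (rule integrable_dominated_convergence[OF Lqm measurable_SU(1)[OF gm] iD' lim bd])
  have backward_lim: "(\<lambda>n. \<integral>\<omega>. g n (hist M t \<omega>) (action M t \<omega>) \<partial>obs M) \<longlonglongrightarrow> (\<integral>\<omega>. Lq (hist M t \<omega>) (action M t \<omega>) \<partial>obs M)"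
    by (rule integral_dominated_convergence[OF Lqm measurable_SU(1)[OF gm] iD' lim bd])
  \<comment> \<open>Both expectations are unfolded into an integral over actions inside one over
    outcomes, since the identity between the two quotients is available only in the inner
    integral.\<close>
  have eq: "(\<integral>\<omega>. g n (hist M t \<omega>) (action M t \<omega>) \<partial>obs M) =
      (\<integral>\<omega>. (\<integral>a. q t (hist M t \<omega>) a * ((\<pi>\<epsilon> (X n) t (hist M t \<omega>) a - \<pi> t (hist M t \<omega>) a) / X n) \<partial>?A) \<partial>obs M)" for n
  proof -
    interpret policy_change "obs M" ?A ?H "hist M t" "action M t" "\<pi> t" "\<pi>\<epsilon> (X n) t"
      by (rule stage_change[OF X_ac t])
    have ig: "integrable (obs M) (\<lambda>\<omega>. g n (hist M t \<omega>) (action M t \<omega>))"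
      by (rule Bochner_Integration.integrable_bound[OF iD' measurable_SU(1)[OF gm]])
         (use bd[of n] in \<open>eventually_elim, auto\<close>)
    have ig': "integrable (obs M \<Otimes>\<^sub>M ?A) (\<lambda>(\<omega>, a). \<pi> t (hist M t \<omega>) a * g n (hist M t \<omega>) a)"
      using ig integrable_law_iff[OF gm] by blast
    have "(\<integral>\<omega>. g n (hist M t \<omega>) (action M t \<omega>) \<partial>obs M) = (\<integral>\<omega>. (\<integral>a. \<pi> t (hist M t \<omega>) a * g n (hist M t \<omega>) a \<partial>?A) \<partial>obs M)"
      unfolding integral_law[OF gm] using PA.integral_fst'[OF ig'] by simp
    also have "\<dots> = (\<integral>\<omega>. (\<integral>a. q t (hist M t \<omega>) a * ((\<pi>\<epsilon> (X n) t (hist M t \<omega>) a - \<pi> t (hist M t \<omega>) a) / X n) \<partial>?A) \<partial>obs M)"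
    proof (rule integral_cong_AE)
      show "AE \<omega> in obs M. (\<integral>a. \<pi> t (hist M t \<omega>) a * g n (hist M t \<omega>) a \<partial>?A) =
          (\<integral>a. q t (hist M t \<omega>) a * ((\<pi>\<epsilon> (X n) t (hist M t \<omega>) a - \<pi> t (hist M t \<omega>) a) / X n) \<partial>?A)"
        unfolding g_def
      proof (rule kernel_quotient[OF qm' iq X_k])
        show "AE s in distr (obs M) ?H (hist M t). density ?A (\<lambda>a. ennreal (\<pi>\<epsilon> (X n) t s a)) =
            density ?A (\<lambda>a. ennreal (\<pi> t s a)) \<bind> (\<lambda>a. k (X n) (s, a))"
          using XP[of n] unfolding hist_law_def by blast
        show "AE \<omega> in obs M. (\<integral>\<^sup>+a. ennreal \<bar>q t (hist M t \<omega>) a *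
             ((\<pi>\<epsilon> (X n) t (hist M t \<omega>) a - \<pi> t (hist M t \<omega>) a) / X n)\<bar> \<partial>?A) < \<infinity>"
          using X_D[of n]
        proof eventually_elim
          case (elim \<omega>)
          then show ?case by (rule le_less_trans) simp
        qed
        show "X n \<noteq> 0" using XP[of n] by auto
      qed
      show "(\<lambda>\<omega>. \<integral>a. \<pi> t (hist M t \<omega>) a * g n (hist M t \<omega>) a \<partial>?A) \<in> borel_measurable (obs M)"
        by (rule A.borel_measurable_lebesgue_integral[OF measurable_SU(2)[OF gm']])
      show "(\<lambda>\<omega>. \<integral>a. q t (hist M t \<omega>) a * ((\<pi>\<epsilon> (X n) t (hist M t \<omega>) a - \<pi> t (hist M t \<omega>) a) / X n) \<partial>?A) \<in> borel_measurable (obs M)"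
        by (rule A.borel_measurable_lebesgue_integral[OF measurable_pair_quotient(2)[OF t X_ac qm]])
    qed
    finally show ?thesis .
  qed
  have "(\<lambda>n. \<integral>\<omega>. g n (hist M t \<omega>) (action M t \<omega>) \<partial>obs M) \<longlonglongrightarrow>
      (\<integral>(\<omega>, a). q t (hist M t \<omega>) a * Lf t (hist M t \<omega>) a \<partial>(obs M \<Otimes>\<^sub>M ?A))"
    unfolding eq by (rule stage_quotient_limit[where q = q and X = X and C = C and D = D, OF t qm X X_ac D X_D C X_C integrable_forward[OF t qm dom]])
  from LIMSEQ_unique[OF backward_lim this]
  show "(\<integral>\<omega>. Lq (hist M t \<omega>) (action M t \<omega>) \<partial>obs M) =
      (\<integral>(\<omega>, a). q t (hist M t \<omega>) a * Lf t (hist M t \<omega>) a \<partial>(obs M \<Otimes>\<^sub>M ?A))" .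
qed

text \<open>For small positive \<open>\<epsilon>\<close> the difference quotient of the value is
  exactly the finite sum of weighted stage quotients, with no remainder, so the derivative is the
  sum of the stage limits.\<close>

lemma value_derivative:
  assumes K: "is_transition_law M K" and q: "is_action_value M \<gamma> q"
    and ret: "\<And>t. t \<in> {1..horizon M} \<Longrightarrow> integrable (obs M) (ret M \<gamma> t)"
    and cf: "\<forall>\<^sub>F \<epsilon> in at_right 0. integrable (cf_law M K (\<pi>\<epsilon> \<epsilon>)) (discounted_sum M \<gamma>)"
    and dom: "\<And>t. t \<in> {1..horizon M} \<Longrightarrow> path_dominated M \<pi> \<pi>\<epsilon> q t"
    and base: "(\<integral>z. discounted_sum M \<gamma> z \<partial>cf_law M K (\<pi>\<epsilon> 0)) = (\<integral>\<omega>. ret M \<gamma> 1 \<omega> \<partial>obs M)"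
  shows "((\<lambda>\<epsilon>. \<integral>z. discounted_sum M \<gamma> z \<partial>cf_law M K (\<pi>\<epsilon> \<epsilon>)) has_real_derivative
      (\<Sum>t\<in>{1..horizon M}. \<gamma> ^ (t - 1) *
        (\<integral>(\<omega>, a). q t (hist M t \<omega>) a * Lf t (hist M t \<omega>) a \<partial>(obs M \<Otimes>\<^sub>M act_space M t))))
    (at 0 within {0..<eps})"
proof -
  let ?J = "\<lambda>\<epsilon>. \<integral>z. discounted_sum M \<gamma> z \<partial>cf_law M K (\<pi>\<epsilon> \<epsilon>)"
  let ?s = "\<lambda>\<epsilon> t (\<omega>, a). likelihood_ratio M \<pi> (\<pi>\<epsilon> \<epsilon>) t \<omega> *
          (q t (hist M t \<omega>) a * ((\<pi>\<epsilon> \<epsilon> t (hist M t \<omega>) a - \<pi> t (hist M t \<omega>) a) / \<epsilon>))"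
  let ?d = "\<lambda>\<epsilon> t (\<omega>, a). likelihood_ratio M \<pi> (\<pi>\<epsilon> \<epsilon>) t \<omega> *
          (q t (hist M t \<omega>) a * (\<pi>\<epsilon> \<epsilon> t (hist M t \<omega>) a - \<pi> t (hist M t \<omega>) a))"
  let ?N = "\<lambda>t. obs M \<Otimes>\<^sub>M act_space M t"
  have qm: "(\<lambda>(s, a). q t s a) \<in> borel_measurable (sa_space M t)" if "t \<in> {1..horizon M}" for t
    using q that by (simp add: is_action_value_def)
  have "((\<lambda>\<epsilon>. \<Sum>t\<in>{1..horizon M}. \<gamma> ^ (t - 1) * (\<integral>x. ?s \<epsilon> t x \<partial>?N t)) \<longlongrightarrow>
      (\<Sum>t\<in>{1..horizon M}. \<gamma> ^ (t - 1) *
        (\<integral>(\<omega>, a). q t (hist M t \<omega>) a * Lf t (hist M t \<omega>) a \<partial>?N t))) (at_right 0)"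
    by (intro tendsto_sum tendsto_mult tendsto_const forward_tendsto qm dom)
  moreover have "\<forall>\<^sub>F \<epsilon> in at_right 0. (\<Sum>t\<in>{1..horizon M}. \<gamma> ^ (t - 1) * (\<integral>x. ?s \<epsilon> t x \<partial>?N t)) = (?J \<epsilon> - ?J 0) / (\<epsilon> - 0)"
  proof -
    have "\<forall>\<^sub>F \<epsilon> in at_right 0. \<forall>t\<in>{1..horizon M}. integrable (?N t) (?s \<epsilon> t)"
      by (intro eventually_ball_finite ballI eventually_integrable_quotient qm dom) auto
    then show ?thesis
      using path_ac cf eventually_at_right_less[of "0::real"]
    proof eventually_elim
      case (elim \<epsilon>)
      have ds: "?d \<epsilon> t = (\<lambda>x. \<epsilon> * ?s \<epsilon> t x)" for t
        using elim(4) by (auto simp: fun_eq_iff)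
      have id: "integrable (?N t) (?d \<epsilon> t)" if "t \<in> {1..horizon M}" for t
        unfolding ds using elim(1) that by (intro integrable_mult_right) blast
      have "?J \<epsilon> = (\<integral>\<omega>. ret M \<gamma> 1 \<omega> \<partial>obs M) + (\<Sum>t\<in>{1..horizon M}. \<gamma> ^ (t - 1) * (\<integral>x. ?d \<epsilon> t x \<partial>?N t))"
        by (rule performance_difference[OF elim(2) K q ret elim(3) id])
      also have "\<dots> = ?J 0 + \<epsilon> * (\<Sum>t\<in>{1..horizon M}. \<gamma> ^ (t - 1) * (\<integral>x. ?s \<epsilon> t x \<partial>?N t))"
        unfolding ds base integral_mult_right_zero sum_distrib_left by (simp only: mult.left_commute)
      finally show ?case using elim(4) by simp
    qed
  qed
  ultimately have "((\<lambda>\<epsilon>. (?J \<epsilon> - ?J 0) / (\<epsilon> - 0)) \<longlongrightarrow>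
      (\<Sum>t\<in>{1..horizon M}. \<gamma> ^ (t - 1) *
        (\<integral>(\<omega>, a). q t (hist M t \<omega>) a * Lf t (hist M t \<omega>) a \<partial>?N t))) (at_right 0)"
    by (rule Lim_transform_eventually)
  \<comment> \<open>Points of the interval other than 0 are positive, so the limit from the right is
    the derivative within the interval.\<close>
  moreover have "at 0 within {0..<eps} \<le> at_right 0"
    unfolding at_within_def by (intro inf_mono order_refl) auto
  ultimately show ?thesis
    unfolding has_field_derivative_iff by (rule tendsto_mono[rotated])
qed

end

section \<open>The marginal policy effect and its four expressions\<close>

theorem theorem1:
  fixes M :: "('w, 'x, 'a) trajectory_model"
    and \<gamma> eps :: real
    and K :: "nat \<Rightarrow> ('x, 'a) history \<times> 'a \<Rightarrow> ('x \<times> real) measure"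
    and PX :: "nat \<Rightarrow> (nat \<Rightarrow> 'a) \<Rightarrow> 'w \<Rightarrow> 'x"
    and PY :: "nat \<Rightarrow> (nat \<Rightarrow> 'a) \<Rightarrow> 'w \<Rightarrow> real"
    and \<pi> :: "('x, 'a) policy"
    and \<pi>\<epsilon> :: "real \<Rightarrow> ('x, 'a) policy"
    and Mk :: "nat \<Rightarrow> real \<Rightarrow> ('x, 'a) history \<times> 'a \<Rightarrow> 'a measure"
    and Lf :: "nat \<Rightarrow> ('x, 'a) history \<Rightarrow> 'a \<Rightarrow> real"
    and Lb :: "nat \<Rightarrow> (('x, 'a) history \<Rightarrow> 'a \<Rightarrow> real) \<Rightarrow> ('x, 'a) history \<Rightarrow> 'a \<Rightarrow> real"
    and Q :: "nat \<Rightarrow> (('x, 'a) history \<Rightarrow> 'a \<Rightarrow> real) set"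
    and q :: "nat \<Rightarrow> ('x, 'a) history \<Rightarrow> 'a \<Rightarrow> real"
    and D :: "nat \<Rightarrow> 'w \<Rightarrow> real"
    and D' :: "nat \<Rightarrow> ('x, 'a) history \<Rightarrow> 'a \<Rightarrow> real"
  assumes model: "is_trajectory_model M"
    and discount: "0 < \<gamma>" "\<gamma> \<le> 1"
    and baseline: "is_policy M \<pi>" "is_status_quo M \<pi>"
    and transition: "is_transition_law M K"
    and pot: "potential_outcomes M PX PY"
    and consist: "consistency M PX PY"
    and unconf: "sequential_unconfoundedness M PX PY"
    and value_fun: "is_action_value M \<gamma> q"
    and path: "convolutional_path M eps \<pi> \<pi>\<epsilon> Mk Lf Lb Q"
    and q_in_Q: "\<And>t. t \<in> {1..horizon M} \<Longrightarrow> q t \<in> Q t"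
    and moment_ret: "\<And>t. t \<in> {1..horizon M} \<Longrightarrow> integrable (obs M) (ret M \<gamma> t)"
    and moment_score: "\<And>t. t \<in> {1..horizon M} \<Longrightarrow>
      integrable (obs M) (\<lambda>\<omega>. score \<pi> Lf t (hist M t \<omega>) (action M t \<omega>) * ret M \<gamma> t \<omega>)"
    and moment_forward: "\<And>t. t \<in> {1..horizon M} \<Longrightarrow>
      (\<integral>\<^sup>+\<omega>. (\<integral>\<^sup>+a. ennreal \<bar>q t (hist M t \<omega>) a * Lf t (hist M t \<omega>) a\<bar> \<partial>act_space M t) \<partial>obs M) < \<infinity>"
    and moment_backward: "\<And>t. t \<in> {1..horizon M} \<Longrightarrow>
      (\<integral>\<^sup>+\<omega>. (\<integral>\<^sup>+a. ennreal \<bar>Lb t (q t) (hist M t \<omega>) a\<bar> * ennreal (\<pi> t (hist M t \<omega>) a)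
         \<partial>act_space M t) \<partial>obs M) < \<infinity>"
    and dom_forward_int: "\<And>t. t \<in> {1..horizon M} \<Longrightarrow> integrable (obs M) (D t)"
    and dom_forward: "\<And>t. t \<in> {1..horizon M} \<Longrightarrow>
      \<forall>\<^sub>F \<epsilon> in at_right 0. AE \<omega> in obs M.
        (\<integral>\<^sup>+a. ennreal \<bar>q t (hist M t \<omega>) a *
             ((\<pi>\<epsilon> \<epsilon> t (hist M t \<omega>) a - \<pi> t (hist M t \<omega>) a) / \<epsilon>)\<bar> \<partial>act_space M t) \<le> ennreal (D t \<omega>)"
    and dom_backward_meas: "\<And>t. t \<in> {1..horizon M} \<Longrightarrow>
      (\<lambda>(s, a). D' t s a) \<in> borel_measurable (sa_space M t)"
    and dom_backward: "\<And>t. t \<in> {1..horizon M} \<Longrightarrow>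
      \<forall>\<^sub>F \<epsilon> in at_right 0. AE (s, a\<^sub>0) in sa_law M t.
        \<bar>((\<integral>a. q t s a \<partial>Mk t \<epsilon> (s, a\<^sub>0)) - q t s a\<^sub>0) / \<epsilon>\<bar> \<le> D' t s a\<^sub>0"
    and dom_backward_int: "\<And>t. t \<in> {1..horizon M} \<Longrightarrow>
      (\<integral>\<^sup>+\<omega>. (\<integral>\<^sup>+a\<^sub>0. ennreal (D' t (hist M t \<omega>) a\<^sub>0) * ennreal (\<pi> t (hist M t \<omega>) a\<^sub>0)
         \<partial>act_space M t) \<partial>obs M) < \<infinity>"
    and path_integrable:
      "\<forall>\<^sub>F \<epsilon> in at_right 0. integrable (cf_law M K (\<pi>\<epsilon> \<epsilon>)) (discounted_sum M \<gamma>)"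
    and path_dom: "\<And>t. t \<in> {1..horizon M} \<Longrightarrow> path_dominated M \<pi> \<pi>\<epsilon> q t"
  shows "\<exists>\<Theta>.
    ((\<lambda>\<epsilon>. \<integral>z. discounted_sum M \<gamma> z \<partial>cf_law M K (\<pi>\<epsilon> \<epsilon>)) has_real_derivative \<Theta>)
       (at 0 within {0..<eps}) \<and>
    \<Theta> = (\<Sum>t\<in>{1..horizon M}. \<gamma> ^ (t - 1) *
           (\<integral>\<omega>. pairing M t (Lf t) (q t) (hist M t \<omega>) \<partial>obs M)) \<and>
    \<Theta> = (\<Sum>t\<in>{1..horizon M}. \<gamma> ^ (t - 1) *
           (\<integral>\<omega>. score \<pi> Lf t (hist M t \<omega>) (action M t \<omega>) * ret M \<gamma> t \<omega> \<partial>obs M)) \<and>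
    \<Theta> = (\<Sum>t\<in>{1..horizon M}. \<gamma> ^ (t - 1) *
           (\<integral>\<omega>. pairing M t (Lb t (q t)) (\<pi> t) (hist M t \<omega>) \<partial>obs M)) \<and>
    \<Theta> = (\<Sum>t\<in>{1..horizon M}. \<gamma> ^ (t - 1) *
           (\<integral>\<omega>. Lb t (q t) (hist M t \<omega>) (action M t \<omega>) \<partial>obs M))"
proof -
  interpret status_quo_model M \<pi> by unfold_locales fact+
  let ?T = "horizon M"
  have eps: "0 < eps" using path by (simp add: convolutional_path_def)
  have small: "\<forall>\<^sub>F \<epsilon> in at_right 0. \<epsilon> \<in> {0..<eps}"
    using eventually_at_right_real[OF eps] by eventually_elim auto
  have pol: "is_policy M (\<pi>\<epsilon> \<epsilon>)" if "\<epsilon> \<in> {0..<eps}" for \<epsilon>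
    using path that unfolding convolutional_path_def by blast
  have Mk_meas: "Mk t \<epsilon> \<in> measurable (sa_space M t) (prob_algebra (act_space M t))"
    and Mk_conv: "AE s in hist_law M t. density (act_space M t) (\<lambda>a. ennreal (\<pi>\<epsilon> \<epsilon> t s a)) =
           density (act_space M t) (\<lambda>a. ennreal (\<pi> t s a)) \<bind> (\<lambda>a\<^sub>0. Mk t \<epsilon> (s, a\<^sub>0))"
    if "t \<in> {1..?T}" "\<epsilon> \<in> {0..<eps}" for t \<epsilon>
    using path that unfolding convolutional_path_def by blast+
  have Mk_0: "Mk t 0 (s, a\<^sub>0) = return (act_space M t) a\<^sub>0"
    if "t \<in> {1..?T}" "s \<in> space (hist_space M t)" "a\<^sub>0 \<in> space (act_space M t)" for t s a\<^sub>0
    using path that unfolding convolutional_path_def by blast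
  have Mk_ac: "\<forall>\<^sub>F \<epsilon> in at_right 0. AE s in hist_law M t. AE a in act_space M t. \<pi> t s a = 0 \<longrightarrow> \<pi>\<epsilon> \<epsilon> t s a = 0"
    if "t \<in> {1..?T}" for t
    using path that unfolding convolutional_path_def by blast
  have Lb_meas: "(\<lambda>(s, a). Lb t (q t) s a) \<in> borel_measurable (sa_space M t)"
    and Lb_lim: "AE (s, a\<^sub>0) in sa_law M t.
      ((\<lambda>\<epsilon>. ((\<integral>a. q t s a \<partial>Mk t \<epsilon> (s, a\<^sub>0)) - q t s a\<^sub>0) / \<epsilon>) \<longlongrightarrow> Lb t (q t) s a\<^sub>0) (at_right 0)"
    if t: "t \<in> {1..?T}" for t
  proof -
    have "\<forall>f\<in>Q t. (\<lambda>(s, a). Lb t f s a) \<in> borel_measurable (sa_space M t) \<and>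
        (AE (s, a\<^sub>0) in sa_law M t.
          (\<forall>\<^sub>F \<epsilon> in at_right 0. integrable (Mk t \<epsilon> (s, a\<^sub>0)) (f s)) \<and>
          ((\<lambda>\<epsilon>. ((\<integral>a. f s a \<partial>Mk t \<epsilon> (s, a\<^sub>0)) - f s a\<^sub>0) / \<epsilon>) \<longlongrightarrow> Lb t f s a\<^sub>0) (at_right 0))"
      using path t unfolding convolutional_path_def by blast
    from bspec[OF this q_in_Q[OF t]]
    show "(\<lambda>(s, a). Lb t (q t) s a) \<in> borel_measurable (sa_space M t)"
      and "AE (s, a\<^sub>0) in sa_law M t.
        ((\<lambda>\<epsilon>. ((\<integral>a. q t s a \<partial>Mk t \<epsilon> (s, a\<^sub>0)) - q t s a\<^sub>0) / \<epsilon>) \<longlongrightarrow> Lb t (q t) s a\<^sub>0) (at_right 0)"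
      by (auto simp: case_prod_beta')
  qed
  interpret policy_path M \<pi> \<pi>\<epsilon> Lf
  proof unfold_locales
    have "\<forall>\<^sub>F \<epsilon> in at_right 0. \<forall>t\<in>{1..?T}. AE s in hist_law M t. AE a in act_space M t. \<pi> t s a = 0 \<longrightarrow> \<pi>\<epsilon> \<epsilon> t s a = 0"
      by (intro eventually_ball_finite ballI Mk_ac) auto
    with small show "\<forall>\<^sub>F \<epsilon> in at_right 0. abs_cont (\<pi>\<epsilon> \<epsilon>)"
      unfolding abs_cont_def by eventually_elim (use pol in blast)
    fix t assume t: "t \<in> {1..?T}"
    then show "(\<lambda>(s, a). Lf t s a) \<in> borel_measurable (sa_space M t)"
      and "AE (s, a) in hist_law M t \<Otimes>\<^sub>M act_space M t.
        ((\<lambda>\<epsilon>. (\<pi>\<epsilon> \<epsilon> t s a - \<pi> t s a) / \<epsilon>) \<longlongrightarrow> Lf t s a) (at_right 0)"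
      using path unfolding convolutional_path_def by blast+
  qed
  \<comment> \<open>The common value of all four stage expressions; each representation is reduced
    to it separately.\<close>
  define I where "I t = (\<integral>(\<omega>, a). q t (hist M t \<omega>) a * Lf t (hist M t \<omega>) a \<partial>(obs M \<Otimes>\<^sub>M act_space M t))" for t
  have base: "(\<integral>z. discounted_sum M \<gamma> z \<partial>cf_law M K (\<pi>\<epsilon> 0)) = (\<integral>\<omega>. ret M \<gamma> 1 \<omega> \<partial>obs M)"
  proof (rule baseline_value[OF _ transition])
    show "is_policy M (\<pi>\<epsilon> 0)" using pol eps by auto
    fix t assume t: "t \<in> {1..?T}"
    have "AE s in hist_law M t. density (act_space M t) (\<lambda>a. ennreal (\<pi>\<epsilon> 0 t s a)) =
           density (act_space M t) (\<lambda>a. ennreal (\<pi> t s a)) \<bind> (\<lambda>a\<^sub>0. Mk t 0 (s, a\<^sub>0))"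
      using Mk_conv[OF t] eps by auto
    then show "AE s in hist_law M t. density (act_space M t) (\<lambda>a. ennreal (\<pi>\<epsilon> 0 t s a)) =
        density (act_space M t) (\<lambda>a. ennreal (\<pi> t s a))"
      using AE_space
    proof eventually_elim
      case (elim s)
      have s: "s \<in> space (hist_space M t)" using elim(2) by (simp add: hist_law_def)
      let ?D = "density (act_space M t) (\<lambda>a. ennreal (\<pi> t s a))"
      \<comment> \<open>The kernel at 0 is known to be Dirac only at actions of the space, which is
        all that the bind sees; the right unit law then removes it.\<close>
      have "?D \<bind> (\<lambda>a\<^sub>0. Mk t 0 (s, a\<^sub>0)) = ?D \<bind> return (act_space M t)"
        by (intro bind_cong_All ballI) (simp add: Mk_0[OF t s])
      also have "\<dots> = ?D" by (rule bind_return'') simp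
      finally show ?case using elim(1) by simp
    qed
  qed
  have qm: "(\<lambda>(s, a). q t s a) \<in> borel_measurable (sa_space M t)" if "t \<in> {1..?T}" for t
    using value_fun that by (simp add: is_action_value_def)
  have deriv: "((\<lambda>\<epsilon>. \<integral>z. discounted_sum M \<gamma> z \<partial>cf_law M K (\<pi>\<epsilon> \<epsilon>)) has_real_derivative
      (\<Sum>t\<in>{1..?T}. \<gamma> ^ (t - 1) * I t)) (at 0 within {0..<eps})"
    unfolding I_def by (rule value_derivative[OF transition value_fun moment_ret path_integrable path_dom base])
  have forward: "(\<integral>\<omega>. pairing M t (Lf t) (q t) (hist M t \<omega>) \<partial>obs M) = I t" if t: "t \<in> {1..?T}" for t
    unfolding I_def by (rule pairing_integral[OF t integrable_forward[OF t qm[OF t] path_dom[OF t]]])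
  have score: "(\<integral>\<omega>. score \<pi> Lf t (hist M t \<omega>) (action M t \<omega>) * ret M \<gamma> t \<omega> \<partial>obs M) = I t"
    if t: "t \<in> {1..?T}" for t
    unfolding I_def by (rule score_eq_forward[OF t value_fun moment_ret[OF t] moment_score[OF t]])
  have backward: "integrable (obs M) (\<lambda>\<omega>. Lb t (q t) (hist M t \<omega>) (action M t \<omega>))"
    "(\<integral>\<omega>. Lb t (q t) (hist M t \<omega>) (action M t \<omega>) \<partial>obs M) = I t" if t: "t \<in> {1..?T}" for t
  proof -
    have k: "\<forall>\<^sub>F \<epsilon> in at_right 0. Mk t \<epsilon> \<in> measurable (sa_space M t) (prob_algebra (act_space M t))"
      using small by eventually_elim (rule Mk_meas[OF t])
    have conv: "\<forall>\<^sub>F \<epsilon> in at_right 0. AE s in hist_law M t. density (act_space M t) (\<lambda>a. ennreal (\<pi>\<epsilon> \<epsilon> t s a)) =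
           density (act_space M t) (\<lambda>a. ennreal (\<pi> t s a)) \<bind> (\<lambda>a\<^sub>0. Mk t \<epsilon> (s, a\<^sub>0))"
      using small by eventually_elim (rule Mk_conv[OF t])
    note hyps = t value_fun moment_ret[OF t] path_dom[OF t] dom_forward_int[OF t] dom_forward[OF t]
      dom_backward_meas[OF t] dom_backward[OF t] dom_backward_int[OF t] k conv Lb_meas[OF t] Lb_lim[OF t]
    show "integrable (obs M) (\<lambda>\<omega>. Lb t (q t) (hist M t \<omega>) (action M t \<omega>))"
      by (rule integrable_backward[OF hyps])
    show "(\<integral>\<omega>. Lb t (q t) (hist M t \<omega>) (action M t \<omega>) \<partial>obs M) = I t"
      unfolding I_def by (rule backward_eq_forward[OF hyps])
  qed
  have backward_pairing: "(\<integral>\<omega>. pairing M t (Lb t (q t)) (\<pi> t) (hist M t \<omega>) \<partial>obs M) = I t"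
    if t: "t \<in> {1..?T}" for t
  proof -
    interpret policy_stage "obs M" "act_space M t" "hist_space M t" "hist M t" "action M t" "\<pi> t"
      by (rule stage[OF t])
    have m: "(\<lambda>(s, a). Lb t (q t) s a) \<in> borel_measurable (hist_space M t \<Otimes>\<^sub>M act_space M t)"
      using Lb_meas[OF t] by (simp add: sa_space_def)
    \<comment> \<open>Fubini unfolds the pairing, and \<open>integral_law\<close> reads the inner
      integral as a draw of the action from \<open>\<pi>\<close>. The integrability that Fubini asks
      for comes from the dominated limit.\<close>
    have "(\<integral>\<omega>. pairing M t (Lb t (q t)) (\<pi> t) (hist M t \<omega>) \<partial>obs M) =
        (\<integral>(\<omega>, a). \<pi> t (hist M t \<omega>) a * Lb t (q t) (hist M t \<omega>) a \<partial>(obs M \<Otimes>\<^sub>M act_space M t))"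
      by (rule pairing_integral[OF t]) (use backward(1)[OF t] integrable_law_iff[OF m] in blast)
    also have "\<dots> = I t" unfolding integral_law[OF m, symmetric] by (rule backward(2)[OF t])
    finally show ?thesis .
  qed
  show ?thesis
    by (intro exI[of _ "\<Sum>t\<in>{1..?T}. \<gamma> ^ (t - 1) * I t"] conjI deriv sum.cong arg_cong2[where f = times] refl)
       (simp_all only: forward score backward(2) backward_pairing)
qed

end
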